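(* Let $k\ge-4$ be an integer and let $\mathcal S$ be a nonlocal symmetry of the Gibbons–Tsarev equation in the covering $\tau_*$ which is polynomial in all variables and homogeneous of weight $k$. Then $\mathcal S=c\,S^{(k)}$ for some constant $c\in\mathbb R$.
   Context: The Gibbons–Tsarev equation is $z_{yy}+z_xz_{xy}-z_yz_{xx}+1=0$, with internal coordinates $x,y,z_X$ ($z_X=\partial^{a+b}z/\partial x^a\partial y^b$ for $X=x^ay^b$, $b\in\{0,1\}$) and total derivatives $D_x,D_y$. Let $\sigma_0=1$ and $\sigma_m=\sum_{0\le j\le m-j}\binom{m-j}{j}z_x^{m-2j}z_y^j$. Put $\psi^{(1)}=y$, $\psi^{(2)}=x$, $\psi^{(3)}=z-\tfrac12y^2$, and for $k\ge2$ let $X^{(k)}=\sigma_{k-2}-\sum_{i=1}^{k-3}i\,\sigma_{k-i-3}\psi^{(i)}$, and for $k\ge3$ let $Y^{(k)}=z_yX^{(k-1)}-(k-2)\psi^{(k-2)}$. The covering $\tau_*$ has coordinates $x,y,z_X$ and new coordinates $\psi^{(k)}$, $k\ge4$, with total derivatives $D^{( * )}_x=D_x+\sum_{k\ge4}X^{(k)}\partial/\partial\psi^{(k)}$, $D^{( * )}_y=D_y+\sum_{k\ge4}Y^{(k)}\partial/\partial\psi^{(k)}$. A nonlocal symmetry in $\tau_*$ is a vector field on this space without $\partial/\partial x,\partial/\partial y$ components commuting with $D^{( * )}_x$ and $D^{( * )}_y$. Weights: $\mathrm{wt}\,x=3$, $\mathrm{wt}\,y=2$, $\mathrm{wt}\,z_{x^ay^b}=4-3a-2b$,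 $\mathrm{wt}\,\psi^{(j)}=j+1$, extended additively to monomials; a vector field $\sum_q c_q\,\partial/\partial q$ ($q$ running over coordinates) is polynomial of weight $k$ if each $c_q$ is a weighted-homogeneous polynomial in the coordinates of weight $\mathrm{wt}\,q+k$. The symmetries $S^{(k)}$: let $\varphi(\lambda)=1/\lambda+\sum_{j\ge1}\varphi^{(j)}\lambda^j$ and $\psi(\mu)=\mu+\sum_{j\ge1}\psi^{(j)}\mu^{-j}$, and relate the coordinates $\varphi^{(j)}$ and $\psi^{(j)}$ (each a polynomial in the others of the same index range) by the formal identity $\psi(\varphi(\lambda))=1/\lambda$; then $\varphi^{(1)}=-y$, $\varphi^{(2)}=-x$, $\varphi^{(3)}=-z-\tfrac12y^2$, and in the coordinates $\varphi^{(j)}$ the total derivatives satisfy $(\varphi^2-z_x\varphi-z_y)\varphi_x=-1$, $(\varphi^2-z_x\varphi-z_y)\varphi_y=-(\varphi-z_x)$ coefficientwise in $\lambda$ (with $\varphi_x=\sum_j D^{( * )}_x(\varphi^{(j)})\lambda^j$, etc.). For $n\in\mathbb Z$ let $f_n=\mathfrak P_\varphi(\lambda^n\varphi_\lambda)=\sum_{i\ge1}f^{(i)}\lambda^i$, where, with $\varphi_\lambda=d\varphi/d\lambda$, $\mathfrak P_\varphi F=F-\sum_{j=0}^m c_j\varphi^j$ if $F=\sum_{j\le m}c_j\varphi(\lambda)^j$ is the unique expansion of the Laurent series $F$ in powers of $\varphi(\lambda)$ with $\lambda$-independent coefficients $c_j$. Then $S^{(k)}$ is the vector field $\sum_X\tilde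 D_X(Z)\partial/\partial z_X+(\text{components on the nonlocal coordinates})$ with $\tilde D_X$ compositions of total derivatives, generating function $Z=(z_y+y)f^{(1)}+z_xf^{(2)}-f^{(3)}$ for $n=1-k$, and $\varphi^{(j)}$-components $f^{(j)}+f^{(2)}D^{( * )}_x\varphi^{(j)}+f^{(1)}D^{( * )}_y\varphi^{(j)}$ ($j\ge4$); it is a symmetry in $\tau_*$ of weight $k$ (for $k=-4,\dots,0$ its generating functions are, up to constant factors, $1$, $z_x$, $z_y$, $yz_x-2x$, $3xz_x+2yz_y-4z$). *)

theory Defs
  imports Complex_Main "HOL-Library.Poly_Mapping" "HOL-Computational_Algebra.Formal_Power_Series"
begin

text \<open>Coordinates: x, y, z_(x^a) (Zx a), z_(x^a y) (Zxy a), and the nonlocal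
  coordinates psi^(n+4) (Psi n), n >= 0.  (z_(yy...) are eliminated via the equation.)\<close>
datatype coord = Xc | Yc | Zx nat | Zxy nat | Psi nat

type_synonym gtpoly = "(coord \<Rightarrow>\<^sub>0 nat) \<Rightarrow>\<^sub>0 real"

definition var :: "coord \<Rightarrow> gtpoly" where
  "var q = Poly_Mapping.single (Poly_Mapping.single q 1) 1"

definition cst :: "real \<Rightarrow> gtpoly" where
  "cst c = Poly_Mapping.single 0 c"

definition vars :: "gtpoly \<Rightarrow> coord set" where
  "vars p = (\<Union>m\<in>Poly_Mapping.keys p. Poly_Mapping.keys m)"

definition pderiv_c :: "coord \<Rightarrow> gtpoly \<Rightarrow> gtpoly" where
  "pderiv_c q p = (\<Sum>m\<in>Poly_Mapping.keys p.
      Poly_Mapping.single (m - Poly_Mapping.single q 1) (Poly_Mapping.lookup p m * of_nat (Poly_Mapping.lookup m q)))"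

text \<open>A vector field is given by its components: V q is the coefficient of d/dq.
  Its action on a polynomial (a finite sum).\<close>
type_synonym vfield = "coord \<Rightarrow> gtpoly"

definition vf_app :: "vfield \<Rightarrow> gtpoly \<Rightarrow> gtpoly" where
  "vf_app V p = (\<Sum>q\<in>vars p. V q * pderiv_c q p)"

definition zx :: gtpoly where "zx = var (Zx 1)"
definition zy :: gtpoly where "zy = var (Zxy 0)"

definition sigma :: "nat \<Rightarrow> gtpoly" where
  "sigma m = (\<Sum>j\<in>{j. j \<le> m - j \<and> j \<le> m}. of_nat ((m - j) choose j) * zx ^ (m - 2 * j) * zy ^ j)"

text \<open>psi^(i) for i >= 1\<close>
definition psi :: "nat \<Rightarrow> gtpoly" where
  "psi i = (if i = 1 then var Yc else if i = 2 then var Xc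
            else if i = 3 then var (Zx 0) - cst (1/2) * (var Yc)^2
            else var (Psi (i - 4)))"

definition Xk :: "nat \<Rightarrow> gtpoly" where
  "Xk k = sigma (k - 2) - (\<Sum>i=1..k-3. of_nat i * sigma (k - i - 3) * psi i)"

definition Yk :: "nat \<Rightarrow> gtpoly" where
  "Yk k = zy * Xk (k - 1) - of_nat (k - 2) * psi (k - 2)"

definition Dx :: vfield where
  "Dx q = (case q of Xc \<Rightarrow> 1 | Yc \<Rightarrow> 0 | Zx a \<Rightarrow> var (Zx (Suc a))
             | Zxy a \<Rightarrow> var (Zxy (Suc a)) | Psi n \<Rightarrow> Xk (n + 4))"

text \<open>z_yy expressed through the equation z_yy + z_x z_xy - z_y z_xx + 1 = 0\<close>
definition zyy :: gtpoly where
  "zyy = zy * var (Zx 2) - zx * var (Zxy 1) - 1"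

definition Dy :: vfield where
  "Dy q = (case q of Xc \<Rightarrow> 0 | Yc \<Rightarrow> 1 | Zx a \<Rightarrow> var (Zxy a)
             | Zxy a \<Rightarrow> (vf_app Dx ^^ a) zyy | Psi n \<Rightarrow> Yk (n + 4))"

definition nonlocal_symmetry :: "vfield \<Rightarrow> bool" where
  "nonlocal_symmetry S \<longleftrightarrow> S Xc = 0 \<and> S Yc = 0 \<and>
     (\<forall>q. vf_app S (Dx q) = vf_app Dx (S q)) \<and>
     (\<forall>q. vf_app S (Dy q) = vf_app Dy (S q))"

fun wt :: "coord \<Rightarrow> int" where
  "wt Xc = 3" | "wt Yc = 2" | "wt (Zx a) = 4 - 3 * int a" | "wt (Zxy a) = 2 - 3 * int a"
| "wt (Psi n) = int n + 5"

definition mono_wt :: "(coord \<Rightarrow>\<^sub>0 nat) \<Rightarrow> int" where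
  "mono_wt m = (\<Sum>q\<in>Poly_Mapping.keys m. int (Poly_Mapping.lookup m q) * wt q)"

definition homogeneous :: "int \<Rightarrow> gtpoly \<Rightarrow> bool" where
  "homogeneous w p \<longleftrightarrow> (\<forall>m\<in>Poly_Mapping.keys p. mono_wt m = w)"

definition poly_vf_of_weight :: "int \<Rightarrow> vfield \<Rightarrow> bool" where
  "poly_vf_of_weight k V \<longleftrightarrow> (\<forall>q. homogeneous (wt q + k) (V q))"

text \<open>psi(mu) = mu + sum_j psi^(j) mu^(-j), phi(lambda) = 1/lambda + sum_j phi^(j) lambda^j =
  lambda^(-1) u(lambda) with u = 1 + lambda Phi(lambda), Phi = sum_j phi^(j) lambda^j.
  Then phi^(-j) = lambda^j u^(-j), and psi(phi(lambda)) = 1/lambda reads, coefficientwise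
  in lambda^n (n >= 1):  phi^(n) + sum_(j=1..n) psi^(j) [lambda^(n-j)] u^(-j) = 0.\<close>

definition ufps :: "gtpoly fps \<Rightarrow> gtpoly fps" where
  "ufps Phi = 1 + fps_X * Phi"

definition uinv :: "gtpoly fps \<Rightarrow> gtpoly fps" where
  "uinv Phi = fps_right_inverse (ufps Phi) 1"

definition phi_rel :: "gtpoly fps \<Rightarrow> bool" where
  "phi_rel Phi \<longleftrightarrow> fps_nth Phi 0 = 0 \<and>
     (\<forall>n\<ge>1. fps_nth Phi n + (\<Sum>j=1..n. psi j * fps_nth (uinv Phi ^ j) (n - j)) = 0)"

definition PhiS :: "gtpoly fps" where
  "PhiS = (THE Phi. phi_rel Phi)"

definition phi :: "nat \<Rightarrow> gtpoly" where
  "phi j = fps_nth PhiS j"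

text \<open>Coefficient of lambda^e in phi(lambda)^j (j integer): phi^j = lambda^(-j) U_j
  with U_j = u^j (j >= 0), U_j = (u^(-1))^(-j) (j < 0).\<close>
definition phipow_coef :: "int \<Rightarrow> int \<Rightarrow> gtpoly" where
  "phipow_coef j e = (let d = e + j in if d < 0 then 0
      else if j \<ge> 0 then fps_nth (ufps PhiS ^ nat j) (nat d)
      else fps_nth (uinv PhiS ^ nat (- j)) (nat d))"

text \<open>Coefficient of lambda^e in lambda^n phi_lambda, with
  phi_lambda = -lambda^(-2) + sum_j j phi^(j) lambda^(j-1).\<close>
definition Fcoef :: "int \<Rightarrow> int \<Rightarrow> gtpoly" where
  "Fcoef n e = (if e = n - 2 then -1
      else if e - n + 1 \<ge> 1 then of_int (e - n + 1) * phi (nat (e - n + 1)) else 0)"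

text \<open>The unique expansion lambda^n phi_lambda = sum_(j <= 2-n) c_j phi^j with
  lambda-independent coefficients c_j (the sum is finite in each lambda-degree).\<close>
definition expansion_coefs :: "int \<Rightarrow> int \<Rightarrow> gtpoly" where
  "expansion_coefs n = (THE c. (\<forall>j>2 - n. c j = 0) \<and>
      (\<forall>e. Fcoef n e = (\<Sum>j\<in>{-e..2 - n}. c j * phipow_coef j e)))"

text \<open>f_n = P_phi(lambda^n phi_lambda) = sum_i f^(i) lambda^i: coefficient of lambda^l.\<close>
definition fcoef :: "int \<Rightarrow> nat \<Rightarrow> gtpoly" where
  "fcoef n l = Fcoef n (int l) -
      (\<Sum>j\<in>{0..2 - n}. expansion_coefs n j * phipow_coef j (int l))"

definition genZ :: "int \<Rightarrow> gtpoly" where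
  "genZ k = (let n = 1 - k in (zy + var Yc) * fcoef n 1 + zx * fcoef n 2 - fcoef n 3)"

definition Sk :: "int \<Rightarrow> vfield" where
  "Sk k = (THE V. V Xc = 0 \<and> V Yc = 0 \<and>
     (\<forall>a. V (Zx a) = (vf_app Dx ^^ a) (genZ k)) \<and>
     (\<forall>a. V (Zxy a) = (vf_app Dx ^^ a) (vf_app Dy (genZ k))) \<and>
     (\<forall>j\<ge>4. vf_app V (phi j) =
        fcoef (1 - k) j + fcoef (1 - k) 2 * vf_app Dx (phi j) + fcoef (1 - k) 1 * vf_app Dy (phi j)))"

end

theory Submission
  imports Defs
begin

text \<open>
  Grade the coordinates by differential order and put \<open>\<psi>(\<mu>) = \<mu> + \<Sum>\<^sub>j \<psi>\<^sup>(\<^sup>j\<^sup>) \<mu>\<^sup>-\<^sup>j\<close>, \<open>t = 1/\<mu>\<close>. Suppose that a symmetry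
  with generating function \<open>Z\<close> has order at least two. The top degree part of its \<open>\<psi>\<close>-components,
  divided by \<open>\<psi>'(\<mu>)\<close>, is by Euler's identity a rational function of \<open>t\<close> whose denominator is a power
  of \<open>1 - z\<^sub>x t - z\<^sub>y t\<^sup>2\<close>. A multiple pole would become worse under \<open>D\<^sub>x\<close>, and the residue of a simple
  pole would not involve derivatives; so this part vanishes, and \<open>Z\<close> has order at most one.
  Compatibility of the first order equations then shows that every power of the discriminant
  \<open>z\<^sub>x\<^sup>2 + 4 z\<^sub>y\<close> divides the second derivatives obstructing that \<open>Z\<close> is affine in \<open>z\<^sub>x\<close> and \<open>z\<^sub>y\<close>.

  Subtracting multiples of \<open>D\<^sub>x\<close>, \<open>D\<^sub>y\<close> leaves a field \<open>\<psi> \<mapsto> - F(\<mu>) \<psi>'(\<mu>)\<close> whose coefficients \<open>F\<^sub>j\<close> depend on the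
  \<open>\<psi>\<^sup>(\<^sup>i\<^sup>)\<close> only. Substituting \<open>z\<^sub>x = q\<^sub>1 + q\<^sub>2\<close>, \<open>z\<^sub>y = - q\<^sub>1 q\<^sub>2\<close> in the symmetry condition and comparing powers of
  \<open>q\<^sub>1\<close>, \<open>q\<^sub>2\<close> gives relations between the \<open>F\<^sub>j\<close> and the fields \<open>L\<^sub>m : \<psi> \<mapsto> - t\<^sup>m\<^sup>-\<^sup>1 \<psi>'\<close>, which satisfy
  \<open>[L\<^sub>a, L\<^sub>b] = (a - b) L\<^sub>a\<^sub>+\<^sub>b\<close>. With these commutators \<open>F\<^sub>j = G\<^sub>-\<^sub>j\<close> extends to a family \<open>G\<^sub>j\<close>, \<open>j \<in> \<int>\<close>, with
  \<open>L\<^sub>m G\<^sub>j = (1 - j - 2m) G\<^sub>j\<^sub>+\<^sub>m\<close>. The coefficients of the expansion of \<open>\<lambda>\<^sup>n \<phi>\<^sub>\<lambda>\<close> in powers of \<open>\<phi>\<close> satisfy the same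
  recursion, and a function of the \<open>\<psi>\<^sup>(\<^sup>i\<^sup>)\<close> annihilated by all \<open>L\<^sub>m\<close> is constant; since the weight leaves
  room for a constant at one index only, the two families are proportional.\<close>

text \<open>In generating form the covering is D_x psi = t^2 psi' / (1 - z_x t - z_y t^2), and D_y
  psi is psi' times (t - z_x t^2) / (1 - z_x t - z_y t^2). Statements about infinitely many
  components become identities of series in t, with poles at the characteristic roots. On functions
  of x, y, z and the psi^(i), partial fractions turn D_y + q_1 D_x into psi' t / (1 - q_1 t), whose
  geometric expansion produces the fields L_m; this is why the roots are substituted.

  The factor 1 - j - 2m has this origin: L_m moves phi by phi^(1-m), hence multiplies phi_lambda by
  (1-m) phi^(-m), and comparing powers of phi in the expansion of lambda^n phi_lambda shifts the
  index by m.

  \<open>Sk\<close> is a definite description. It is identified by showing that S divided by the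
  proportionality factor meets the defining conditions and that these determine a field; if the
  factor is zero, S itself vanishes.\<close>

fun coord_code :: "coord \<Rightarrow> nat" where
  "coord_code Xc = 0" | "coord_code Yc = 1" | "coord_code (Zx a) = 3 * a + 2"
| "coord_code (Zxy a) = 3 * a + 3" | "coord_code (Psi a) = 3 * a + 4"

lemma inj_coord_code: "inj coord_code"
proof (rule injI)
  fix p q assume "coord_code p = coord_code q"
  then show "p = q" by (cases p; cases q; simp; presburger)
qed

text \<open>A linear order on the coordinates makes the monomials linearly ordered, so that the
  library provides the instance \<open>gtpoly :: idom\<close>.\<close>

instantiation coord :: linorder
begin
definition "less_eq_coord p q \<longleftrightarrow> coord_code p \<le> coord_code q"
definition "less_coord p q \<longleftrightarrow> coord_code p < coord_code q"
instance
  by standard (auto simp: less_eq_coord_def less_coord_def dest: injD[OF inj_coord_code])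
end

subsection \<open>Polynomials and derivations\<close>

lemma lookup_sum_single:
  "finite M \<Longrightarrow> Poly_Mapping.lookup (\<Sum>m\<in>M. Poly_Mapping.single m (f m)) k = (if k \<in> M then f k else 0)"
  by (simp add: lookup_sum lookup_single when_def)

lemma gtpoly_sum_single:
  fixes p :: gtpoly
  shows "p = (\<Sum>m\<in>Poly_Mapping.keys p. Poly_Mapping.single m (Poly_Mapping.lookup p m))"
  by (rule poly_mapping_eqI) (auto simp: lookup_sum_single in_keys_iff)

lemma gtpoly_induct_single [case_names add single]:
  fixes p :: gtpoly
  assumes "\<And>p q. P p \<Longrightarrow> P q \<Longrightarrow> P (p + q)" and single: "\<And>m c. P (Poly_Mapping.single m c)"
  shows "P p"
proof -
  have P0: "P 0" using single[of 0 0] by simp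
  have "finite M \<Longrightarrow> P (\<Sum>m\<in>M. Poly_Mapping.single m (Poly_Mapping.lookup p m))" for M
    by (induction M rule: finite_induct) (auto intro: assms P0)
  then show ?thesis by (subst gtpoly_sum_single) simp
qed

lemma var_power: "var q ^ n = Poly_Mapping.single (Poly_Mapping.single q n) 1"
  by (induction n) (simp_all add: var_def mult_single single_add[symmetric])

lemma cst_add: "cst (a + b) = cst a + cst b" by (simp add: cst_def single_add)
lemma cst_mult: "cst (a * b) = cst a * cst b" by (simp add: cst_def mult_single)
lemma cst_0 [simp]: "cst 0 = 0" by (simp add: cst_def)
lemma cst_1 [simp]: "cst 1 = 1" by (simp add: cst_def)
lemma cst_minus: "cst (- a) = - cst a" by (simp add: cst_def single_uminus)
lemma cst_of_nat: "cst (of_nat n) = of_nat n" by (induction n) (simp_all add: cst_add)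
lemma cst_diff: "cst (a - b) = cst a - cst b" by (simp add: cst_def single_diff)
lemma cst_of_int: "cst (of_int n) = of_int n"
  by (cases n rule: int_diff_cases) (simp add: cst_diff cst_of_nat)
lemma cst_numeral: "cst (numeral n) = numeral n" using cst_of_nat[of "numeral n"] by simp

lemma gtpoly_induct [case_names add cst var]:
  fixes p :: gtpoly
  assumes add: "\<And>p q. P p \<Longrightarrow> P q \<Longrightarrow> P (p + q)" and cst: "\<And>c. P (cst c)"
    and var: "\<And>p q. P p \<Longrightarrow> P (var q * p)"
  shows "P p"
proof (induction p rule: gtpoly_induct_single)
  case (single m c)
  show ?case
  proof (induction m rule: update_induct)
    case const
    then show ?case using cst by (simp add: cst_def)
  next
    case (update f a b)
    have "Poly_Mapping.update a b f = Poly_Mapping.single a b + f"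
      using update(1) by (intro poly_mapping_eqI) (auto simp: lookup_update lookup_add lookup_single in_keys_iff when_def)
    then have "Poly_Mapping.single (Poly_Mapping.update a b f) c = var a ^ b * Poly_Mapping.single f c"
      by (simp add: var_power mult_single)
    moreover have "P (var a ^ n * Poly_Mapping.single f c)" for n
      by (induction n) (use update var in \<open>auto simp: mult.assoc\<close>)
    ultimately show ?case by simp
  qed
qed (rule add)

definition derivation :: "(gtpoly \<Rightarrow> gtpoly) \<Rightarrow> bool" where
  "derivation D \<longleftrightarrow> (\<forall>p q. D (p + q) = D p + D q) \<and> (\<forall>p q. D (p * q) = D p * q + p * D q) \<and> (\<forall>c. D (cst c) = 0)"

lemma derivationI:
  assumes "\<And>p q. D (p + q) = D p + D q" "\<And>p q. D (p * q) = D p * q + p * D q" "\<And>c. D (cst c) = 0"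
  shows "derivation D"
  using assms by (simp add: derivation_def)

lemma derivationD:
  assumes "derivation D"
  shows "D (p + q) = D p + D q" "D (p * q) = D p * q + p * D q" "D (cst c) = 0"
  using assms by (auto simp: derivation_def)

lemma derivation_simps:
  assumes "derivation D"
  shows "D (p + q) = D p + D q" "D (p * q) = D p * q + p * D q" "D (cst c) = 0"
    "D 0 = 0" "D 1 = 0" "D (- p) = - D p" "D (p - q) = D p - D q"
    "D (of_nat n) = 0" "D (of_int i) = 0" "D (numeral w) = 0"
    "D (p ^ n) = of_nat n * p ^ (n - 1) * D p"
proof -
  note [simp] = derivationD[OF assms]
  show "D (p + q) = D p + D q" "D (p * q) = D p * q + p * D q" "D (cst c) = 0" by simp_all
  show 0: "D 0 = 0" using derivationD(3)[OF assms, of 0] by simp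
  show 1: "D 1 = 0" using derivationD(3)[OF assms, of 1] by simp
  have m: "D (- p) = - D p" for p
    using derivationD(1)[OF assms, of p "- p"] 0 by (simp add: eq_neg_iff_add_eq_0 add.commute)
  then show "D (- p) = - D p" .
  show "D (p - q) = D p - D q" using derivationD(1)[OF assms, of p "- q"] m by simp
  show "D (of_nat n) = 0" using derivationD(3)[OF assms, of "of_nat n"] unfolding cst_of_nat .
  show "D (of_int i) = 0" using derivationD(3)[OF assms, of "of_int i"] unfolding cst_of_int .
  show "D (numeral w) = 0" using derivationD(3)[OF assms, of "numeral w"] unfolding cst_numeral .
  show "D (p ^ n) = of_nat n * p ^ (n - 1) * D p"
  proof (induction n)
    case (Suc n)
    then show ?case by (cases n) (simp_all add: algebra_simps)
  qed (simp add: 1)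
qed

lemma derivation_sum: "derivation D \<Longrightarrow> D (\<Sum>i\<in>I. f i) = (\<Sum>i\<in>I. D (f i))"
  by (induction I rule: infinite_finite_induct) (simp_all add: derivation_simps)

lemma derivation_cmult: "derivation D \<Longrightarrow> D (cst c * p) = cst c * D p"
  by (simp add: derivation_simps)

lemma derivation_plus: "derivation D \<Longrightarrow> derivation D' \<Longrightarrow> derivation (\<lambda>p. D p + D' p)"
  by (rule derivationI) (simp_all add: derivation_simps algebra_simps)

lemma derivation_minus: "derivation D \<Longrightarrow> derivation D' \<Longrightarrow> derivation (\<lambda>p. D p - D' p)"
  by (rule derivationI) (simp_all add: derivation_simps algebra_simps)

lemma derivation_scale: "derivation D \<Longrightarrow> derivation (\<lambda>p. a * D p)"
  by (rule derivationI) (simp_all add: derivation_simps algebra_simps)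

lemma derivation_commutator: "derivation D \<Longrightarrow> derivation D' \<Longrightarrow> derivation (\<lambda>p. D (D' p) - D' (D p))"
  by (rule derivationI) (simp_all add: derivation_simps algebra_simps)

lemma derivation_zero: "derivation (\<lambda>p. 0)"
  by (rule derivationI) simp_all

lemma derivation_ext:
  assumes "derivation D" "derivation D'" and "\<And>q. D (var q) = D' (var q)"
  shows "D p = D' p"
  by (induction p rule: gtpoly_induct) (simp_all add: assms derivationD[OF assms(1)] derivationD[OF assms(2)])

lemma pderiv_c_superset:
  assumes "finite M" "Poly_Mapping.keys p \<subseteq> M"
  shows "pderiv_c q p = (\<Sum>m\<in>M. Poly_Mapping.single (m - Poly_Mapping.single q 1) (Poly_Mapping.lookup p m * of_nat (Poly_Mapping.lookup m q)))"
  unfolding pderiv_c_def using assms by (intro sum.mono_neutral_left) (auto simp: in_keys_iff)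

lemma pderiv_c_add: "pderiv_c q (p + r) = pderiv_c q p + pderiv_c q r"
proof -
  let ?M = "Poly_Mapping.keys p \<union> Poly_Mapping.keys r"
  have "finite ?M" "Poly_Mapping.keys (p + r) \<subseteq> ?M" by (auto simp: keys_add dest: subsetD[OF keys_add])
  then show ?thesis
    by (simp add: pderiv_c_superset[of ?M] lookup_add algebra_simps single_add sum.distrib)
qed

lemma pderiv_c_single:
  "pderiv_c q (Poly_Mapping.single m c) = Poly_Mapping.single (m - Poly_Mapping.single q 1) (c * of_nat (Poly_Mapping.lookup m q))"
  by (subst pderiv_c_superset[of "{m}"]) auto

lemma pderiv_c_var_mult:
  "pderiv_c q (var r * p) = (if q = r then p else 0) + var r * pderiv_c q p"
proof (induction p rule: gtpoly_induct_single)
  case (single m c)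
  show ?case
  proof (cases "q = r")
    case True
    have *: "Poly_Mapping.lookup m r > 0 \<Longrightarrow> Poly_Mapping.single r (Suc 0) + (m - Poly_Mapping.single r (Suc 0)) = m"
      by (intro poly_mapping_eqI) (auto simp: lookup_add lookup_minus lookup_single when_def)
    show ?thesis using True *
      by (cases "Poly_Mapping.lookup m r > 0")
        (simp_all add: var_def mult_single pderiv_c_single lookup_add algebra_simps single_add)
  next
    case False
    have *: "Poly_Mapping.lookup m q > 0 \<Longrightarrow> Poly_Mapping.single r (Suc 0) + m - Poly_Mapping.single q (Suc 0) = Poly_Mapping.single r (Suc 0) + (m - Poly_Mapping.single q (Suc 0))"
      using False by (intro poly_mapping_eqI) (auto simp: lookup_add lookup_minus lookup_single when_def)
    show ?thesis using False *
      by (cases "Poly_Mapping.lookup m q > 0")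
        (simp_all add: var_def mult_single pderiv_c_single lookup_add lookup_single)
  qed
qed (simp add: pderiv_c_add algebra_simps)

lemma pderiv_c_cst: "pderiv_c q (cst c) = 0"
  by (simp add: cst_def pderiv_c_single)

lemma pderiv_c_cst_mult: "pderiv_c q (cst c * p) = cst c * pderiv_c q p"
  by (induction p rule: gtpoly_induct_single)
    (simp_all add: pderiv_c_add algebra_simps cst_def mult_single pderiv_c_single)

lemma derivation_pderiv_c: "derivation (pderiv_c q)"
proof (rule derivationI)
  show "pderiv_c q (p * r) = pderiv_c q p * r + p * pderiv_c q r" for p r
    by (induction p rule: gtpoly_induct)
      (simp_all add: pderiv_c_add distrib_right distrib_left mult.assoc pderiv_c_cst pderiv_c_cst_mult pderiv_c_var_mult)
qed (simp_all add: pderiv_c_add pderiv_c_cst)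

lemma pderiv_c_var: "pderiv_c q (var r) = (if q = r then 1 else 0)"
  using pderiv_c_var_mult[of q r 1] pderiv_c_cst[of q 1] by simp

lemma finite_vars: "finite (vars p)"
  by (simp add: vars_def)

lemma pderiv_c_notin_vars: "q \<notin> vars p \<Longrightarrow> pderiv_c q p = 0"
  unfolding pderiv_c_def vars_def by (intro sum.neutral) (auto simp: in_keys_iff)

text \<open>Monomials containing q stay distinct after one factor q is removed, and the exponents
  that multiply the coefficients are nonzero reals; so no terms cancel.\<close>

lemma pderiv_c_eq_0_iff: "pderiv_c q p = 0 \<longleftrightarrow> q \<notin> vars p"
proof
  assume 0: "pderiv_c q p = 0"
  show "q \<notin> vars p"
  proof
    assume "q \<in> vars p"
    then obtain m where m: "m \<in> Poly_Mapping.keys p" "Poly_Mapping.lookup m q > 0"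
      by (auto simp: vars_def in_keys_iff)
    have inj: "m' = m" if "m' - Poly_Mapping.single q (Suc 0) = m - Poly_Mapping.single q (Suc 0)" "Poly_Mapping.lookup m' q > 0" for m'
    proof (rule poly_mapping_eqI)
      fix r
      from that(1) have "Poly_Mapping.lookup (m' - Poly_Mapping.single q (Suc 0)) r = Poly_Mapping.lookup (m - Poly_Mapping.single q (Suc 0)) r" by simp
      then show "Poly_Mapping.lookup m' r = Poly_Mapping.lookup m r"
        using m that(2) by (auto simp: lookup_minus lookup_single when_def split: if_splits)
    qed
    have "Poly_Mapping.lookup (pderiv_c q p) (m - Poly_Mapping.single q 1) =
       (\<Sum>m'\<in>Poly_Mapping.keys p. if m' = m then Poly_Mapping.lookup p m * of_nat (Poly_Mapping.lookup m q) else 0)"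
      unfolding pderiv_c_def lookup_sum
    proof (rule sum.cong)
      fix m' assume "m' \<in> Poly_Mapping.keys p"
      show "Poly_Mapping.lookup (Poly_Mapping.single (m' - Poly_Mapping.single q 1) (Poly_Mapping.lookup p m' * real (Poly_Mapping.lookup m' q)))
          (m - Poly_Mapping.single q 1) =
         (if m' = m then Poly_Mapping.lookup p m * real (Poly_Mapping.lookup m q) else 0)"
        using inj[of m'] by (cases "Poly_Mapping.lookup m' q = 0") (auto simp: lookup_single when_def)
    qed simp
    also have "\<dots> \<noteq> 0" using m by (simp add: in_keys_iff)
    finally show False using 0 by simp
  qed
qed (rule pderiv_c_notin_vars)

lemma vf_app_superset:
  "finite Q \<Longrightarrow> vars p \<subseteq> Q \<Longrightarrow> vf_app V p = (\<Sum>q\<in>Q. V q * pderiv_c q p)"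
  unfolding vf_app_def by (intro sum.mono_neutral_left) (auto simp: pderiv_c_notin_vars)

lemma vars_add: "vars (p + q) \<subseteq> vars p \<union> vars q"
  unfolding vars_def using keys_add by fastforce

lemma vars_mult: "vars (p * q) \<subseteq> vars p \<union> vars q"
proof
  fix r assume "r \<in> vars (p * q)"
  then have "pderiv_c r (p * q) \<noteq> 0" by (simp add: pderiv_c_eq_0_iff)
  then have "pderiv_c r p \<noteq> 0 \<or> pderiv_c r q \<noteq> 0"
    by (auto simp: derivation_simps[OF derivation_pderiv_c])
  then show "r \<in> vars p \<union> vars q" by (simp add: pderiv_c_eq_0_iff)
qed

lemma derivation_vf_app: "derivation (vf_app V)"
proof (rule derivationI)
  fix p q
  let ?Q = "vars p \<union> vars q"
  have Q: "finite ?Q" by (simp add: finite_vars)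
  show "vf_app V (p + q) = vf_app V p + vf_app V q"
    using vars_add[of p q] Q
    by (simp add: vf_app_superset[of ?Q] pderiv_c_add algebra_simps sum.distrib)
  show "vf_app V (p * q) = vf_app V p * q + p * vf_app V q"
    using vars_mult[of p q] Q
    by (simp add: vf_app_superset[of ?Q] derivation_simps[OF derivation_pderiv_c] algebra_simps sum.distrib sum_distrib_left)
next
  show "vf_app V (cst c) = 0" for c by (simp add: vf_app_def pderiv_c_cst)
qed

lemma vf_app_var: "vf_app V (var q) = V q"
proof -
  have "vars (var q) \<subseteq> {q}"
    by (auto simp: vars_def var_def split: if_splits)
  then show ?thesis by (subst vf_app_superset[of "{q}"]) (auto simp: pderiv_c_var)
qed

lemma derivation_eq_vf_app: "derivation D \<Longrightarrow> D p = vf_app (\<lambda>q. D (var q)) p"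
  by (rule derivation_ext) (simp_all add: derivation_vf_app vf_app_var)

lemma derivation_eq_sum: "derivation D \<Longrightarrow> D p = (\<Sum>q\<in>vars p. D (var q) * pderiv_c q p)"
  using derivation_eq_vf_app[of D p] by (simp only: vf_app_def)

lemma cst_mult_eq_0: "cst c * p = 0 \<longleftrightarrow> c = 0 \<or> p = 0"
  by (auto simp: cst_def dest: arg_cong[where f = "\<lambda>p. Poly_Mapping.lookup p 0"])

lemma const_if_pderiv_c_0:
  assumes "\<And>q. pderiv_c q p = 0"
  shows "p = cst (Poly_Mapping.lookup p 0)"
proof (rule poly_mapping_eqI)
  fix m
  have "vars p = {}" using assms by (auto simp: pderiv_c_eq_0_iff)
  then have "m \<in> Poly_Mapping.keys p \<Longrightarrow> m = 0"
    by (auto simp: vars_def intro: poly_mapping_eqI)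
  then show "Poly_Mapping.lookup p m = Poly_Mapping.lookup (cst (Poly_Mapping.lookup p 0)) m"
    by (cases "m = 0") (auto simp: cst_def lookup_single when_def in_keys_iff)
qed

subsection \<open>Gradings\<close>

definition mono_deg :: "(coord \<Rightarrow> int) \<Rightarrow> (coord \<Rightarrow>\<^sub>0 nat) \<Rightarrow> int" where
  "mono_deg w m = (\<Sum>q\<in>Poly_Mapping.keys m. int (Poly_Mapping.lookup m q) * w q)"

definition hom_deg :: "(coord \<Rightarrow> int) \<Rightarrow> int \<Rightarrow> gtpoly \<Rightarrow> bool" where
  "hom_deg w n p \<longleftrightarrow> (\<forall>m\<in>Poly_Mapping.keys p. mono_deg w m = n)"

lemma homogeneous_iff: "homogeneous n p \<longleftrightarrow> hom_deg wt n p"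
  by (simp add: homogeneous_def hom_deg_def mono_wt_def mono_deg_def)

lemma mono_deg_superset:
  "finite Q \<Longrightarrow> Poly_Mapping.keys m \<subseteq> Q \<Longrightarrow> mono_deg w m = (\<Sum>q\<in>Q. int (Poly_Mapping.lookup m q) * w q)"
  unfolding mono_deg_def by (intro sum.mono_neutral_left) (auto simp: in_keys_iff)

lemma mono_deg_add: "mono_deg w (m + m') = mono_deg w m + mono_deg w m'"
proof -
  let ?Q = "Poly_Mapping.keys m \<union> Poly_Mapping.keys m'"
  have "finite ?Q" "Poly_Mapping.keys (m + m') \<subseteq> ?Q" using keys_add[of m m'] by auto
  then show ?thesis by (simp add: mono_deg_superset[of ?Q] lookup_add algebra_simps sum.distrib)
qed

lemma mono_deg_0 [simp]: "mono_deg w 0 = 0" by (simp add: mono_deg_def)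
lemma mono_deg_single [simp]: "mono_deg w (Poly_Mapping.single q n) = int n * w q"
  by (cases "n = 0") (simp_all add: mono_deg_def)

lemma hom_deg_add: "hom_deg w n p \<Longrightarrow> hom_deg w n q \<Longrightarrow> hom_deg w n (p + q)"
  unfolding hom_deg_def using keys_add[of p q] by blast

lemma hom_deg_0 [simp]: "hom_deg w n 0" by (simp add: hom_deg_def)
lemma hom_deg_minus: "hom_deg w n p \<Longrightarrow> hom_deg w n (- p)" by (simp add: hom_deg_def)
lemma hom_deg_diff: "hom_deg w n p \<Longrightarrow> hom_deg w n q \<Longrightarrow> hom_deg w n (p - q)"
  using hom_deg_add[of w n p "- q"] hom_deg_minus[of w n q] by simp
lemma hom_deg_sum: "(\<And>i. i \<in> I \<Longrightarrow> hom_deg w n (f i)) \<Longrightarrow> hom_deg w n (\<Sum>i\<in>I. f i)"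
  by (induction I rule: infinite_finite_induct) (auto intro: hom_deg_add)
lemma hom_deg_mult: "hom_deg w n p \<Longrightarrow> hom_deg w n' q \<Longrightarrow> hom_deg w (n + n') (p * q)"
  unfolding hom_deg_def using keys_mult[of p q] by (force simp: mono_deg_add)
lemma hom_deg_cst: "hom_deg w 0 (cst c)" by (simp add: hom_deg_def cst_def)
lemma hom_deg_1: "hom_deg w 0 1" using hom_deg_cst[of w 1] by simp
lemma hom_deg_var: "hom_deg w (w q) (var q)" by (simp add: hom_deg_def var_def)
lemma hom_deg_power: "hom_deg w n p \<Longrightarrow> hom_deg w (int k * n) (p ^ k)"
proof (induction k)
  case (Suc k)
  then show ?case using hom_deg_mult[of w n p "int k * n" "p ^ k"] by (simp add: algebra_simps)
qed (simp add: hom_deg_1)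
lemma hom_deg_cst_mult: "hom_deg w n p \<Longrightarrow> hom_deg w n (cst c * p)"
  using hom_deg_mult[OF hom_deg_cst, of w n p c] by simp
lemma hom_deg_of_nat_mult: "hom_deg w n p \<Longrightarrow> hom_deg w n (of_nat c * p)"
  using hom_deg_cst_mult[of w n p "real c"] by (simp add: cst_of_nat)

lemma hom_deg_pderiv_c:
  assumes "hom_deg w n p"
  shows "hom_deg w (n - w q) (pderiv_c q p)"
  unfolding pderiv_c_def
proof (rule hom_deg_sum)
  fix m assume m: "m \<in> Poly_Mapping.keys p"
  show "hom_deg w (n - w q) (Poly_Mapping.single (m - Poly_Mapping.single q 1) (Poly_Mapping.lookup p m * real (Poly_Mapping.lookup m q)))"
  proof (cases "Poly_Mapping.lookup m q = 0")
    case False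
    then have "m = Poly_Mapping.single q 1 + (m - Poly_Mapping.single q 1)"
      by (intro poly_mapping_eqI) (auto simp: lookup_add lookup_minus lookup_single when_def)
    then have "mono_deg w m = w q + mono_deg w (m - Poly_Mapping.single q 1)"
      by (metis mono_deg_add mono_deg_single of_nat_1 mult_1)
    then show ?thesis using assms m by (auto simp: hom_deg_def)
  qed simp
qed

lemma hom_deg_derivation:
  assumes D: "derivation D" and v: "\<And>q. hom_deg w (w q + e) (D (var q))" and p: "hom_deg w n p"
  shows "hom_deg w (n + e) (D p)"
proof -
  have "hom_deg w (n + e) (D (var q) * pderiv_c q p)" for q
    using hom_deg_mult[OF v[of q] hom_deg_pderiv_c[OF p, of q]] by (simp add: algebra_simps)
  then have "hom_deg w (n + e) (\<Sum>q\<in>vars p. D (var q) * pderiv_c q p)"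
    by (intro hom_deg_sum)
  then show ?thesis by (simp only: derivation_eq_sum[OF D, of p])
qed

definition gcomp :: "(coord \<Rightarrow> int) \<Rightarrow> int \<Rightarrow> gtpoly \<Rightarrow> gtpoly" where
  "gcomp w n p = Abs_poly_mapping (\<lambda>m. if mono_deg w m = n then Poly_Mapping.lookup p m else 0)"

lemma lookup_gcomp: "Poly_Mapping.lookup (gcomp w n p) m = (if mono_deg w m = n then Poly_Mapping.lookup p m else 0)"
proof -
  have "finite {m. (if mono_deg w m = n then Poly_Mapping.lookup p m else 0) \<noteq> 0}"
    by (rule finite_subset[of _ "Poly_Mapping.keys p"]) (auto simp: in_keys_iff)
  then show ?thesis unfolding gcomp_def by (simp add: Abs_poly_mapping_inverse)
qed

lemma gcomp_add: "gcomp w n (p + q) = gcomp w n p + gcomp w n q"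
  by (rule poly_mapping_eqI) (simp add: lookup_gcomp lookup_add)
lemma gcomp_0 [simp]: "gcomp w n 0 = 0"
  by (rule poly_mapping_eqI) (simp add: lookup_gcomp)
lemma gcomp_minus: "gcomp w n (- p) = - gcomp w n p"
  by (rule poly_mapping_eqI) (simp add: lookup_gcomp)
lemma gcomp_sum: "gcomp w n (\<Sum>i\<in>I. f i) = (\<Sum>i\<in>I. gcomp w n (f i))"
  by (induction I rule: infinite_finite_induct) (simp_all add: gcomp_add)
lemma hom_deg_gcomp: "hom_deg w n (gcomp w n p)"
  by (auto simp: hom_deg_def in_keys_iff lookup_gcomp split: if_splits)
lemma gcomp_hom_deg: "hom_deg w n p \<Longrightarrow> gcomp w n' p = (if n = n' then p else 0)"
  by (rule poly_mapping_eqI) (auto simp: hom_deg_def in_keys_iff lookup_gcomp)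

lemma gcomp_operator:
  assumes add: "\<And>p q. T (p + q) = T p + T q" and hom: "\<And>j p. hom_deg w j p \<Longrightarrow> hom_deg w (j + e) (T p)"
  shows "gcomp w n (T p) = T (gcomp w (n - e) p)"
proof (induction p rule: gtpoly_induct_single)
  case (add p q)
  then show ?case by (simp add: assms(1) gcomp_add)
next
  case (single m c)
  have h: "hom_deg w (mono_deg w m) (Poly_Mapping.single m c)" by (simp add: hom_deg_def)
  have T0: "T 0 = 0" using assms(1)[of 0 0] by (metis add_cancel_right_right add_0)
  show ?case
    unfolding gcomp_hom_deg[OF hom[OF h], of n] gcomp_hom_deg[OF h, of "n - e"]
    by (simp add: T0 eq_diff_eq)
qed

lemma gcomp_derivation:
  assumes "derivation D" "\<And>q. hom_deg w (w q + e) (D (var q))"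
  shows "gcomp w n (D p) = D (gcomp w (n - e) p)"
  by (rule gcomp_operator) (simp_all add: assms derivation_simps hom_deg_derivation)

lemma gcomp_mult:
  assumes "hom_deg w e a"
  shows "gcomp w n (a * p) = a * gcomp w (n - e) p"
  by (rule gcomp_operator[where T = "\<lambda>p. a * p"])
    (use assms hom_deg_mult in \<open>auto simp: algebra_simps\<close>)

lemma gcomp_top_exists:
  assumes "gcomp w n p \<noteq> 0"
  obtains N where "N \<ge> n" "gcomp w N p \<noteq> 0" "\<And>j. j > N \<Longrightarrow> gcomp w j p = 0"
proof -
  define J where "J = mono_deg w ` Poly_Mapping.keys p"
  have J: "j \<in> J" if "gcomp w j p \<noteq> 0" for j
    using that unfolding J_def by (metis (mono_tags, lifting) image_eqI in_keys_iff lookup_gcomp lookup_zero poly_mapping_eqI)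
  have fin: "finite {j \<in> J. gcomp w j p \<noteq> 0}" (is "finite ?K") by (simp add: J_def)
  have n: "n \<in> ?K" using assms J by auto
  show ?thesis
  proof (rule that[of "Max ?K"])
    show "n \<le> Max ?K" using fin n by (rule Max_ge)
    show "gcomp w (Max ?K) p \<noteq> 0" using Max_in[OF fin] n by blast
    show "gcomp w j p = 0" if "j > Max ?K" for j
      using that Max_ge[OF fin, of j] J[of j] by auto
  qed
qed

text \<open>Euler's identity. Q need only contain the variables of nonzero weight and may be larger,
  so that one Q can serve all coefficients of a series.\<close>

lemma hom_deg_euler:
  assumes "hom_deg w n p" "finite Q" "\<And>q. q \<in> vars p \<Longrightarrow> w q \<noteq> 0 \<Longrightarrow> q \<in> Q"
  shows "(\<Sum>q\<in>Q. of_int (w q) * var q * pderiv_c q p) = of_int n * p"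
proof -
  define D where "D = vf_app (\<lambda>q. of_int (w q) * var q)"
  have mono: "vf_app (\<lambda>q. of_int (w q) * var q) (Poly_Mapping.single m c) = of_int (mono_deg w m) * Poly_Mapping.single m c" for m c
    proof (induction m rule: update_induct)
      case const
      then show ?case using derivation_simps(3)[OF derivation_vf_app, of _ c] by (simp add: cst_def)
    next
      case (update f a b)
      have u: "Poly_Mapping.update a b f = Poly_Mapping.single a b + f"
        using update(1) by (intro poly_mapping_eqI) (auto simp: lookup_update lookup_add lookup_single in_keys_iff when_def)
      have "Poly_Mapping.single (Poly_Mapping.update a b f) c = var a ^ b * Poly_Mapping.single f c"
        by (simp add: u var_power mult_single)
      moreover have "vf_app (\<lambda>q. of_int (w q) * var q) (var a ^ b) = of_int (int b * w a) * var a ^ b"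
        by (induction b) (simp_all add: derivation_simps(1-10)[OF derivation_vf_app] vf_app_var algebra_simps)
      ultimately show ?case
        using update(3) by (simp add: u mono_deg_add derivation_simps(2)[OF derivation_vf_app] algebra_simps)
    qed
  have "D p = (\<Sum>m\<in>Poly_Mapping.keys p. D (Poly_Mapping.single m (Poly_Mapping.lookup p m)))"
    unfolding D_def by (subst derivation_sum[OF derivation_vf_app, symmetric]) (metis gtpoly_sum_single)
  also have "\<dots> = (\<Sum>m\<in>Poly_Mapping.keys p. of_int n * Poly_Mapping.single m (Poly_Mapping.lookup p m))"
    using assms(1) by (intro sum.cong) (auto simp: D_def mono hom_deg_def)
  also have "\<dots> = of_int n * p"
    unfolding sum_distrib_left[symmetric] by (metis gtpoly_sum_single)
  finally have "D p = of_int n * p" .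
  moreover have "D p = (\<Sum>q\<in>Q \<union> vars p. of_int (w q) * var q * pderiv_c q p)"
    unfolding D_def by (rule vf_app_superset) (auto simp: assms finite_vars)
  moreover have "\<dots> = (\<Sum>q\<in>Q. of_int (w q) * var q * pderiv_c q p)"
    using assms by (intro sum.mono_neutral_right) (auto simp: finite_vars)
  ultimately show ?thesis by simp
qed

subsection \<open>Substitutions\<close>

text \<open>The algebra endomorphism sending each coordinate q to \<open>h q\<close>. It serves to
  evaluate jets at characteristic roots and to read off constant terms.\<close>

definition subst_gt :: "(coord \<Rightarrow> gtpoly) \<Rightarrow> gtpoly \<Rightarrow> gtpoly" where
  "subst_gt h p = (\<Sum>m\<in>Poly_Mapping.keys p. cst (Poly_Mapping.lookup p m) * (\<Prod>q\<in>Poly_Mapping.keys m. h q ^ Poly_Mapping.lookup m q))"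

lemma subst_gt_superset:
  "finite M \<Longrightarrow> Poly_Mapping.keys p \<subseteq> M \<Longrightarrow>
    subst_gt h p = (\<Sum>m\<in>M. cst (Poly_Mapping.lookup p m) * (\<Prod>q\<in>Poly_Mapping.keys m. h q ^ Poly_Mapping.lookup m q))"
  unfolding subst_gt_def by (intro sum.mono_neutral_left) (auto simp: in_keys_iff)

lemma subst_gt_add: "subst_gt h (p + q) = subst_gt h p + subst_gt h q"
proof -
  let ?M = "Poly_Mapping.keys p \<union> Poly_Mapping.keys q"
  have "finite ?M" "Poly_Mapping.keys (p + q) \<subseteq> ?M" using keys_add[of p q] by auto
  then show ?thesis by (simp add: subst_gt_superset[of ?M] lookup_add cst_add algebra_simps sum.distrib)
qed

lemma subst_gt_single:
  "subst_gt h (Poly_Mapping.single m c) = cst c * (\<Prod>q\<in>Poly_Mapping.keys m. h q ^ Poly_Mapping.lookup m q)"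
  by (subst subst_gt_superset[of "{m}"]) auto

lemma subst_gt_cst: "subst_gt h (cst c) = cst c"
  unfolding cst_def[of c] by (simp add: subst_gt_single cst_def)

lemma subst_gt_var_mult: "subst_gt h (var r * p) = h r * subst_gt h p"
proof (induction p rule: gtpoly_induct_single)
  case (single m c)
  let ?Q = "insert r (Poly_Mapping.keys m)"
  have prod: "(\<Prod>q\<in>Poly_Mapping.keys m'. h q ^ Poly_Mapping.lookup m' q) = (\<Prod>q\<in>?Q. h q ^ Poly_Mapping.lookup m' q)"
    if "Poly_Mapping.keys m' \<subseteq> ?Q" for m'
    using that by (intro prod.mono_neutral_left) (auto simp: in_keys_iff)
  have "Poly_Mapping.keys (Poly_Mapping.single r 1 + m) \<subseteq> ?Q"
    using keys_add[of "Poly_Mapping.single r 1" m] by auto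
  moreover have "(\<Prod>q\<in>?Q. h q ^ (Poly_Mapping.lookup (Poly_Mapping.single r 1) q)) = (\<Prod>q\<in>{r}. h q)"
    by (intro prod.mono_neutral_cong_right) (auto simp: lookup_single when_def)
  moreover note prod[of "Poly_Mapping.single r 1 + m"] prod[of m]
  ultimately show ?case
    by (simp add: var_def mult_single subst_gt_single lookup_add power_add prod.distrib subset_insertI del: prod.insert)
       simp
qed (simp add: subst_gt_add algebra_simps)

lemma subst_gt_mult: "subst_gt h (p * q) = subst_gt h p * subst_gt h q"
proof (induction p rule: gtpoly_induct)
  case (cst c)
  show ?case
    by (induction q rule: gtpoly_induct_single)
      (simp_all add: subst_gt_add algebra_simps subst_gt_cst, simp add: cst_def mult_single subst_gt_single flip: mult.assoc)
qed (simp_all add: subst_gt_add distrib_right subst_gt_var_mult mult.assoc)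

lemma subst_gt_var: "subst_gt h (var q) = h q"
  using subst_gt_var_mult[of h q 1] subst_gt_cst[of h 1] by simp

lemma subst_gt_simps:
  "subst_gt h (p + q) = subst_gt h p + subst_gt h q"
  "subst_gt h (p * q) = subst_gt h p * subst_gt h q"
  "subst_gt h (cst c) = cst c" "subst_gt h 0 = 0" "subst_gt h 1 = 1"
  "subst_gt h (- p) = - subst_gt h p" "subst_gt h (p - q) = subst_gt h p - subst_gt h q"
  "subst_gt h (p ^ n) = subst_gt h p ^ n"
  "subst_gt h (of_nat n) = of_nat n" "subst_gt h (numeral k) = numeral k"
proof -
  show "subst_gt h (p + q) = subst_gt h p + subst_gt h q" by (rule subst_gt_add)
  show "subst_gt h (p * q) = subst_gt h p * subst_gt h q" by (rule subst_gt_mult)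
  show "subst_gt h (cst c) = cst c" by (rule subst_gt_cst)
  show z: "subst_gt h 0 = 0" using subst_gt_cst[of h 0] by simp
  show o: "subst_gt h 1 = 1" using subst_gt_cst[of h 1] by simp
  have m: "subst_gt h (- p) = - subst_gt h p" for p
    using subst_gt_add[of h p "- p"] z by (simp add: eq_neg_iff_add_eq_0 add.commute)
  then show "subst_gt h (- p) = - subst_gt h p" .
  show "subst_gt h (p - q) = subst_gt h p - subst_gt h q" using subst_gt_add[of h p "- q"] m by simp
  show "subst_gt h (p ^ n) = subst_gt h p ^ n" by (induction n) (simp_all add: o subst_gt_mult)
  show "subst_gt h (of_nat n) = of_nat n" using subst_gt_cst[of h "of_nat n"] unfolding cst_of_nat .
  show "subst_gt h (numeral k) = numeral k" using subst_gt_cst[of h "numeral k"] unfolding cst_numeral .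
qed

lemma subst_gt_sum: "subst_gt h (\<Sum>i\<in>I. f i) = (\<Sum>i\<in>I. subst_gt h (f i))"
  by (induction I rule: infinite_finite_induct) (simp_all add: subst_gt_simps)

subsection \<open>Coefficientwise operators on power series\<close>

definition cmap :: "(gtpoly \<Rightarrow> gtpoly) \<Rightarrow> gtpoly fps \<Rightarrow> gtpoly fps" where
  "cmap T f = Abs_fps (\<lambda>n. T (fps_nth f n))"

lemma cmap_nth [simp]: "fps_nth (cmap T f) n = T (fps_nth f n)"
  by (simp add: cmap_def)

lemma cmap_simps:
  assumes D: "derivation D"
  shows "cmap D (f + g) = cmap D f + cmap D g" "cmap D (f * g) = cmap D f * g + f * cmap D g"
    "cmap D 0 = 0" "cmap D 1 = 0" "cmap D (- f) = - cmap D f" "cmap D (f - g) = cmap D f - cmap D g"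
    "cmap D fps_X = 0" "cmap D (fps_const a) = fps_const (D a)"
    "cmap D (of_nat n) = 0" "cmap D (numeral w) = 0"
    "cmap D (f ^ n) = of_nat n * f ^ (n - 1) * cmap D f" "cmap D (fps_deriv f) = fps_deriv (cmap D f)"
proof -
  note s = derivation_simps[OF D] derivation_sum[OF D]
  show "cmap D (f + g) = cmap D f + cmap D g" "cmap D 0 = 0" "cmap D 1 = 0" "cmap D (- f) = - cmap D f"
    "cmap D (f - g) = cmap D f - cmap D g" "cmap D fps_X = 0" "cmap D (fps_const a) = fps_const (D a)"
    "cmap D (numeral w) = 0" "cmap D (fps_deriv f) = fps_deriv (cmap D f)"
    by (auto simp: fps_eq_iff s fps_X_def numeral_fps_const)
  show m: "cmap D (f * g) = cmap D f * g + f * cmap D g" for f g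
    by (simp add: fps_eq_iff s fps_mult_nth sum.distrib)
  show one: "cmap D (of_nat n) = 0" by (induction n) (auto simp: fps_eq_iff s)
  have o: "cmap D 1 = 0" by (auto simp: fps_eq_iff s)
  show "cmap D (f ^ n) = of_nat n * f ^ (n - 1) * cmap D f"
  proof (induction n)
    case (Suc n)
    then show ?case by (cases n) (simp_all add: algebra_simps m)
  qed (simp add: o)
qed

lemma cmap_subst_gt:
  "cmap (subst_gt h) (f + g) = cmap (subst_gt h) f + cmap (subst_gt h) g"
  "cmap (subst_gt h) (f * g) = cmap (subst_gt h) f * cmap (subst_gt h) g"
  "cmap (subst_gt h) 0 = 0" "cmap (subst_gt h) 1 = 1" "cmap (subst_gt h) (- f) = - cmap (subst_gt h) f"
  "cmap (subst_gt h) (f - g) = cmap (subst_gt h) f - cmap (subst_gt h) g"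
  "cmap (subst_gt h) fps_X = fps_X" "cmap (subst_gt h) (fps_const a) = fps_const (subst_gt h a)"
  "cmap (subst_gt h) (numeral w) = numeral w"
  "cmap (subst_gt h) (f ^ n) = cmap (subst_gt h) f ^ n"
  "cmap (subst_gt h) (fps_deriv f) = fps_deriv (cmap (subst_gt h) f)"
proof -
  note s = subst_gt_simps subst_gt_sum
  show "cmap (subst_gt h) (f + g) = cmap (subst_gt h) f + cmap (subst_gt h) g"
    "cmap (subst_gt h) 0 = 0" "cmap (subst_gt h) (- f) = - cmap (subst_gt h) f"
    "cmap (subst_gt h) (f - g) = cmap (subst_gt h) f - cmap (subst_gt h) g"
    "cmap (subst_gt h) fps_X = fps_X" "cmap (subst_gt h) (fps_const a) = fps_const (subst_gt h a)"
    "cmap (subst_gt h) (numeral w) = numeral w"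
    "cmap (subst_gt h) (fps_deriv f) = fps_deriv (cmap (subst_gt h) f)"
    by (auto simp: fps_eq_iff s fps_X_def numeral_fps_const)
  show m: "cmap (subst_gt h) (f * g) = cmap (subst_gt h) f * cmap (subst_gt h) g" for f g
    by (simp add: fps_eq_iff s fps_mult_nth)
  show o: "cmap (subst_gt h) 1 = 1" by (auto simp: fps_eq_iff s)
  show "cmap (subst_gt h) (f ^ n) = cmap (subst_gt h) f ^ n"
    by (induction n) (simp_all add: o m)
qed

subsection \<open>Generating series of the covering\<close>

definition sigma_fps :: "gtpoly fps" where
  "sigma_fps = Abs_fps sigma"

definition quad_fps :: "gtpoly fps" where
  "quad_fps = 1 - fps_const zx * fps_X - fps_const zy * fps_X ^ 2"

definition psi_fps :: "gtpoly fps" where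
  "psi_fps = Abs_fps (\<lambda>n. if n = 0 then 0 else psi n)"

text \<open>The derivative of \<open>\<psi>(\<mu>)\<close> as a series in \<open>1/\<mu>\<close>.\<close>

definition dpsi_fps :: "gtpoly fps" where
  "dpsi_fps = 1 - fps_X ^ 2 * fps_deriv psi_fps"

text \<open>This is D_x applied to \<open>psi_fps\<close>, see \<open>cmap_Dx_psi\<close>: the sums
  X^(k) are the convolution of psi' with 1 / (1 - z_x t - z_y t^2).\<close>

definition x_fps :: "gtpoly fps" where
  "x_fps = fps_X ^ 2 * dpsi_fps * sigma_fps"

definition y_fps :: "gtpoly fps" where
  "y_fps = dpsi_fps * (fps_X + fps_const zy * fps_X ^ 3 * sigma_fps)"

lemma sigma_alt: "sigma m = (\<Sum>j\<le>m. of_nat ((m - j) choose j) * zx ^ (m - 2 * j) * zy ^ j)"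
  unfolding sigma_def by (rule sum.mono_neutral_left) (auto simp: binomial_eq_0)

lemma sigma_0: "sigma 0 = 1" by (simp add: sigma_alt)
lemma sigma_1: "sigma (Suc 0) = zx" by (simp add: sigma_alt)

text \<open>Pascal's rule. The binomial coefficient vanishes wherever the truncated subtraction in
  an exponent would cut off.\<close>

lemma sigma_rec: "sigma (Suc (Suc m)) = zx * sigma (Suc m) + zy * sigma m"
proof -
  let ?t = "\<lambda>c j. of_nat c * zx ^ (Suc (Suc m) - 2 * j) * zy ^ j"
  have 1: "zx * sigma (Suc m) = (\<Sum>j\<le>Suc m. ?t ((Suc m - j) choose j) j)"
    unfolding sigma_alt sum_distrib_left
  proof (rule sum.cong)
    fix j assume "j \<in> {..Suc m}"
    show "zx * (of_nat (Suc m - j choose j) * zx ^ (Suc m - 2 * j) * zy ^ j) = of_nat (Suc m - j choose j) * zx ^ (Suc (Suc m) - 2 * j) * zy ^ j"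
    proof (cases "2 * j \<le> Suc m")
      case True
      then have "Suc (Suc m) - 2 * j = Suc (Suc m - 2 * j)" by simp
      then show ?thesis by (simp add: algebra_simps)
    qed (simp add: binomial_eq_0)
  qed simp
  have 2: "zy * sigma m = (\<Sum>j\<le>m. ?t ((m - j) choose j) (Suc j))"
    unfolding sigma_alt sum_distrib_left by (rule sum.cong) (simp_all add: algebra_simps)
  have "sigma (Suc (Suc m)) = (\<Sum>j\<le>Suc m. ?t ((Suc (Suc m) - j) choose j) j)"
    unfolding sigma_alt by simp
  also have "\<dots> = ?t 1 0 + (\<Sum>j\<le>m. ?t ((Suc m - j) choose Suc j) (Suc j))"
    by (subst sum.atMost_Suc_shift) simp
  also have "\<dots> = ?t 1 0 + (\<Sum>j\<le>m. ?t ((m - j) choose Suc j) (Suc j) + ?t ((m - j) choose j) (Suc j))"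
    by (intro arg_cong2[where f = "(+)"] sum.cong refl) (simp_all add: Suc_diff_le algebra_simps)
  also have "\<dots> = (\<Sum>j\<le>Suc m. ?t ((Suc m - j) choose j) j) + (\<Sum>j\<le>m. ?t ((m - j) choose j) (Suc j))"
    unfolding sum.atMost_Suc_shift[of "\<lambda>j. ?t ((Suc m - j) choose j) j" m] by (simp add: sum.distrib)
  finally show ?thesis by (simp add: 1 2)
qed

text \<open>The recursion of \<open>sigma\<close> in generating form; it is what turns the covering
  into rational expressions with the characteristic polynomial as denominator.\<close>

lemma quad_sigma: "quad_fps * sigma_fps = 1"
proof (rule fps_ext)
  fix n
  have e: "quad_fps * sigma_fps = sigma_fps - fps_const zx * (fps_X * sigma_fps) - fps_const zy * (fps_X ^ 2 * sigma_fps)"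
    by (simp add: quad_fps_def algebra_simps)
  consider "n = 0" | "n = 1" | m where "n = Suc (Suc m)" by (metis One_nat_def not0_implies_Suc)
  then show "fps_nth (quad_fps * sigma_fps) n = fps_nth 1 n"
    unfolding e by cases (simp_all add: sigma_fps_def fps_X_power_mult_nth sigma_0 sigma_1 sigma_rec)
qed

lemma dpsi_nth: "fps_nth dpsi_fps n = (if n = 0 then 1 else if n = 1 then 0 else - (of_nat (n - 1) * psi (n - 1)))"
proof -
  consider "n = 0" | "n = 1" | m where "n = Suc (Suc m)" by (metis One_nat_def not0_implies_Suc)
  then show ?thesis
    by cases (simp_all add: dpsi_fps_def fps_X_power_mult_nth psi_fps_def del: of_nat_Suc)
qed

lemma dpsi_sigma_nth: "fps_nth (dpsi_fps * sigma_fps) n = Xk (n + 2)"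
proof (cases n)
  case 0
  then show ?thesis by (simp add: Xk_def sigma_fps_def dpsi_nth)
next
  case (Suc m)
  have "fps_nth (dpsi_fps * sigma_fps) n = (\<Sum>i=0..Suc m. fps_nth dpsi_fps i * sigma (Suc m - i))"
    by (simp add: fps_mult_nth Suc sigma_fps_def)
  also have "\<dots> = sigma (Suc m) + (\<Sum>i=0..m. fps_nth dpsi_fps (Suc i) * sigma (m - i))"
    by (subst sum.atLeast0_atMost_Suc_shift) (simp add: dpsi_nth)
  also have "(\<Sum>i=0..m. fps_nth dpsi_fps (Suc i) * sigma (m - i)) = (\<Sum>i=1..m. - (of_nat i * sigma (m - i) * psi i))"
    by (subst sum.atLeast_Suc_atMost) (auto simp: dpsi_nth algebra_simps intro!: sum.cong)
  finally show ?thesis by (simp add: Xk_def Suc sum_negf)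
qed

lemma x_fps_nth: "fps_nth x_fps n = (if n < 2 then 0 else Xk n)"
proof (cases "n < 2")
  case False
  then have "n - 2 + 2 = n" by simp
  then show ?thesis using dpsi_sigma_nth[of "n - 2"] False
    unfolding x_fps_def mult.assoc fps_X_power_mult_nth by metis
qed (simp add: x_fps_def fps_X_power_mult_nth mult.assoc)

lemma y_fps_nth: "fps_nth y_fps n = (if n = 0 then 0 else if n = 1 then 1 else if n = 2 then 0 else Yk n)"
proof -
  have e: "y_fps = fps_X * dpsi_fps + fps_const zy * (fps_X * x_fps)"
    by (simp add: y_fps_def x_fps_def algebra_simps power2_eq_square power3_eq_cube)
  show ?thesis unfolding e
    by (auto simp: x_fps_nth dpsi_nth Yk_def numeral_2_eq_2)
qed

text \<open>The part of D_x that preserves the differential order: it acts as D_x on x, y, z and the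
  psi^(i), with z_x, z_y and all higher jets as constants. \<open>Ezero\<close> is the analogue for
  D_y, and \<open>Dtop\<close> is the remaining part of D_x.\<close>

definition Azero :: "gtpoly \<Rightarrow> gtpoly" where
  "Azero = vf_app (\<lambda>q. case q of Xc \<Rightarrow> 1 | Zx a \<Rightarrow> (if a = 0 then zx else 0) | Psi n \<Rightarrow> Xk (n + 4) | _ \<Rightarrow> 0)"

definition Ezero :: "gtpoly \<Rightarrow> gtpoly" where
  "Ezero = vf_app (\<lambda>q. case q of Yc \<Rightarrow> 1 | Zx a \<Rightarrow> (if a = 0 then zy else 0) | Psi n \<Rightarrow> Yk (n + 4) | _ \<Rightarrow> 0)"

definition Dtop :: "gtpoly \<Rightarrow> gtpoly" where
  "Dtop = vf_app (\<lambda>q. case q of Zx a \<Rightarrow> (if a = 0 then 0 else var (Zx (Suc a))) | Zxy a \<Rightarrow> var (Zxy (Suc a)) | _ \<Rightarrow> 0)"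

lemma derivation_Azero: "derivation Azero" by (simp add: Azero_def derivation_vf_app)
lemma derivation_Ezero: "derivation Ezero" by (simp add: Ezero_def derivation_vf_app)
lemma derivation_Dtop: "derivation Dtop" by (simp add: Dtop_def derivation_vf_app)

lemma Dx_split: "vf_app Dx p = Dtop p + Azero p"
  by (rule derivation_ext)
    (auto simp: derivation_vf_app derivation_plus derivation_Azero derivation_Dtop vf_app_var Azero_def Dtop_def Dx_def zx_def split: coord.splits)

lemma psi_fps_nth: "fps_nth psi_fps n = (if n = 0 then 0 else psi n)"
  by (simp add: psi_fps_def)

text \<open>Since psi^(3) = z - y^2/2, a derivation taking psi^(j) to f_j takes z to f_3 + y
  f_1.\<close>

lemma cmap_psi_fpsI:
  assumes D: "derivation D"
    and "D (var Yc) = fps_nth f 1" "D (var Xc) = fps_nth f 2"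
    and "D (var (Zx 0)) = fps_nth f 3 + var Yc * fps_nth f 1"
    and "\<And>n. D (var (Psi n)) = fps_nth f (n + 4)" and "fps_nth f 0 = 0"
  shows "cmap D psi_fps = f"
proof (rule fps_ext)
  fix n :: nat
  have h: "cst (1/2) * (p + p) = p" for p
  proof -
    have "cst (1/2) * (p + p) = (cst (1/2) + cst (1/2)) * p" by (simp add: algebra_simps)
    also have "\<dots> = p" unfolding cst_add[symmetric] by simp
    finally show ?thesis .
  qed
  have y2: "D (cst (1/2) * (var Yc)\<^sup>2) = var Yc * D (var Yc)"
    using h[of "var Yc * D (var Yc)"] by (simp add: derivation_simps[OF D] algebra_simps power2_eq_square)
  consider "n = 0" | "n = 1" | "n = 2" | "n = 3" | "n \<ge> 4" by linarith
  then show "fps_nth (cmap D psi_fps) n = fps_nth f n"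
  proof cases
    case 5
    then have "n = (n - 4) + 4" by simp
    then show ?thesis using 5 assms(5)[of "n - 4"] by (simp add: psi_fps_nth psi_def)
  qed (use assms y2 in \<open>auto simp: psi_fps_nth psi_def derivation_simps(7)[OF D] derivation_simps(4)[OF D]\<close>)
qed

text \<open>x, y and z are polynomials in psi^(1), psi^(2), psi^(3), so the coefficients of
  \<open>psi_fps\<close> together with the jets generate everything. Identities between derivations
  thus reduce to one identity of series.\<close>

lemma derivation_ext_psi:
  assumes D: "derivation D" and D': "derivation D'" and psi: "cmap D psi_fps = cmap D' psi_fps"
    and zx: "\<And>a. D (var (Zx (Suc a))) = D' (var (Zx (Suc a)))" and zxy: "\<And>a. D (var (Zxy a)) = D' (var (Zxy a))"
  shows "D p = D' p"
proof (rule derivation_ext[OF D D'])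
  fix q
  have e: "D (psi n) = D' (psi n)" if "n \<ge> 1" for n
    using arg_cong[OF psi, of "\<lambda>f. fps_nth f n"] that by (simp add: psi_fps_nth)
  have z: "var (Zx 0) = psi 3 + cst (1/2) * (psi 1)\<^sup>2" by (simp add: psi_def)
  show "D (var q) = D' (var q)"
  proof (cases q)
    case Xc then show ?thesis using e[of 2] by (simp add: psi_def)
  next
    case Yc then show ?thesis using e[of 1] by (simp add: psi_def)
  next
    case (Zx a)
    show ?thesis
    proof (cases a)
      case 0
      then show ?thesis using e[of 3] e[of 1] unfolding Zx 0 z
        by (simp add: derivation_simps[OF D] derivation_simps[OF D'])
    qed (use Zx zx in simp)
  next
    case (Zxy a) then show ?thesis using zxy by simp
  next
    case (Psi n) then show ?thesis using e[of "n + 4"] by (simp add: psi_def)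
  qed
qed

lemma Xk_2: "Xk 2 = 1" by (simp add: Xk_def sigma_0)
lemma Xk_3: "Xk 3 = zx" by (simp add: Xk_def sigma_1)
lemma Yk_3: "Yk 3 = zy - var Yc" by (simp add: Yk_def Xk_2 psi_def)

lemma cmap_Dx_psi: "cmap (vf_app Dx) psi_fps = x_fps"
  by (rule cmap_psi_fpsI) (simp_all add: derivation_vf_app vf_app_var Dx_def x_fps_nth Xk_2 Xk_3 zx_def)

lemma cmap_Azero_psi: "cmap Azero psi_fps = x_fps"
  by (rule cmap_psi_fpsI) (simp_all add: derivation_Azero, simp_all add: Azero_def vf_app_var x_fps_nth Xk_2 Xk_3 zx_def)

lemma cmap_Dy_psi: "cmap (vf_app Dy) psi_fps = y_fps"
  by (rule cmap_psi_fpsI) (simp_all add: derivation_vf_app vf_app_var Dy_def y_fps_nth Yk_3 zy_def)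

lemma cmap_Ezero_psi: "cmap Ezero psi_fps = y_fps"
  by (rule cmap_psi_fpsI) (simp_all add: derivation_Ezero, simp_all add: Ezero_def vf_app_var y_fps_nth Yk_3 zy_def)

lemma cmap_Dtop_psi: "cmap Dtop psi_fps = 0"
  by (rule cmap_psi_fpsI) (simp_all add: derivation_Dtop, simp_all add: Dtop_def vf_app_var)

lemma cmap_pderiv_psi: "(\<And>n. q \<noteq> Psi n) \<Longrightarrow> q \<noteq> Xc \<Longrightarrow> q \<noteq> Yc \<Longrightarrow> q \<noteq> Zx 0 \<Longrightarrow> cmap (pderiv_c q) psi_fps = 0"
  by (rule cmap_psi_fpsI) (simp_all add: derivation_pderiv_c pderiv_c_var)

section \<open>Dependence of the covering on \<open>zx\<close> and \<open>zy\<close>\<close>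

abbreviation du :: "gtpoly \<Rightarrow> gtpoly" where "du \<equiv> pderiv_c (Zx (Suc 0))"
abbreviation dv :: "gtpoly \<Rightarrow> gtpoly" where "dv \<equiv> pderiv_c (Zxy 0)"

lemma derivation_zx_zy:
  "du zx = 1" "du zy = 0" "dv zx = 0" "dv zy = 1" "Azero zx = 0" "Azero zy = 0" "Ezero zx = 0" "Ezero zy = 0"
  "Dtop zx = var (Zx 2)" "Dtop zy = var (Zxy 1)"
  by (simp_all add: zx_def zy_def pderiv_c_var Azero_def Ezero_def Dtop_def vf_app_var numeral_2_eq_2)

lemma cmap_quad: "derivation D \<Longrightarrow> cmap D quad_fps = - fps_const (D zx) * fps_X - fps_const (D zy) * fps_X ^ 2"
  by (simp add: quad_fps_def cmap_simps del: fps_const_neg)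

lemma cmap_sigma:
  assumes D: "derivation D"
  shows "cmap D sigma_fps = sigma_fps ^ 2 * (fps_const (D zx) * fps_X + fps_const (D zy) * fps_X ^ 2)"
proof -
  have "0 = cmap D (quad_fps * sigma_fps)" by (simp add: quad_sigma cmap_simps[OF D])
  then have "quad_fps * cmap D sigma_fps = - cmap D quad_fps * sigma_fps"
    by (simp add: cmap_simps[OF D] eq_neg_iff_add_eq_0 algebra_simps)
  then have "sigma_fps * (quad_fps * cmap D sigma_fps) = sigma_fps * (- cmap D quad_fps * sigma_fps)" by simp
  moreover have "sigma_fps * (quad_fps * cmap D sigma_fps) = cmap D sigma_fps"
  proof -
    have "sigma_fps * (quad_fps * c) = (quad_fps * sigma_fps) * c" for c by (simp only: mult_ac)
    then show ?thesis by (simp add: quad_sigma)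
  qed
  ultimately have "cmap D sigma_fps = sigma_fps * (- cmap D quad_fps * sigma_fps)" by simp
  then show ?thesis by (simp add: cmap_quad[OF D] algebra_simps power2_eq_square del: fps_const_neg)
qed

lemma cmap_dpsi:
  assumes D: "derivation D"
  shows "cmap D dpsi_fps = - (fps_X ^ 2 * fps_deriv (cmap D psi_fps))"
  by (simp add: dpsi_fps_def cmap_simps[OF D])

lemma cmap_commutator: "cmap (\<lambda>p. D (D' p) - D' (D p)) f = cmap D (cmap D' f) - cmap D' (cmap D f)"
  by (rule fps_ext) simp

lemma cmap_scale: "cmap (\<lambda>p. a * T p) f = fps_const a * cmap T f"
  by (rule fps_ext) simp

lemma cmap_minus: "cmap (\<lambda>p. T p - T' p) f = cmap T f - cmap T' f"
  by (rule fps_ext) simp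

lemma cmap_plus: "cmap (\<lambda>p. T p + T' p) f = cmap T f + cmap T' f"
  by (rule fps_ext) simp

lemma cmap_pderiv_uv_psi: "cmap du psi_fps = 0" "cmap dv psi_fps = 0"
  by (rule cmap_pderiv_psi; simp)+

lemma pderiv_uv_x_y_fps:
  "cmap du x_fps = fps_X ^ 3 * dpsi_fps * sigma_fps ^ 2"
  "cmap dv x_fps = fps_X ^ 4 * dpsi_fps * sigma_fps ^ 2"
  "cmap du y_fps = fps_const zy * fps_X ^ 4 * dpsi_fps * sigma_fps ^ 2"
  "cmap dv y_fps = dpsi_fps * (fps_X ^ 3 * sigma_fps + fps_const zy * fps_X ^ 5 * sigma_fps ^ 2)"
  unfolding x_fps_def y_fps_def
  by (simp_all add: cmap_simps[OF derivation_pderiv_c] cmap_sigma[OF derivation_pderiv_c] cmap_dpsi[OF derivation_pderiv_c]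
      derivation_zx_zy cmap_pderiv_uv_psi)
    (simp_all add: algebra_simps eval_nat_numeral)

text \<open>Writing one factor \<open>sigma_fps\<close> as \<open>sigma_fps ^ 2 * quad_fps\<close>
  gives both sides the same denominator.\<close>

lemma y_fps_v_eq: "cmap dv y_fps = cmap du x_fps - fps_const zx * cmap dv x_fps"
proof -
  have "dpsi_fps * fps_X ^ 3 * sigma_fps = dpsi_fps * fps_X ^ 3 * sigma_fps * (quad_fps * sigma_fps)" by (simp add: quad_sigma)
  then show ?thesis
    unfolding pderiv_uv_x_y_fps by (simp add: quad_fps_def algebra_simps eval_nat_numeral)
qed

text \<open>The operators take constant values on jets, so only the action on \<open>psi_fps\<close>
  counts, where the claim is that \<open>du\<close> of \<open>y_fps\<close> is \<open>zy\<close>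
  times \<open>dv\<close> of \<open>x_fps\<close>. With the next lemma, commutators with
  \<open>Ezero\<close> are expressed through those with \<open>Azero\<close>, which removes unknowns
  from the compatibility conditions.\<close>

lemma commutator_du_Ezero: "du (Ezero p) - Ezero (du p) = zy * (dv (Azero p) - Azero (dv p))"
proof (rule derivation_ext_psi[where D = "\<lambda>p. du (Ezero p) - Ezero (du p)" and D' = "\<lambda>p. zy * (dv (Azero p) - Azero (dv p))"])
  show "cmap (\<lambda>p. du (Ezero p) - Ezero (du p)) psi_fps = cmap (\<lambda>p. zy * (dv (Azero p) - Azero (dv p))) psi_fps"
    unfolding cmap_scale cmap_commutator
    by (simp add: cmap_Ezero_psi cmap_Azero_psi cmap_pderiv_uv_psi cmap_simps(3)[OF derivation_Azero] cmap_simps(3)[OF derivation_Ezero]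
      pderiv_uv_x_y_fps algebra_simps)
qed (simp_all add: derivation_commutator derivation_scale derivation_pderiv_c derivation_Azero derivation_Ezero,
   simp_all add: Azero_def Ezero_def vf_app_var pderiv_c_var derivation_simps[OF derivation_pderiv_c] derivation_simps[OF derivation_vf_app])

lemma commutator_dv_Ezero:
  "dv (Ezero p) - Ezero (dv p) = (du (Azero p) - Azero (du p)) - zx * (dv (Azero p) - Azero (dv p))"
proof (rule derivation_ext_psi[where D = "\<lambda>p. dv (Ezero p) - Ezero (dv p)"
    and D' = "\<lambda>p. (du (Azero p) - Azero (du p)) - zx * (dv (Azero p) - Azero (dv p))"])
  show "cmap (\<lambda>p. dv (Ezero p) - Ezero (dv p)) psi_fps =
      cmap (\<lambda>p. (du (Azero p) - Azero (du p)) - zx * (dv (Azero p) - Azero (dv p))) psi_fps"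
    unfolding cmap_scale cmap_minus[of "\<lambda>p. du (Azero p) - Azero (du p)"] cmap_commutator
    by (simp add: cmap_Ezero_psi cmap_Azero_psi cmap_pderiv_uv_psi cmap_simps(3)[OF derivation_Azero] cmap_simps(3)[OF derivation_Ezero]
      y_fps_v_eq)
qed (simp_all add: derivation_commutator derivation_minus derivation_scale derivation_pderiv_c derivation_Azero derivation_Ezero,
   simp_all add: Azero_def Ezero_def vf_app_var pderiv_c_var derivation_simps[OF derivation_pderiv_c] derivation_simps[OF derivation_vf_app])

subsection \<open>The differential grading\<close>

text \<open>The subtraction \<open>a - 1\<close> is truncated, so z has degree 0 like z_x and z_y:
  degree 0 means order at most one.\<close>

fun jet_deg :: "coord \<Rightarrow> int" where
  "jet_deg (Zx a) = int (a - 1)" | "jet_deg (Zxy a) = int a" | "jet_deg q = 0"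

text \<open>The series variable t carries weight -a; here a = 0 for the differential grading and a =
  1 for \<open>wt\<close>.\<close>

definition fps_hom_deg :: "(coord \<Rightarrow> int) \<Rightarrow> int \<Rightarrow> int \<Rightarrow> gtpoly fps \<Rightarrow> bool" where
  "fps_hom_deg w a e f \<longleftrightarrow> (\<forall>n. hom_deg w (a * int n + e) (fps_nth f n))"

lemma fps_hom_deg_nth: "fps_hom_deg w a e f \<Longrightarrow> hom_deg w (a * int n + e) (fps_nth f n)"
  by (simp add: fps_hom_deg_def)

lemma fps_hom_deg_add: "fps_hom_deg w a e f \<Longrightarrow> fps_hom_deg w a e g \<Longrightarrow> fps_hom_deg w a e (f + g)"
  by (simp add: fps_hom_deg_def hom_deg_add)
lemma fps_hom_deg_minus: "fps_hom_deg w a e f \<Longrightarrow> fps_hom_deg w a e (- f)"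
  by (simp add: fps_hom_deg_def hom_deg_minus)
lemma fps_hom_deg_diff: "fps_hom_deg w a e f \<Longrightarrow> fps_hom_deg w a e g \<Longrightarrow> fps_hom_deg w a e (f - g)"
  by (simp add: fps_hom_deg_def hom_deg_diff)
lemma fps_hom_deg_mult:
  assumes "fps_hom_deg w a e f" "fps_hom_deg w a e' g"
  shows "fps_hom_deg w a (e + e') (f * g)"
  unfolding fps_hom_deg_def fps_mult_nth
proof (intro allI hom_deg_sum)
  fix n i :: nat assume "i \<in> {0..n}"
  then have *: "a * int n + (e + e') = (a * int i + e) + (a * int (n - i) + e')" by (simp add: algebra_simps of_nat_diff)
  show "hom_deg w (a * int n + (e + e')) (fps_nth f i * fps_nth g (n - i))"
    unfolding * by (intro hom_deg_mult fps_hom_deg_nth assms)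
qed
lemma fps_hom_deg_1: "fps_hom_deg w a 0 1"
  by (auto simp: fps_hom_deg_def hom_deg_1)
lemma fps_hom_deg_const: "hom_deg w e c \<Longrightarrow> fps_hom_deg w a e (fps_const c)"
  by (auto simp: fps_hom_deg_def)
lemma fps_hom_deg_X: "fps_hom_deg w a (- a) fps_X"
  by (auto simp: fps_hom_deg_def fps_X_def hom_deg_1)
lemma fps_hom_deg_power: "fps_hom_deg w a e f \<Longrightarrow> fps_hom_deg w a (int k * e) (f ^ k)"
proof (induction k)
  case (Suc k)
  then show ?case using fps_hom_deg_mult[of w a e f "int k * e" "f ^ k"] by (simp add: algebra_simps)
qed (simp add: fps_hom_deg_1)
lemma fps_hom_deg_deriv:
  assumes "fps_hom_deg w a e f" shows "fps_hom_deg w a (e + a) (fps_deriv f)"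
  unfolding fps_hom_deg_def
proof
  fix n
  show "hom_deg w (a * int n + (e + a)) (fps_nth (fps_deriv f) n)"
    using hom_deg_of_nat_mult[OF fps_hom_deg_nth[OF assms, of "Suc n"], of "n + 1"] by (simp add: algebra_simps)
qed
lemma fps_hom_deg_inverse:
  assumes "fps_hom_deg w a 0 f" "fps_nth f 0 = 1" "f * g = 1"
  shows "fps_hom_deg w a 0 g"
proof -
  have "hom_deg w (a * int n) (fps_nth g n)" for n
  proof (induction n rule: less_induct)
    case (less n)
    show ?case
    proof (cases n)
      case 0
      have "fps_nth (f * g) 0 = 1" using assms(3) by simp
      then show ?thesis using assms(2) 0 by (simp add: hom_deg_1)
    next
      case (Suc m)
      have "(\<Sum>i=0..n. fps_nth f i * fps_nth g (n - i)) = 0"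
        using arg_cong[OF assms(3), of "\<lambda>f. fps_nth f n"] Suc by (simp add: fps_mult_nth)
      then have "fps_nth g n = - (\<Sum>i=1..n. fps_nth f i * fps_nth g (n - i))"
        by (subst (asm) sum.atLeast_Suc_atMost) (simp_all add: assms(2) eq_neg_iff_add_eq_0)
      moreover have "hom_deg w (a * int n) (fps_nth f i * fps_nth g (n - i))" if "i \<in> {1..n}" for i
      proof -
        have "a * int i + a * int (n - i) = a * int n" using that by (simp add: algebra_simps)
        then show ?thesis using hom_deg_mult[OF fps_hom_deg_nth[OF assms(1), of i] less[of "n - i"]] that by simp
      qed
      ultimately show ?thesis by (simp only:) (intro hom_deg_minus hom_deg_sum)
    qed
  qed
  then show ?thesis by (simp add: fps_hom_deg_def)
qed

lemma fps_hom_deg_psi: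
  assumes "\<And>n. n \<ge> 1 \<Longrightarrow> hom_deg w (a * int n + a) (psi n)"
  shows "fps_hom_deg w a a psi_fps" "fps_hom_deg w a 0 dpsi_fps"
proof -
  show 1: "fps_hom_deg w a a psi_fps" using assms by (simp add: fps_hom_deg_def psi_fps_nth)
  have "fps_hom_deg w a 0 (fps_X ^ 2 * fps_deriv psi_fps)"
    using fps_hom_deg_mult[OF fps_hom_deg_power[OF fps_hom_deg_X, of w a 2] fps_hom_deg_deriv[OF 1]] by simp
  then show "fps_hom_deg w a 0 dpsi_fps"
    unfolding dpsi_fps_def by (intro fps_hom_deg_diff fps_hom_deg_1)
qed

lemma fps_hom_deg_quad:
  assumes "hom_deg w a zx" "hom_deg w (2 * a) zy"
  shows "fps_hom_deg w a 0 quad_fps"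
proof -
  have "fps_hom_deg w a 0 (fps_const zx * fps_X)"
    using fps_hom_deg_mult[OF fps_hom_deg_const[OF assms(1)] fps_hom_deg_X, of a] by simp
  moreover have "fps_hom_deg w a 0 (fps_const zy * fps_X ^ 2)"
    using fps_hom_deg_mult[OF fps_hom_deg_const[OF assms(2)] fps_hom_deg_power[OF fps_hom_deg_X], of a 2] by simp
  ultimately show ?thesis unfolding quad_fps_def by (intro fps_hom_deg_diff fps_hom_deg_1)
qed

lemma quad_nth_0: "fps_nth quad_fps 0 = 1"
  by (simp add: quad_fps_def)

lemma fps_hom_deg_sigma:
  assumes "hom_deg w a zx" "hom_deg w (2 * a) zy"
  shows "fps_hom_deg w a 0 sigma_fps"
  by (rule fps_hom_deg_inverse[OF fps_hom_deg_quad[OF assms] quad_nth_0 quad_sigma])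

lemma jet_deg_psi: "hom_deg jet_deg 0 (psi n)"
  using hom_deg_var[of jet_deg Yc] hom_deg_var[of jet_deg Xc] hom_deg_var[of jet_deg "Zx 0"] hom_deg_var[of jet_deg "Psi (n - 4)"]
    hom_deg_cst_mult[OF hom_deg_power[OF hom_deg_var[of jet_deg Yc], of 2], of "1/2"]
  by (simp add: psi_def hom_deg_diff)

lemma jet_deg_zx: "hom_deg jet_deg 0 zx" using hom_deg_var[of jet_deg "Zx 1"] by (simp add: zx_def)
lemma jet_deg_zy: "hom_deg jet_deg 0 zy" using hom_deg_var[of jet_deg "Zxy 0"] by (simp add: zy_def)

lemma jet_deg_dpsi: "fps_hom_deg jet_deg 0 0 dpsi_fps"
  using fps_hom_deg_psi(2)[of jet_deg 0] jet_deg_psi by simp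
lemma jet_deg_sigma: "fps_hom_deg jet_deg 0 0 sigma_fps"
  using fps_hom_deg_sigma[of jet_deg 0] jet_deg_zx jet_deg_zy by simp

lemma jet_deg_x_fps: "fps_hom_deg jet_deg 0 0 x_fps"
  using fps_hom_deg_mult[OF fps_hom_deg_mult[OF fps_hom_deg_power[OF fps_hom_deg_X] jet_deg_dpsi] jet_deg_sigma, of 2]
  by (simp add: x_fps_def)

lemma jet_deg_Azero: "hom_deg jet_deg (jet_deg q + 0) (Azero (var q))"
proof (cases q)
  case (Psi n)
  then show ?thesis using fps_hom_deg_nth[OF jet_deg_x_fps, of "n + 4"]
    by (simp add: Azero_def vf_app_var x_fps_nth)
qed (simp_all add: Azero_def vf_app_var hom_deg_1 jet_deg_zx)

lemma jet_deg_Dtop: "hom_deg jet_deg (jet_deg q + 1) (Dtop (var q))"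
proof (cases q)
  case (Zx a)
  then show ?thesis using hom_deg_var[of jet_deg "Zx (Suc a)"] by (cases a) (simp_all add: Dtop_def vf_app_var add.commute)
next
  case (Zxy a)
  then show ?thesis using hom_deg_var[of jet_deg "Zxy (Suc a)"] by (simp add: Dtop_def vf_app_var add.commute)
qed (simp_all add: Dtop_def vf_app_var)

lemma gcomp_Dx: "gcomp jet_deg n (vf_app Dx p) = Dtop (gcomp jet_deg (n - 1) p) + Azero (gcomp jet_deg n p)"
  using gcomp_derivation[OF derivation_Dtop jet_deg_Dtop, of n p] gcomp_derivation[OF derivation_Azero jet_deg_Azero, of n p]
  by (simp add: Dx_split gcomp_add)

text \<open>\<open>Dtop\<close> raises jet indices by one, so its commutator with a jet derivative
  is the derivative with index lowered by one. It kills z itself, hence the double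
  successor.\<close>

lemma pderiv_Dtop_Zx: "pderiv_c (Zx (Suc (Suc a))) (Dtop p) = Dtop (pderiv_c (Zx (Suc (Suc a))) p) + pderiv_c (Zx (Suc a)) p"
proof -
  have "pderiv_c (Zx (Suc (Suc a))) (Dtop p) - Dtop (pderiv_c (Zx (Suc (Suc a))) p) = pderiv_c (Zx (Suc a)) p"
    by (rule derivation_ext[where D = "\<lambda>p. pderiv_c (Zx (Suc (Suc a))) (Dtop p) - Dtop (pderiv_c (Zx (Suc (Suc a))) p)"],
        rule derivation_commutator[OF derivation_pderiv_c derivation_Dtop], rule derivation_pderiv_c)
      (auto simp: pderiv_c_var Dtop_def vf_app_var
        derivation_simps[OF derivation_vf_app] derivation_simps[OF derivation_pderiv_c] split: coord.splits)
  then show ?thesis by (simp add: algebra_simps)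
qed

lemma pderiv_Dtop_Zxy: "pderiv_c (Zxy (Suc a)) (Dtop p) = Dtop (pderiv_c (Zxy (Suc a)) p) + pderiv_c (Zxy a) p"
proof -
  have "pderiv_c (Zxy (Suc a)) (Dtop p) - Dtop (pderiv_c (Zxy (Suc a)) p) = pderiv_c (Zxy a) p"
    by (rule derivation_ext[where D = "\<lambda>p. pderiv_c (Zxy (Suc a)) (Dtop p) - Dtop (pderiv_c (Zxy (Suc a)) p)"],
        rule derivation_commutator[OF derivation_pderiv_c derivation_Dtop], rule derivation_pderiv_c)
      (auto simp: pderiv_c_var Dtop_def vf_app_var
        derivation_simps[OF derivation_vf_app] derivation_simps[OF derivation_pderiv_c] split: coord.splits)
  then show ?thesis by (simp add: algebra_simps)
qed

lemma finite_jets: "\<exists>N. \<forall>a\<ge>N. pderiv_c (Zx a) p = 0 \<and> pderiv_c (Zxy a) p = 0"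
proof -
  define f where "f q = (case q of Zx a \<Rightarrow> a | Zxy a \<Rightarrow> a | _ \<Rightarrow> 0)" for q
  have "finite (f ` vars p)" by (simp add: finite_vars)
  then obtain N where N: "\<forall>x\<in>f ` vars p. x < N" using finite_nat_set_iff_bounded by auto
  have "Zx a \<notin> vars p \<and> Zxy a \<notin> vars p" if "a \<ge> N" for a
    using N that by (force simp: f_def)
  then show ?thesis by (auto simp: pderiv_c_eq_0_iff)
qed

lemma downward_vanish:
  fixes g :: "nat \<Rightarrow> 'a::zero"
  assumes "\<And>a. a \<ge> N \<Longrightarrow> g a = 0" and step: "\<And>a. a \<ge> a0 \<Longrightarrow> g (Suc a) = 0 \<Longrightarrow> g a = 0" and "a \<ge> a0"
  shows "g a = 0"
proof (cases "a \<ge> N")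
  case False
  then have "a \<le> N" by simp
  then show ?thesis using \<open>a \<ge> a0\<close>
  proof (induction a rule: inc_induct)
    case base
    then show ?case using assms(1) by simp
  next
    case (step n)
    then show ?case using assms(2)[of n] by simp
  qed
qed (use assms in simp)

lemma jets_vanish:
  assumes "\<And>a. pderiv_c (Zx (Suc (Suc a))) p = 0 \<Longrightarrow> pderiv_c (Zx (Suc a)) p = 0"
    and "\<And>a. pderiv_c (Zxy (Suc (Suc a))) p = 0 \<Longrightarrow> pderiv_c (Zxy (Suc a)) p = 0"
  shows "pderiv_c (Zx (Suc a)) p = 0" "pderiv_c (Zxy (Suc a)) p = 0"
proof -
  obtain N where N: "\<forall>a\<ge>N. pderiv_c (Zx a) p = 0 \<and> pderiv_c (Zxy a) p = 0" using finite_jets by blast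
  show "pderiv_c (Zx (Suc a)) p = 0"
    by (rule downward_vanish[of N "\<lambda>a. pderiv_c (Zx (Suc a)) p" 0]) (use N assms in auto)
  show "pderiv_c (Zxy (Suc a)) p = 0"
    by (rule downward_vanish[of N "\<lambda>a. pderiv_c (Zxy (Suc a)) p" 0]) (use N assms in auto)
qed

lemma hom_jet_deg_eq_0:
  assumes "hom_deg jet_deg d p" "d \<noteq> 0" "\<And>a. pderiv_c (Zx (Suc a)) p = 0" "\<And>a. pderiv_c (Zxy (Suc a)) p = 0"
  shows "p = 0"
proof -
  have "False" if "q \<in> vars p" "jet_deg q \<noteq> 0" for q
  proof (cases q)
    case (Zx a) then show False using that assms(3)[of "a - 1"] by (cases a) (auto simp: pderiv_c_eq_0_iff)
  next
    case (Zxy a) then show False using that assms(4)[of "a - 1"] by (cases a) (auto simp: pderiv_c_eq_0_iff)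
  qed (use that in auto)
  then have "of_int d * p = 0" using hom_deg_euler[OF assms(1), of "{}"] by auto
  then show ?thesis using assms(2) by simp
qed

text \<open>If the derivative in one jet vanishes, the commutator formulas make the derivative in
  the next lower jet vanish. Starting beyond the finitely many jets in p this removes all of them,
  and Euler's identity leaves only 0.\<close>

lemma Dtop_hom_eq_0:
  assumes "Dtop p = 0" "hom_deg jet_deg d p" "d \<noteq> 0"
  shows "p = 0"
proof (rule hom_jet_deg_eq_0[OF assms(2,3)])
  note z = derivation_simps(4)[OF derivation_Dtop] derivation_simps(4)[OF derivation_pderiv_c]
  have "pderiv_c (Zx (Suc (Suc a))) p = 0 \<Longrightarrow> pderiv_c (Zx (Suc a)) p = 0" for a
    using pderiv_Dtop_Zx[of a p] assms(1) by (simp add: z)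
  moreover have "pderiv_c (Zxy (Suc (Suc a))) p = 0 \<Longrightarrow> pderiv_c (Zxy (Suc a)) p = 0" for a
    using pderiv_Dtop_Zxy[of "Suc a" p] assms(1) by (simp add: z)
  ultimately show "pderiv_c (Zx (Suc a)) p = 0" "pderiv_c (Zxy (Suc a)) p = 0" for a
    using jets_vanish[of p] by blast+
qed

definition jet_le :: "int \<Rightarrow> gtpoly \<Rightarrow> bool" where
  "jet_le n p \<longleftrightarrow> (\<forall>j>n. gcomp jet_deg j p = 0)"

text \<open>The top component of D_x p is \<open>Dtop\<close> of the top component of p, and
  \<open>Dtop\<close> is injective in nonzero degrees.\<close>

lemma jet_le_Dx:
  assumes "jet_le (n + 1) (vf_app Dx p)" "n \<ge> 0"
  shows "jet_le n p"
proof (rule ccontr)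
  assume "\<not> jet_le n p"
  then obtain j where j: "j > n" "gcomp jet_deg j p \<noteq> 0" by (auto simp: jet_le_def)
  obtain N where N: "N \<ge> j" "gcomp jet_deg N p \<noteq> 0" "\<And>j. j > N \<Longrightarrow> gcomp jet_deg j p = 0"
    using gcomp_top_exists[OF j(2)] by blast
  have "Dtop (gcomp jet_deg N p) = 0"
    using gcomp_Dx[of "N + 1" p] assms(1) N j(1)
    by (simp add: jet_le_def derivation_simps(4)[OF derivation_Azero])
  then have "gcomp jet_deg N p = 0"
    using Dtop_hom_eq_0[OF _ hom_deg_gcomp] N j assms(2) by auto
  then show False using N by simp
qed

lemma jet_le_0_pderiv:
  assumes "jet_le 0 p"
  shows "pderiv_c (Zx (Suc (Suc a))) p = 0" "pderiv_c (Zxy (Suc a)) p = 0"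
proof -
  have "q \<notin> vars p" if q: "jet_deg q > 0" for q
  proof
    assume "q \<in> vars p"
    then obtain m where m: "m \<in> Poly_Mapping.keys p" "q \<in> Poly_Mapping.keys m" by (auto simp: vars_def)
    have nonneg: "jet_deg r \<ge> 0" for r by (cases r) auto
    have "mono_deg jet_deg m \<ge> int (Poly_Mapping.lookup m q) * jet_deg q"
      unfolding mono_deg_def using m(2) nonneg by (intro member_le_sum) auto
    moreover have "int (Poly_Mapping.lookup m q) * jet_deg q > 0" using m(2) q by (simp add: in_keys_iff)
    ultimately have "gcomp jet_deg (mono_deg jet_deg m) p = 0" using assms by (simp add: jet_le_def)
    then show False using m(1) lookup_gcomp[of jet_deg "mono_deg jet_deg m" p m] by (simp add: in_keys_iff)
  qed
  then show "pderiv_c (Zx (Suc (Suc a))) p = 0" "pderiv_c (Zxy (Suc a)) p = 0"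
    by (auto simp: pderiv_c_eq_0_iff)
qed

lemma jet_le_exists: "\<exists>n. jet_le (int n) p"
proof -
  have "finite (mono_deg jet_deg ` Poly_Mapping.keys p)" by simp
  then obtain N where N: "\<forall>x\<in>mono_deg jet_deg ` Poly_Mapping.keys p. x \<le> N"
    using bdd_above_finite bdd_above.unfold by metis
  have "jet_le (int (nat N)) p"
    unfolding jet_le_def
  proof (intro allI impI poly_mapping_eqI)
    fix j m assume "int (nat N) < j"
    moreover have "mono_deg jet_deg m \<le> N" if "m \<in> Poly_Mapping.keys p" using N that by simp
    ultimately show "Poly_Mapping.lookup (gcomp jet_deg j p) m = Poly_Mapping.lookup 0 m"
      by (cases "m \<in> Poly_Mapping.keys p") (auto simp: lookup_gcomp in_keys_iff split: if_splits)
  qed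
  then show ?thesis by blast
qed

lemma cmap_gcomp_mult:
  assumes "fps_hom_deg jet_deg 0 0 f"
  shows "cmap (gcomp jet_deg n) (f * g) = f * cmap (gcomp jet_deg n) g"
proof (rule fps_ext)
  fix k
  have "hom_deg jet_deg 0 (fps_nth f i)" for i using fps_hom_deg_nth[OF assms, of i] by simp
  then have "gcomp jet_deg n (fps_nth f i * p) = fps_nth f i * gcomp jet_deg n p" for i p
    using gcomp_mult[of jet_deg 0 "fps_nth f i" n p] by simp
  then show "fps_nth (cmap (gcomp jet_deg n) (f * g)) k = fps_nth (f * cmap (gcomp jet_deg n) g) k"
    by (simp add: fps_mult_nth gcomp_sum)
qed

subsection \<open>Series with denominators powers of the characteristic polynomial\<close>

definition fin_fps :: "gtpoly fps \<Rightarrow> bool" where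
  "fin_fps f \<longleftrightarrow> (\<exists>n. \<forall>k\<ge>n. fps_nth f k = 0)"

lemma fin_fps_add: "fin_fps f \<Longrightarrow> fin_fps g \<Longrightarrow> fin_fps (f + g)"
proof -
  assume "fin_fps f" "fin_fps g"
  then obtain n m where "\<forall>k\<ge>n. fps_nth f k = 0" "\<forall>k\<ge>m. fps_nth g k = 0" by (auto simp: fin_fps_def)
  then have "\<forall>k\<ge>max n m. fps_nth (f + g) k = 0" by simp
  then show ?thesis unfolding fin_fps_def by blast
qed
lemma fin_fps_minus: "fin_fps f \<Longrightarrow> fin_fps (- f)" by (simp add: fin_fps_def)
lemma fin_fps_diff: "fin_fps f \<Longrightarrow> fin_fps g \<Longrightarrow> fin_fps (f - g)"
  using fin_fps_add[of f "- g"] by (simp add: fin_fps_minus)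
lemma fin_fps_mult:
  assumes "fin_fps f" "fin_fps g" shows "fin_fps (f * g)"
proof -
  obtain n m where nm: "\<forall>k\<ge>n. fps_nth f k = 0" "\<forall>k\<ge>m. fps_nth g k = 0"
    using assms by (auto simp: fin_fps_def)
  have "fps_nth (f * g) k = 0" if "k \<ge> n + m" for k
    unfolding fps_mult_nth
  proof (rule sum.neutral, rule ballI)
    fix i assume "i \<in> {0..k}"
    then have "i \<ge> n \<or> k - i \<ge> m" using that by auto
    then show "fps_nth f i * fps_nth g (k - i) = 0" using nm by auto
  qed
  then show ?thesis unfolding fin_fps_def by blast
qed
lemma fin_fps_const: "fin_fps (fps_const c)" by (auto simp: fin_fps_def intro!: exI[of _ 1])
lemma fin_fps_X: "fin_fps fps_X" by (auto simp: fin_fps_def fps_X_def intro!: exI[of _ 2])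
lemma fin_fps_0: "fin_fps 0" by (simp add: fin_fps_def)
lemma fin_fps_1: "fin_fps 1" using fin_fps_const[of 1] by simp
lemma fin_fps_power: "fin_fps f \<Longrightarrow> fin_fps (f ^ n)"
  by (induction n) (simp_all add: fin_fps_1 fin_fps_mult)
lemma fin_fps_of_nat: "fin_fps (of_nat n)" using fin_fps_const[of "of_nat n"] by (simp add: fps_of_nat)
lemma fin_fps_quad: "fin_fps quad_fps"
  unfolding quad_fps_def by (intro fin_fps_diff fin_fps_mult fin_fps_power fin_fps_X fin_fps_1 fin_fps_const)
lemma fin_fps_cmap: "derivation D \<Longrightarrow> fin_fps f \<Longrightarrow> fin_fps (cmap D f)"
  unfolding fin_fps_def cmap_nth using derivation_simps(4)[of D] by metis
lemma fin_fps_const_mult_cancel: "fin_fps (fps_const r * f) \<Longrightarrow> r \<noteq> 0 \<Longrightarrow> fin_fps f"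
  by (simp add: fin_fps_def)
lemma fin_fps_X_mult_cancel: "fin_fps (fps_X * f) \<Longrightarrow> fin_fps f"
proof -
  assume "fin_fps (fps_X * f)"
  then obtain n where n: "\<forall>k\<ge>n. fps_nth (fps_X * f) k = 0" by (auto simp: fin_fps_def)
  have "fps_nth f k = 0" if "k \<ge> n" for k using n[rule_format, of "Suc k"] that by simp
  then show ?thesis unfolding fin_fps_def by blast
qed

lemma quad_power_mult_eq_0: "quad_fps ^ n * f = 0 \<Longrightarrow> f = 0"
proof -
  assume "quad_fps ^ n * f = 0"
  then have "sigma_fps ^ n * (quad_fps ^ n * f) = 0" by simp
  moreover have "sigma_fps ^ n * (quad_fps ^ n * f) = (quad_fps * sigma_fps) ^ n * f"
    unfolding power_mult_distrib by (simp only: mult_ac)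
  ultimately show ?thesis by (simp add: quad_sigma)
qed

text \<open>Rational functions of t whose denominator is a power of the characteristic polynomial;
  \<open>fin_fps\<close> singles out the polynomials in t.\<close>

definition rat_fps :: "gtpoly fps \<Rightarrow> bool" where
  "rat_fps f \<longleftrightarrow> (\<exists>N. fin_fps (quad_fps ^ N * f))"

lemma rat_fpsI: "fin_fps (quad_fps ^ N * f) \<Longrightarrow> rat_fps f"
  by (auto simp: rat_fps_def)

lemma rat_fps_0: "rat_fps 0" by (simp add: rat_fps_def fin_fps_0)

lemma rat_fps_const_mult: "rat_fps f \<Longrightarrow> rat_fps (fps_const c * f)"
proof -
  assume "rat_fps f"
  then obtain N where "fin_fps (quad_fps ^ N * f)" by (auto simp: rat_fps_def)
  then have "fin_fps (fps_const c * (quad_fps ^ N * f))" by (rule fin_fps_mult[OF fin_fps_const])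
  then show ?thesis by (intro rat_fpsI[of N]) (simp only: mult_ac)
qed

lemma rat_fps_add: "rat_fps f \<Longrightarrow> rat_fps g \<Longrightarrow> rat_fps (f + g)"
proof -
  assume "rat_fps f" "rat_fps g"
  then obtain N M where "fin_fps (quad_fps ^ N * f)" "fin_fps (quad_fps ^ M * g)" by (auto simp: rat_fps_def)
  then have "fin_fps (quad_fps ^ M * (quad_fps ^ N * f) + quad_fps ^ N * (quad_fps ^ M * g))"
    by (blast intro: fin_fps_add fin_fps_mult[OF fin_fps_power[OF fin_fps_quad]])
  then show ?thesis by (intro rat_fpsI[of "N + M"]) (simp add: power_add algebra_simps)
qed

lemma rat_fps_minus: "rat_fps f \<Longrightarrow> rat_fps (- f)"
  using rat_fps_const_mult[of f "- 1"] by (simp flip: fps_const_neg)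

lemma rat_fps_diff: "rat_fps f \<Longrightarrow> rat_fps g \<Longrightarrow> rat_fps (f - g)"
  using rat_fps_add[of f "- g"] by (simp add: rat_fps_minus)

lemma rat_fps_sum: "(\<And>i. i \<in> I \<Longrightarrow> rat_fps (f i)) \<Longrightarrow> rat_fps (\<Sum>i\<in>I. f i)"
  by (induction I rule: infinite_finite_induct) (auto simp: rat_fps_0 rat_fps_add)

lemma cmap_power_Suc: "derivation D \<Longrightarrow> cmap D (f ^ Suc n) = of_nat (Suc n) * (f ^ n * cmap D f)"
  by (simp only: cmap_simps(11) diff_Suc_1 mult.assoc)

lemma cmap_quad_power_mult:
  assumes D: "derivation D"
  shows "quad_fps * cmap D (quad_fps ^ N * f) = of_nat N * (cmap D quad_fps * (quad_fps ^ N * f)) + quad_fps ^ Suc N * cmap D f"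
proof (cases N)
  case (Suc n)
  show ?thesis
    unfolding Suc cmap_simps(2)[OF D] cmap_power_Suc[OF D] by (simp add: algebra_simps)
qed (simp add: cmap_simps[OF D])

lemma rat_fps_cmap:
  assumes D: "derivation D" and "rat_fps f"
  shows "rat_fps (cmap D f)"
proof -
  obtain N where N: "fin_fps (quad_fps ^ N * f)" using assms by (auto simp: rat_fps_def)
  have "quad_fps ^ Suc N * cmap D f = quad_fps * cmap D (quad_fps ^ N * f) - of_nat N * (cmap D quad_fps * (quad_fps ^ N * f))"
    using cmap_quad_power_mult[OF D, of N f] by simp
  moreover have "fin_fps (quad_fps * cmap D (quad_fps ^ N * f) - of_nat N * (cmap D quad_fps * (quad_fps ^ N * f)))"
    by (intro fin_fps_diff fin_fps_mult fin_fps_quad fin_fps_cmap D N fin_fps_of_nat)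
  ultimately show ?thesis using rat_fpsI[of "Suc N"] by metis
qed

text \<open>Each coefficient of \<open>g a\<close> vanishes for large a, but with a bound depending
  on the coefficient. The recursion makes \<open>max a0 n0\<close> a uniform bound, and rationality
  then descends from there in finitely many steps.\<close>

lemma rat_fps_downward:
  fixes g w :: "nat \<Rightarrow> gtpoly fps"
  assumes step: "\<And>a. a \<ge> a0 \<Longrightarrow> g a = w a - cmap Dtop (g (Suc a))" and w: "\<And>a. rat_fps (w a)"
    and w0: "\<And>a. a \<ge> n0 \<Longrightarrow> w a = 0" and fin: "\<And>k. \<exists>N. \<forall>a\<ge>N. fps_nth (g a) k = 0"
  shows "a \<ge> a0 \<Longrightarrow> rat_fps (g a)" and "a \<ge> max a0 n0 \<Longrightarrow> g a = 0"
proof -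
  have 0: "g a = 0" if a: "a \<ge> max a0 n0" for a
  proof (rule fps_ext)
    fix k
    obtain N where N: "\<forall>a\<ge>N. fps_nth (g a) k = 0" using fin by blast
    have "fps_nth (g a) k = 0"
    proof (rule downward_vanish[of N "\<lambda>a. fps_nth (g a) k" "max a0 n0"])
      fix a assume a: "a \<ge> max a0 n0" "fps_nth (g (Suc a)) k = 0"
      then have "fps_nth (g a) k = fps_nth (w a) k - Dtop (fps_nth (g (Suc a)) k)"
        using step[of a] by (metis cmap_nth fps_sub_nth max.bounded_iff)
      then show "fps_nth (g a) k = 0" using a w0[of a] by (simp add: derivation_simps(4)[OF derivation_Dtop])
    qed (use N a in auto)
    then show "fps_nth (g a) k = fps_nth 0 k" by simp
  qed
  then show "a \<ge> max a0 n0 \<Longrightarrow> g a = 0" .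
  show "rat_fps (g a)" if "a \<ge> a0"
  proof (cases "a \<ge> max a0 n0")
    case False
    then have "a \<le> max a0 n0" by linarith
    then show ?thesis
      using that
    proof (induction a rule: inc_induct)
      case base
      then show ?case using 0 by (simp add: rat_fps_0)
    next
      case (step n)
      have r: "rat_fps (g (Suc n))" by (rule step.IH) (use step.prems in simp)
      show ?case unfolding assms(1)[OF step.prems]
        by (rule rat_fps_diff[OF w rat_fps_cmap[OF derivation_Dtop r]])
    qed
  qed (simp add: 0 rat_fps_0)
qed

lemma fin_fps_jets: "fin_fps f \<Longrightarrow> \<exists>N. \<forall>a\<ge>N. cmap (pderiv_c (Zx a)) f = 0 \<and> cmap (pderiv_c (Zxy a)) f = 0"
proof -
  assume "fin_fps f"
  then obtain n where n: "\<forall>k\<ge>n. fps_nth f k = 0" by (auto simp: fin_fps_def)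
  have "\<forall>k. \<exists>N. \<forall>a\<ge>N. pderiv_c (Zx a) (fps_nth f k) = 0 \<and> pderiv_c (Zxy a) (fps_nth f k) = 0"
    using finite_jets by blast
  from choice[OF this] obtain b where b: "\<And>k a. a \<ge> b k \<Longrightarrow> pderiv_c (Zx a) (fps_nth f k) = 0 \<and> pderiv_c (Zxy a) (fps_nth f k) = 0"
    by blast
  have "cmap (pderiv_c (Zx a)) f = 0 \<and> cmap (pderiv_c (Zxy a)) f = 0" if "a \<ge> (\<Sum>k<n. b k)" for a
  proof -
    have "pderiv_c (Zx a) (fps_nth f k) = 0 \<and> pderiv_c (Zxy a) (fps_nth f k) = 0" for k
    proof (cases "k < n")
      case True
      then have "b k \<le> (\<Sum>k<n. b k)" by (intro member_le_sum) auto
      then show ?thesis using b[of k a] that by simp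
    qed (use n in \<open>simp add: derivation_simps(4)[OF derivation_pderiv_c]\<close>)
    then show ?thesis by (simp add: fps_eq_iff)
  qed
  then show ?thesis by blast
qed

text \<open>Commuting \<open>Dtop\<close> with jet derivatives gives the recursion of
  \<open>rat_fps_downward\<close> for the jet derivatives of f, with those of W as source. Finitely
  many of them are nonzero, and as d is not 0 Euler's identity recovers f from them.\<close>

lemma rat_fps_if_cmap_Dtop_rat:
  assumes W: "cmap Dtop f = W" and fin: "fin_fps (quad_fps ^ 2 * W)"
    and hom: "\<And>k. hom_deg jet_deg d (fps_nth f k)" and d: "d \<ge> 1"
  shows "rat_fps f"
proof -
  have quad0: "cmap (pderiv_c q) quad_fps = 0" if "q \<noteq> Zx (Suc 0)" "q \<noteq> Zxy 0" for q
    using that by (simp add: cmap_quad[OF derivation_pderiv_c] zx_def zy_def pderiv_c_var)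
  have ratW: "rat_fps (cmap (pderiv_c q) W)" for q
    by (intro rat_fps_cmap derivation_pderiv_c rat_fpsI[OF fin])
  have *: "cmap (pderiv_c q) (quad_fps ^ 2 * W) = quad_fps ^ 2 * cmap (pderiv_c q) W" if "q \<noteq> Zx (Suc 0)" "q \<noteq> Zxy 0" for q
    using quad0[OF that] by (simp add: cmap_simps[OF derivation_pderiv_c])
  \<comment> \<open>A polynomial in t has finitely many coefficients, so one bound covers all jets
    occurring in it.\<close>
  obtain N where N: "\<And>a. a \<ge> N \<Longrightarrow> cmap (pderiv_c (Zx a)) (quad_fps ^ 2 * W) = 0"
      "\<And>a. a \<ge> N \<Longrightarrow> cmap (pderiv_c (Zxy a)) (quad_fps ^ 2 * W) = 0"
    using fin_fps_jets[OF fin] by blast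
  have finj: "\<exists>N. \<forall>a\<ge>N. fps_nth (cmap (pderiv_c (Zx a)) f) k = 0" "\<exists>N. \<forall>a\<ge>N. fps_nth (cmap (pderiv_c (Zxy a)) f) k = 0" for k
    using finite_jets[of "fps_nth f k"] by auto
  have sx: "cmap (pderiv_c (Zx a)) f = cmap (pderiv_c (Zx (Suc a))) W - cmap Dtop (cmap (pderiv_c (Zx (Suc a))) f)" if "a \<ge> 1" for a
  proof -
    have "Suc (a - 1) = a" using that by simp
    then show ?thesis using pderiv_Dtop_Zx[of "a - 1"] unfolding W[symmetric] fps_eq_iff by simp
  qed
  have sy: "cmap (pderiv_c (Zxy a)) f = cmap (pderiv_c (Zxy (Suc a))) W - cmap Dtop (cmap (pderiv_c (Zxy (Suc a))) f)" for a
    using pderiv_Dtop_Zxy[of a] unfolding W[symmetric] fps_eq_iff by simp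
  have zx: "cmap (pderiv_c (Zx (Suc a))) W = 0" if "a \<ge> max N 1" for a
    by (rule quad_power_mult_eq_0[of 2]) (use N(1)[of "Suc a"] *[of "Zx (Suc a)"] that in simp)
  have zy: "cmap (pderiv_c (Zxy (Suc a))) W = 0" if "a \<ge> N" for a
    by (rule quad_power_mult_eq_0[of 2]) (use N(2)[of "Suc a"] *[of "Zxy (Suc a)"] that in simp)
  note X = rat_fps_downward[of 1 "\<lambda>a. cmap (pderiv_c (Zx a)) f" "\<lambda>a. cmap (pderiv_c (Zx (Suc a))) W", OF sx ratW, of "max N 1", OF _ zx finj(1)]
  note Y = rat_fps_downward[of 0 "\<lambda>a. cmap (pderiv_c (Zxy a)) f" "\<lambda>a. cmap (pderiv_c (Zxy (Suc a))) W", OF sy ratW, of N, OF zy finj(2)]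
  define Q where "Q = Zx ` {1..N+1} \<union> Zxy ` {0..N+1}"
  have "rat_fps (\<Sum>q\<in>Q. fps_const (of_int (jet_deg q) * var q) * cmap (pderiv_c q) f)"
  proof (rule rat_fps_sum)
    fix q assume "q \<in> Q"
    then consider a where "q = Zx a" "a \<ge> 1" | a where "q = Zxy a" by (auto simp: Q_def)
    then have "rat_fps (cmap (pderiv_c q) f)" using X(1) Y(1) by cases auto
    then show "rat_fps (fps_const (of_int (jet_deg q) * var q) * cmap (pderiv_c q) f)" by (rule rat_fps_const_mult)
  qed
  moreover have "(\<Sum>q\<in>Q. fps_const (of_int (jet_deg q) * var q) * cmap (pderiv_c q) f) = fps_const (of_int d) * f"
  proof (rule fps_ext)
    fix k
    have "q \<in> Q" if q: "q \<in> vars (fps_nth f k)" "jet_deg q \<noteq> 0" for q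
    proof (rule ccontr)
      assume "q \<notin> Q"
      then consider a where "q = Zx a" "a \<ge> max 1 (max N 1)" | a where "q = Zxy a" "a \<ge> max 0 N"
        using q(2) by (cases q) (auto simp: Q_def image_iff)
      then have "cmap (pderiv_c q) f = 0" using X(2) Y(2) by cases auto
      then have "pderiv_c q (fps_nth f k) = 0" by (metis cmap_nth fps_zero_nth)
      then show False using q by (simp add: pderiv_c_eq_0_iff)
    qed
    then show "fps_nth (\<Sum>q\<in>Q. fps_const (of_int (jet_deg q) * var q) * cmap (pderiv_c q) f) k = fps_nth (fps_const (of_int d) * f) k"
      using hom_deg_euler[OF hom, of Q k] by (simp add: fps_sum_nth Q_def)
  qed
  ultimately have "rat_fps (fps_const (cst (1 / real_of_int d)) * (fps_const (of_int d) * f))" by (simp only: rat_fps_const_mult)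
  moreover have "cst (1 / real_of_int d) * of_int d = 1"
    using d by (simp flip: cst_of_int cst_mult)
  ultimately show ?thesis by (simp add: mult.assoc[symmetric])
qed

text \<open>Differentiating a pole of order at least two raises the order beyond two, because the
  derivative of the characteristic polynomial is coprime to it; so poles are simple.\<close>

lemma fin_fps_reduce:
  assumes fin: "fin_fps (quad_fps ^ 2 * cmap Dtop f)" and N: "fin_fps (quad_fps ^ Suc (Suc N) * f)"
  shows "fin_fps (quad_fps ^ Suc N * f)"
proof -
  let ?h = "quad_fps ^ Suc N * f" and ?a = "var (Zx 2)" and ?b = "var (Zxy 1)"
  define L where "L = fps_const ?a + fps_const ?b * fps_X"
  have L: "cmap Dtop quad_fps = - (fps_X * L)"
    by (simp add: cmap_quad[OF derivation_Dtop] derivation_zx_zy L_def algebra_simps power2_eq_square flip: fps_const_neg)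
  have "cmap Dtop (quad_fps ^ Suc (Suc N) * f) = of_nat (Suc (Suc N)) * (cmap Dtop quad_fps * ?h) + quad_fps ^ N * (quad_fps ^ 2 * cmap Dtop f)"
    unfolding cmap_simps(2)[OF derivation_Dtop] cmap_power_Suc[OF derivation_Dtop]
    by (simp add: mult_ac power2_eq_square)
  then have "of_nat (Suc (Suc N)) * (fps_X * (L * ?h)) = quad_fps ^ N * (quad_fps ^ 2 * cmap Dtop f) - cmap Dtop (quad_fps ^ Suc (Suc N) * f)"
    unfolding L by (simp only: mult_minus_left mult_minus_right mult.assoc) simp
  moreover have "fin_fps (quad_fps ^ N * (quad_fps ^ 2 * cmap Dtop f) - cmap Dtop (quad_fps ^ Suc (Suc N) * f))"
    by (intro fin_fps_diff fin_fps_mult[OF fin_fps_power] fin_fps_quad fin_fps_cmap derivation_Dtop fin N)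
  ultimately have "fin_fps (fps_const (of_nat (Suc (Suc N))) * (fps_X * (L * ?h)))"
    by (simp only: fps_of_nat)
  then have Lh: "fin_fps (L * ?h)"
    by (intro fin_fps_X_mult_cancel[of "L * ?h"]) (rule fin_fps_const_mult_cancel, assumption, simp del: of_nat_Suc)
  \<comment> \<open>r is the resultant of L and the characteristic polynomial: z_xy^2 times the
    value of the latter at the root - z_xx / z_xy of L. The polynomial b is the other cofactor in
    the Bezout identity.\<close>
  define r where "r = ?b ^ 2 + zx * ?a * ?b - zy * ?a ^ 2"
  define b where "b = fps_const (zx * ?b - zy * ?a) + fps_const (zy * ?b) * fps_X"
  have "fps_const r = fps_const (?b ^ 2) * quad_fps + b * L"
    by (simp add: r_def b_def L_def quad_fps_def algebra_simps power2_eq_square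
        flip: fps_const_mult fps_const_add fps_const_sub fps_const_power)
  then have "fps_const r * ?h = fps_const (?b ^ 2) * (quad_fps ^ Suc (Suc N) * f) + b * (L * ?h)"
    by (simp add: algebra_simps)
  moreover have "fin_fps b"
    unfolding b_def by (intro fin_fps_add fin_fps_mult fin_fps_const fin_fps_X)
  ultimately have "fin_fps (fps_const r * ?h)"
    using N Lh by (simp only:) (intro fin_fps_add fin_fps_mult[OF fin_fps_const] fin_fps_mult[of b])
  \<comment> \<open>The second derivative of r in z_xy is 2.\<close>
  moreover have "r \<noteq> 0"
  proof
    assume "r = 0"
    then have "pderiv_c (Zxy 1) (pderiv_c (Zxy 1) r) = 0" by (simp add: derivation_simps[OF derivation_pderiv_c])
    then show False
      by (simp add: r_def derivation_simps[OF derivation_pderiv_c] pderiv_c_var zx_def zy_def)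
  qed
  ultimately show ?thesis by (rule fin_fps_const_mult_cancel)
qed

text \<open>The hypothesis says that \<open>Dtop\<close> annihilates the quotient p / z_y, which has
  nonzero degree; the argument is that of \<open>Dtop_hom_eq_0\<close> with denominators
  cleared.\<close>

lemma hom_jet_deg_proportional_zy:
  assumes "zy * Dtop p = p * Dtop zy" "hom_deg jet_deg d p" "d \<noteq> 0"
  shows "p = 0"
proof (rule hom_jet_deg_eq_0[OF assms(2,3)])
  note s = derivation_simps[OF derivation_pderiv_c] derivation_simps(4)[OF derivation_Dtop]
  have zy0: "zy \<noteq> 0" using derivation_zx_zy(4) by (auto simp: s)
  have x: "pderiv_c (Zx (Suc a)) p = 0" if "pderiv_c (Zx (Suc (Suc a))) p = 0" for a
  proof -
    have "pderiv_c (Zx (Suc (Suc a))) (zy * Dtop p) = pderiv_c (Zx (Suc (Suc a))) (p * Dtop zy)" by (simp add: assms(1))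
    then have "zy * pderiv_c (Zx (Suc a)) p = 0"
      using that by (simp add: s derivation_zx_zy pderiv_Dtop_Zx, simp add: zy_def pderiv_c_var)
    then show ?thesis using zy0 by simp
  qed
  have y: "pderiv_c (Zxy (Suc a)) p = 0" if "pderiv_c (Zxy (Suc (Suc a))) p = 0" for a
  proof -
    have "pderiv_c (Zxy (Suc (Suc a))) (zy * Dtop p) = pderiv_c (Zxy (Suc (Suc a))) (p * Dtop zy)" by (simp add: assms(1))
    then have "zy * pderiv_c (Zxy (Suc a)) p = 0"
      using that by (simp add: s derivation_zx_zy pderiv_Dtop_Zxy, simp add: zy_def pderiv_c_var)
    then show ?thesis using zy0 by simp
  qed
  show "pderiv_c (Zx (Suc a)) p = 0" "pderiv_c (Zxy (Suc a)) p = 0" for a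
    using jets_vanish[of p] x y by blast+
qed

text \<open>By \<open>fin_fps_reduce\<close> f = R / quad with R polynomial in t. The right-hand
  side starts at t^3, so R does too, while in high degrees it is absent; this forces the top
  coefficient of R to be proportional to z_y over the constants of \<open>Dtop\<close>, hence to
  vanish.\<close>

lemma cmap_Dtop_double_pole:
  assumes W: "quad_fps ^ 2 * cmap Dtop f = fps_X ^ 3 * (fps_const z1 + fps_const z2 * fps_X)"
    and hom: "\<And>k. hom_deg jet_deg d (fps_nth f k)" and d: "d \<ge> 1"
  shows "z1 = 0" "z2 = 0"
proof -
  let ?W = "fps_X ^ 3 * (fps_const z1 + fps_const z2 * fps_X)"
  have fin: "fin_fps (quad_fps ^ 2 * cmap Dtop f)"
    unfolding W by (intro fin_fps_mult fin_fps_add fin_fps_const fin_fps_power fin_fps_X)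
  obtain N where "fin_fps (quad_fps ^ N * f)"
    using rat_fps_if_cmap_Dtop_rat[OF refl fin hom d] by (auto simp: rat_fps_def)
  then have "fin_fps (quad_fps ^ Suc N * f)" using fin_fps_mult[OF fin_fps_quad] by (simp add: mult.assoc)
  then have "fin_fps (quad_fps ^ Suc 0 * f)"
    by (induction N) (blast dest: fin_fps_reduce[OF fin])+
  then have R: "fin_fps (quad_fps * f)" by simp
  define R where "R = quad_fps * f"
  have homR: "hom_deg jet_deg d (fps_nth R k)" for k
  proof -
    have "fps_hom_deg jet_deg 0 0 quad_fps" using fps_hom_deg_quad[of jet_deg 0] jet_deg_zx jet_deg_zy by simp
    moreover have "fps_hom_deg jet_deg 0 d f" using hom by (simp add: fps_hom_deg_def)
    ultimately have "fps_hom_deg jet_deg 0 (0 + d) R" unfolding R_def by (rule fps_hom_deg_mult)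
    then show ?thesis using fps_hom_deg_nth by fastforce
  qed
  have eqR: "quad_fps * cmap Dtop R - R * cmap Dtop quad_fps = ?W"
    unfolding W[symmetric] R_def by (simp add: cmap_simps[OF derivation_Dtop] algebra_simps power2_eq_square)
  have "cmap Dtop f = (quad_fps * sigma_fps) ^ 2 * cmap Dtop f" by (simp add: quad_sigma)
  also have "\<dots> = sigma_fps ^ 2 * (quad_fps ^ 2 * cmap Dtop f)" unfolding power_mult_distrib by (simp only: mult_ac)
  also have "\<dots> = fps_X ^ 3 * (sigma_fps ^ 2 * (fps_const z1 + fps_const z2 * fps_X))" unfolding W by (simp only: mult_ac)
  finally have "fps_nth (cmap Dtop f) i = 0" if "i < 3" for i using that by (simp add: fps_X_power_mult_nth)
  then have f3: "fps_nth f i = 0" if "i < 3" for i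
    using that Dtop_hom_eq_0[OF _ hom] d by auto
  have R3: "fps_nth R i = 0" if "i < 3" for i
    unfolding R_def fps_mult_nth using f3 that by (intro sum.neutral) auto
  have "R = 0"
  proof (rule ccontr)
    assume "R \<noteq> 0"
    obtain n where n: "\<forall>k\<ge>n. fps_nth R k = 0" using R by (auto simp: fin_fps_def R_def)
    have fin: "finite {k. fps_nth R k \<noteq> 0}" (is "finite ?K")
      by (rule finite_subset[of _ "{..<n}"]) (use n not_le in auto)
    moreover have "?K \<noteq> {}" using \<open>R \<noteq> 0\<close> by (auto simp: fps_eq_iff)
    ultimately have M: "Max ?K \<in> ?K" by (rule Max_in)
    define M where "M = Max ?K"
    have above: "fps_nth R k = 0" if "k > M" for k using that fin Max_ge[OF fin, of k] unfolding M_def by fastforce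
    have M3: "M \<ge> 3" using M R3[of M] unfolding M_def[symmetric] by (cases "M < 3") auto
    have exp: "?W = cmap Dtop R - fps_X * (fps_const zx * cmap Dtop R) - fps_X ^ 2 * (fps_const zy * cmap Dtop R)
         + fps_X * (fps_const (Dtop zx) * R) + fps_X ^ 2 * (fps_const (Dtop zy) * R)"
      unfolding eqR[symmetric] cmap_quad[OF derivation_Dtop]
      by (simp add: quad_fps_def algebra_simps flip: fps_const_neg)
    \<comment> \<open>The right-hand side has degree at most 4 in t and M + 2 exceeds it. On the
      left only the top coefficient of R contributes, through the terms with z_y t^2.\<close>
    have "fps_nth ?W (M + 2) = 0" using M3 by (simp add: fps_X_power_mult_nth)
    then have "- (zy * Dtop (fps_nth R M)) + Dtop zy * fps_nth R M = 0"
      unfolding exp using above[of "M + 1"] above[of "M + 2"]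
      by (simp add: fps_X_power_mult_nth derivation_simps(4)[OF derivation_Dtop])
    then have "fps_nth R M = 0"
      using hom_jet_deg_proportional_zy[OF _ homR, of M] d by (simp add: algebra_simps)
    then show False using M by (simp add: M_def)
  qed
  then have W0: "?W = 0" using eqR by (simp add: cmap_simps[OF derivation_Dtop])
  have "fps_nth ?W 3 = z1" "fps_nth ?W 4 = z2" by (simp_all add: fps_X_power_mult_nth)
  then show "z1 = 0" "z2 = 0" unfolding W0 by simp_all
qed

subsection \<open>Symmetries have order at most one\<close>

locale gt_symmetry =
  fixes S :: vfield
  assumes nonlocal: "nonlocal_symmetry S"
begin

abbreviation "DX \<equiv> vf_app Dx"
abbreviation "DY \<equiv> vf_app Dy"
abbreviation "VS \<equiv> vf_app S"

lemma VS_DX: "VS (DX p) = DX (VS p)"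
proof -
  have "VS (DX p) - DX (VS p) = 0"
    by (rule derivation_ext[OF derivation_commutator[OF derivation_vf_app derivation_vf_app] derivation_zero])
      (use nonlocal in \<open>simp add: vf_app_var nonlocal_symmetry_def\<close>)
  then show ?thesis by simp
qed

lemma VS_DY: "VS (DY p) = DY (VS p)"
proof -
  have "VS (DY p) - DY (VS p) = 0"
    by (rule derivation_ext[OF derivation_commutator[OF derivation_vf_app derivation_vf_app] derivation_zero])
      (use nonlocal in \<open>simp add: vf_app_var nonlocal_symmetry_def\<close>)
  then show ?thesis by simp
qed

text \<open>The components of S on all psi^(n) in one series. Below t^3 it vanishes because S has no
  x and y components, and its coefficient at t^3 is Z.\<close>

definition P :: "gtpoly fps" where "P = cmap VS psi_fps"
definition Z :: gtpoly where "Z = S (Zx 0)"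

lemma VS_x_y: "VS (var Xc) = 0" "VS (var Yc) = 0"
  using nonlocal by (simp_all add: vf_app_var nonlocal_symmetry_def)

lemma VS_zx: "VS zx = DX Z"
  using VS_DX[of "var (Zx 0)"] by (simp add: vf_app_var Dx_def zx_def Z_def)
lemma VS_zy: "VS zy = DY Z"
  using VS_DY[of "var (Zx 0)"] by (simp add: vf_app_var Dy_def zy_def Z_def)

lemma cmap_VS_dpsi: "cmap VS dpsi_fps = - (fps_X ^ 2 * fps_deriv P)"
  by (simp add: cmap_dpsi[OF derivation_vf_app] P_def)

lemma cmap_VS_sigma: "cmap VS sigma_fps = sigma_fps ^ 2 * (fps_const (DX Z) * fps_X + fps_const (DY Z) * fps_X ^ 2)"
  by (simp add: cmap_sigma[OF derivation_vf_app] VS_zx VS_zy)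

text \<open>S commutes with D_x, so D_x P is S applied to the closed form of D_x psi: the linearised
  covering equation.\<close>

lemma cmap_DX_P:
  "cmap DX P = - (fps_X ^ 4 * (sigma_fps * fps_deriv P)) +
    fps_X ^ 3 * (dpsi_fps * sigma_fps ^ 2 * (fps_const (DX Z) + fps_const (DY Z) * fps_X))"
proof -
  have "cmap DX P = cmap VS (cmap DX psi_fps)"
    unfolding P_def fps_eq_iff cmap_nth VS_DX by simp
  also have "\<dots> = cmap VS x_fps" by (simp add: cmap_Dx_psi)
  also have "\<dots> = fps_X ^ 2 * (cmap VS dpsi_fps * sigma_fps + dpsi_fps * cmap VS sigma_fps)"
    by (simp add: x_fps_def cmap_simps[OF derivation_vf_app] algebra_simps)
  finally show ?thesis
    unfolding cmap_VS_dpsi cmap_VS_sigma by (simp add: algebra_simps eval_nat_numeral)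
qed

lemma cmap_DY_P:
  "cmap DY P = - (fps_X ^ 2 * fps_deriv P * (fps_X + fps_const zy * fps_X ^ 3 * sigma_fps)) +
    dpsi_fps * fps_X ^ 3 * (fps_const (DY Z) * sigma_fps
      + fps_const zy * fps_X * sigma_fps ^ 2 * (fps_const (DX Z) + fps_const (DY Z) * fps_X))"
proof -
  have "cmap DY P = cmap VS (cmap DY psi_fps)"
    unfolding P_def fps_eq_iff cmap_nth VS_DY by simp
  also have "\<dots> = cmap VS y_fps" by (simp add: cmap_Dy_psi)
  also have "\<dots> = cmap VS dpsi_fps * (fps_X + fps_const zy * fps_X ^ 3 * sigma_fps)
      + dpsi_fps * fps_X ^ 3 * (fps_const (DY Z) * sigma_fps + fps_const zy * cmap VS sigma_fps)"
    by (simp add: y_fps_def cmap_simps[OF derivation_vf_app] VS_zy algebra_simps)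
  finally show ?thesis
    unfolding cmap_VS_dpsi cmap_VS_sigma by (simp add: algebra_simps eval_nat_numeral)
qed

lemma P_nth_012: "n < 3 \<Longrightarrow> fps_nth P n = 0"
  using VS_x_y derivation_simps(4)[OF derivation_vf_app, of S]
  by (auto simp: P_def psi_fps_nth psi_def less_Suc_eq numeral_3_eq_3)

lemma P_nth_3: "fps_nth P 3 = Z"
proof -
  have "VS (cst (1 / 2) * (var Yc)\<^sup>2) = 0"
    by (simp add: derivation_cmult[OF derivation_vf_app] derivation_simps(11)[OF derivation_vf_app] VS_x_y)
  then show ?thesis
    by (simp add: P_def psi_fps_nth psi_def derivation_simps(7)[OF derivation_vf_app] vf_app_var Z_def)
qed

text \<open>The factor t^4 outweighs the index shift of \<open>fps_deriv\<close>, so coefficient k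
  only involves earlier coefficients of P. This is what allows induction on the index.\<close>

lemma gcomp_sigma_deriv_P:
  assumes "\<And>i. i < k \<Longrightarrow> gcomp jet_deg j (fps_nth P i) = 0"
  shows "gcomp jet_deg j (fps_nth (fps_X ^ 4 * (sigma_fps * fps_deriv P)) k) = 0"
proof -
  have g: "gcomp jet_deg j (of_nat c * p) = of_nat c * gcomp jet_deg j p" for c p
    using gcomp_mult[of jet_deg 0 "cst (real c)" j p] hom_deg_cst[of jet_deg "real c"] by (simp add: cst_of_nat)
  have "fps_nth (sigma_fps * cmap (gcomp jet_deg j) (fps_deriv P)) (k - 4) = 0" if "k \<ge> 4"
    unfolding fps_mult_nth using that assms
    by (intro sum.neutral) (auto simp: g simp del: of_nat_Suc of_nat_add)
  then show ?thesis
    using arg_cong[OF cmap_gcomp_mult[OF jet_deg_sigma, of j "fps_deriv P"], of "\<lambda>f. fps_nth f (k - 4)"]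
    by (simp only: fps_X_power_mult_nth cmap_nth) simp
qed

lemma gcomp_second_part:
  "gcomp jet_deg j (fps_nth (fps_X ^ 3 * (dpsi_fps * sigma_fps ^ 2 * (fps_const p + fps_const q * fps_X))) k) =
   fps_nth (fps_X ^ 3 * (dpsi_fps * sigma_fps ^ 2 * (fps_const (gcomp jet_deg j p) + fps_const (gcomp jet_deg j q) * fps_X))) k"
proof -
  have "fps_hom_deg jet_deg 0 0 (fps_X ^ 3 * (dpsi_fps * sigma_fps ^ 2))"
    using fps_hom_deg_mult[OF fps_hom_deg_power[OF fps_hom_deg_X, of jet_deg 0 3]
      fps_hom_deg_mult[OF jet_deg_dpsi fps_hom_deg_power[OF jet_deg_sigma, of 2]]] by simp
  then have 1: "cmap (gcomp jet_deg j) (fps_X ^ 3 * (dpsi_fps * sigma_fps ^ 2) * (fps_const p + fps_const q * fps_X)) =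
     fps_X ^ 3 * (dpsi_fps * sigma_fps ^ 2) * cmap (gcomp jet_deg j) (fps_const p + fps_const q * fps_X)"
    by (rule cmap_gcomp_mult)
  have 2: "cmap (gcomp jet_deg j) (fps_const p + fps_const q * fps_X) = fps_const (gcomp jet_deg j p) + fps_const (gcomp jet_deg j q) * fps_X"
    by (rule fps_ext) (simp add: gcomp_add fps_X_def)
  show ?thesis
    using arg_cong[OF 1, of "\<lambda>f. fps_nth f k"] by (simp only: 2 mult.assoc cmap_nth)
qed

lemma jet_le_P:
  assumes "e \<ge> 1" "jet_le e (DX Z)" "jet_le e (DY Z)"
  shows "jet_le (e - 1) (fps_nth P k)"
proof (induction k rule: less_induct)
  case (less k)
  have "gcomp jet_deg j (DX (fps_nth P k)) = 0" if "j > e" for j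
  proof -
    have "gcomp jet_deg j (fps_nth P i) = 0" if "i < k" for i
      using less[OF that] \<open>j > e\<close> by (simp add: jet_le_def)
    then have "gcomp jet_deg j (fps_nth (fps_X ^ 4 * (sigma_fps * fps_deriv P)) k) = 0"
      by (rule gcomp_sigma_deriv_P)
    moreover have "gcomp jet_deg j (DX Z) = 0" "gcomp jet_deg j (DY Z) = 0" using assms that by (simp_all add: jet_le_def)
    moreover have "DX (fps_nth P k) = fps_nth (cmap DX P) k" by simp
    ultimately show ?thesis
      unfolding cmap_DX_P by (simp only: fps_add_nth fps_neg_nth gcomp_add gcomp_minus gcomp_second_part) simp
  qed
  then have "jet_le e (DX (fps_nth P k))" by (simp add: jet_le_def)
  then show ?case using jet_le_Dx[of "e - 1"] assms(1) by simp
qed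

text \<open>With p the degree e - 1 part of P, the degree e part of D_x P is just
  \<open>Dtop\<close> applied to p, and the term with P' has no part of degree e. What remains is a
  double pole times psi'.\<close>

lemma jet_le_step:
  assumes e: "e \<ge> 2" and le: "jet_le e (DX Z)" "jet_le e (DY Z)"
  shows "gcomp jet_deg e (DX Z) = 0" "gcomp jet_deg e (DY Z) = 0"
proof -
  have leP: "jet_le (e - 1) (fps_nth P k)" for k
    by (rule jet_le_P) (use assms in auto)
  define p where "p = cmap (gcomp jet_deg (e - 1)) P"
  let ?z = "\<lambda>e. fps_const (gcomp jet_deg e (DX Z)) + fps_const (gcomp jet_deg e (DY Z)) * fps_X"
  have Dp: "cmap Dtop p = fps_X ^ 3 * (dpsi_fps * sigma_fps ^ 2 * ?z e)"
  proof (rule fps_ext)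
    fix k
    have 0: "gcomp jet_deg e (fps_nth P i) = 0" for i using leP[of i] by (simp add: jet_le_def)
    have "fps_nth (cmap Dtop p) k = gcomp jet_deg e (DX (fps_nth P k))"
      using gcomp_Dx[of e "fps_nth P k"] 0 by (simp add: p_def derivation_simps(4)[OF derivation_Azero])
    also have "DX (fps_nth P k) = fps_nth (cmap DX P) k" by simp
    also have "gcomp jet_deg e (fps_nth (cmap DX P) k) = fps_nth (fps_X ^ 3 * (dpsi_fps * sigma_fps ^ 2 * ?z e)) k"
      unfolding cmap_DX_P using gcomp_sigma_deriv_P[of k e] 0
      by (simp only: fps_add_nth fps_neg_nth gcomp_add gcomp_minus gcomp_second_part) simp
    finally show "fps_nth (cmap Dtop p) k = fps_nth (fps_X ^ 3 * (dpsi_fps * sigma_fps ^ 2 * ?z e)) k" .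
  qed
  have d0: "fps_nth dpsi_fps 0 = 1" by (simp add: dpsi_nth)
  \<comment> \<open>J = 1/psi' has degree 0 and is annihilated by \<open>Dtop\<close>, so
    multiplying by it removes psi' without disturbing the equation.\<close>
  obtain J where J: "dpsi_fps * J = 1" using fps_right_inverse[of dpsi_fps 1] d0 by (metis mult_1)
  have Jhom: "fps_hom_deg jet_deg 0 0 J" by (rule fps_hom_deg_inverse[OF jet_deg_dpsi d0 J])
  have Ddpsi: "cmap Dtop dpsi_fps = 0" by (simp add: cmap_dpsi[OF derivation_Dtop] cmap_Dtop_psi)
  have "dpsi_fps * cmap Dtop J = cmap Dtop (dpsi_fps * J)"
    by (simp add: cmap_simps(2)[OF derivation_Dtop] Ddpsi)
  also have "\<dots> = 0" by (simp add: J cmap_simps(4)[OF derivation_Dtop])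
  finally have "J * (dpsi_fps * cmap Dtop J) = 0" by simp
  moreover have "J * (dpsi_fps * cmap Dtop J) = (dpsi_fps * J) * cmap Dtop J" by (simp only: mult_ac)
  ultimately have DJ: "cmap Dtop J = 0" by (simp add: J)
  have "quad_fps ^ 2 * cmap Dtop (J * p) = fps_X ^ 3 * ((dpsi_fps * J) * (quad_fps * sigma_fps) ^ 2 * ?z e)"
    unfolding cmap_simps(2)[OF derivation_Dtop] DJ Dp power_mult_distrib by (simp only: mult_zero_left add_0 mult_ac)
  then have W: "quad_fps ^ 2 * cmap Dtop (J * p) = fps_X ^ 3 * ?z e" by (simp add: J quad_sigma)
  have hom: "hom_deg jet_deg (e - 1) (fps_nth (J * p) k)" for k
  proof -
    have "fps_hom_deg jet_deg 0 (e - 1) p" by (simp add: fps_hom_deg_def p_def hom_deg_gcomp)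
    then have "fps_hom_deg jet_deg 0 (0 + (e - 1)) (J * p)" by (rule fps_hom_deg_mult[OF Jhom])
    then show ?thesis using fps_hom_deg_nth by fastforce
  qed
  show "gcomp jet_deg e (DX Z) = 0" "gcomp jet_deg e (DY Z) = 0"
    using cmap_Dtop_double_pole[OF W hom] e by auto
qed

lemma jet_le_1: "jet_le 1 (DX Z)" "jet_le 1 (DY Z)"
proof -
  obtain n m where nm: "jet_le (int n) (DX Z)" "jet_le (int m) (DY Z)" using jet_le_exists by meson
  have mono: "jet_le i p \<Longrightarrow> i \<le> j \<Longrightarrow> jet_le j p" for i j p by (auto simp: jet_le_def)
  have "jet_le (int N + 1) (DX Z) \<and> jet_le (int N + 1) (DY Z) \<Longrightarrow> jet_le 1 (DX Z) \<and> jet_le 1 (DY Z)" for N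
  proof (induction N)
    case (Suc N)
    have "jet_le (int N + 1) p" if "jet_le (int (Suc N) + 1) p" "gcomp jet_deg (int (Suc N) + 1) p = 0" for p
      unfolding jet_le_def
    proof (intro allI impI)
      fix j assume "j > int N + 1"
      then consider "j = int (Suc N) + 1" | "j > int (Suc N) + 1" by linarith
      then show "gcomp jet_deg j p = 0" using that by cases (auto simp: jet_le_def)
    qed
    then have "jet_le (int N + 1) (DX Z) \<and> jet_le (int N + 1) (DY Z)"
      using jet_le_step[of "int (Suc N) + 1"] Suc.prems by simp
    then show ?case by (rule Suc.IH)
  qed simp
  moreover have "jet_le (int (max n m) + 1) (DX Z) \<and> jet_le (int (max n m) + 1) (DY Z)"
    using mono[OF nm(1)] mono[OF nm(2)] by simp
  ultimately show "jet_le 1 (DX Z)" "jet_le 1 (DY Z)" by blast+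
qed

lemma jet_le_0: "jet_le 0 Z" "jet_le 0 (fps_nth P k)"
  using jet_le_Dx[of 0 Z] jet_le_P[of 1 k] jet_le_1 by simp_all

end

subsection \<open>The characteristic discriminant\<close>

lemma pderiv_c_commute: "pderiv_c q (pderiv_c r p) = pderiv_c r (pderiv_c q p)"
proof -
  have "pderiv_c q (pderiv_c r p) - pderiv_c r (pderiv_c q p) = 0"
    by (rule derivation_ext[OF derivation_commutator[OF derivation_pderiv_c derivation_pderiv_c] derivation_zero])
      (simp add: pderiv_c_var derivation_simps[OF derivation_pderiv_c])
  then show ?thesis by simp
qed

definition discr :: gtpoly where "discr = zx ^ 2 + 4 * zy"

lemma dv_discr: "dv discr = 4"
  by (simp add: discr_def derivation_simps[OF derivation_pderiv_c] derivation_zx_zy)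

lemma discr_nonzero: "discr \<noteq> 0"
  using dv_discr derivation_simps(4)[OF derivation_pderiv_c] by fastforce

fun uv_deg :: "coord \<Rightarrow> int" where
  "uv_deg (Zx a) = (if a = 1 then 1 else 0)" | "uv_deg (Zxy a) = (if a = 0 then 2 else 0)" | "uv_deg q = 0"

text \<open>When z_x has degree 1 and z_y degree 2, the discriminant is homogeneous of degree 2, so
  a multiple of its n-th power has no component of degree below 2n.\<close>

lemma discr_power_dvd_all_imp_0:
  assumes "\<And>n. discr ^ n dvd p"
  shows "p = 0"
proof -
  have zx: "hom_deg uv_deg 1 zx" and zy: "hom_deg uv_deg 2 zy"
    using hom_deg_var[of uv_deg "Zx 1"] hom_deg_var[of uv_deg "Zxy 0"] by (simp_all add: zx_def zy_def)
  have "hom_deg uv_deg 2 discr"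
    using hom_deg_add[OF hom_deg_power[OF zx, of 2, simplified] hom_deg_cst_mult[OF zy, of 4]]
    by (simp add: discr_def cst_numeral)
  then have pow: "hom_deg uv_deg (2 * int n) (discr ^ n)" for n
    using hom_deg_power[of uv_deg 2 discr n] by (simp add: mult.commute)
  have nonneg: "uv_deg q \<ge> 0" for q by (cases q) auto
  have neg: "gcomp uv_deg j q = 0" if "j < 0" for j q
  proof (rule poly_mapping_eqI)
    fix m
    have "mono_deg uv_deg m \<ge> 0" unfolding mono_deg_def by (intro sum_nonneg mult_nonneg_nonneg nonneg) auto
    then show "Poly_Mapping.lookup (gcomp uv_deg j q) m = Poly_Mapping.lookup 0 m"
      using that by (simp add: lookup_gcomp)
  qed
  have "gcomp uv_deg j p = 0" for j
  proof -
    obtain q where "p = discr ^ (nat j + 1) * q" using assms dvdE by blast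
    then show ?thesis
      using gcomp_mult[OF pow, of j "nat j + 1" q] neg by simp
  qed
  then show ?thesis
    by (intro poly_mapping_eqI) (metis lookup_gcomp lookup_zero)
qed

lemma scaled_dvd: "c \<noteq> 0 \<Longrightarrow> cst c * p = d * q \<Longrightarrow> d dvd p" for p d :: gtpoly
proof -
  assume c: "c \<noteq> 0" and "cst c * p = d * q"
  then have "cst (1 / c) * (cst c * p) = d * (cst (1 / c) * q)" by (simp add: algebra_simps)
  moreover have "cst (1 / c) * (cst c * p) = p" using c by (simp flip: mult.assoc cst_mult)
  ultimately show "d dvd p" by (metis dvd_triv_left)
qed

lemma discr_dv_power: "discr * dv (discr ^ n) = 4 * of_nat n * discr ^ n"
  by (induction n) (simp_all add: derivation_simps(1-10)[OF derivation_pderiv_c] dv_discr algebra_simps)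

text \<open>Since \<open>dv discr = 4\<close>, a solution would be a multiple of
  \<open>discr\<close> to the power -1/2. In the induction this shows as the factor 2 + 4n, which
  never vanishes.\<close>

lemma discr_power_dvd_first_order:
  assumes eq: "2 * p + discr * dv p = 0"
  shows "p = 0"
proof (rule discr_power_dvd_all_imp_0)
  note s = derivation_simps[OF derivation_pderiv_c]
  show "discr ^ n dvd p" for n
  proof (induction n)
    case (Suc n)
    then obtain q where q: "p = discr ^ n * q" by blast
    have dvp: "discr * dv p = 4 * of_nat n * discr ^ n * q + discr ^ Suc n * dv q"
    proof -
      have "discr * dv p = (discr * dv (discr ^ n)) * q + discr ^ Suc n * dv q"
        by (simp add: q s(2) algebra_simps)
      then show ?thesis by (simp only: discr_dv_power)
    qed
    have "discr ^ n * (cst (2 + 4 * real n) * q + discr * dv q) = 2 * p + discr * dv p"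
      unfolding dvp by (simp add: q algebra_simps cst_add cst_mult cst_of_nat cst_numeral)
    then have "cst (2 + 4 * real n) * q + discr * dv q = 0"
      using eq discr_nonzero by simp
    then have "cst (2 + 4 * real n) * q = discr * (- dv q)" by (simp add: eq_neg_iff_add_eq_0)
    then have "discr dvd q" by (rule scaled_dvd[rotated]) auto
    then show ?case unfolding q by (simp add: mult_dvd_mono)
  qed simp
qed

text \<open>The derivation along the level sets of the discriminant, normalised to commute with
  \<open>dv\<close>; it can be applied to an equation with coefficients in \<open>discr\<close>
  without changing its form.\<close>

definition th :: "gtpoly \<Rightarrow> gtpoly" where "th p = 2 * du p - zx * dv p"

lemma derivation_th: "derivation th"
  unfolding th_def by (intro derivation_minus derivation_scale derivation_pderiv_c)

lemma th_discr: "th discr = 0"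
  by (simp add: th_def discr_def derivation_simps[OF derivation_pderiv_c] derivation_zx_zy)

lemma th_dv: "th (dv p) = dv (th p)"
  using pderiv_c_commute[of "Zxy 0" "Zx (Suc 0)" p]
  by (simp add: th_def derivation_simps[OF derivation_pderiv_c] derivation_zx_zy)

text \<open>On \<open>discr\<close> to the power s the right-hand operator has leading factor 8 s
  (2s - 1), with roots 0 and 1/2. The assumed divisibility excludes s = 0, and for s = n + 1 the
  factor is nonzero, so divisibility always improves by one.\<close>

lemma th_th_equation_zero:
  assumes eq: "th (th p) = 2 * dv p + discr * dv (dv p)" and div: "discr dvd p"
  shows "p = 0"
proof (rule discr_power_dvd_all_imp_0)
  note s = derivation_simps[OF derivation_pderiv_c]
  have "discr ^ Suc n dvd p" for n
  proof (induction n)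
    case (Suc n)
    then obtain q where q: "p = discr ^ Suc n * q" by blast
    define N where "N = of_nat (Suc n) * (discr ^ n :: gtpoly)"
    have 1: "dv p = 4 * of_nat (Suc n) * discr ^ n * q + discr ^ Suc n * dv q"
      unfolding q s(2) s(11) dv_discr by (simp add: algebra_simps)
    note 2 = discr_dv_power[of n]
    have 3: "discr * dv (dv p) = 4 * of_nat (Suc n) * (4 * of_nat n * discr ^ n * q + discr ^ Suc n * dv q)
       + 4 * of_nat (Suc n) * discr ^ Suc n * dv q + discr ^ Suc (Suc n) * dv (dv q)"
    proof -
      have "dv (dv p) = 4 * of_nat (Suc n) * (dv (discr ^ n) * q + discr ^ n * dv q)
          + (4 * of_nat (Suc n) * discr ^ n * dv q + discr ^ Suc n * dv (dv q))"
        proof -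
        have "dv (discr ^ Suc n) = 4 * of_nat (Suc n) * discr ^ n"
          unfolding s(11) dv_discr by (simp add: algebra_simps)
        then show ?thesis unfolding 1 s(1,2,8,10) by (simp add: algebra_simps)
      qed
      then have "discr * dv (dv p) = 4 * of_nat (Suc n) * ((discr * dv (discr ^ n)) * q + discr ^ Suc n * dv q)
          + (4 * of_nat (Suc n) * discr ^ Suc n * dv q + discr ^ Suc (Suc n) * dv (dv q))"
        by (simp only:) (simp add: algebra_simps)
      then show ?thesis unfolding 2 by (simp add: algebra_simps)
    qed
    have thpow: "th (discr ^ m * r) = discr ^ m * th r" for m r
      by (simp add: derivation_simps[OF derivation_th] th_discr)
    have "discr ^ n * (discr * th (th q)) = th (th p)" unfolding q thpow by simp
    also have "\<dots> = discr ^ n * (cst (8 * (1 + real n) * (1 + 2 * real n)) * q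
        + discr * ((2 + 8 * of_nat (Suc n)) * dv q + discr * dv (dv q)))"
      unfolding eq 3 unfolding 1 by (simp add: algebra_simps cst_add cst_mult cst_of_nat cst_numeral)
    finally have "discr * th (th q) = cst (8 * (1 + real n) * (1 + 2 * real n)) * q
        + discr * ((2 + 8 * of_nat (Suc n)) * dv q + discr * dv (dv q))"
      using discr_nonzero by simp
    then have "cst (8 * (1 + real n) * (1 + 2 * real n)) * q = discr * (th (th q) - ((2 + 8 * of_nat (Suc n)) * dv q + discr * dv (dv q)))"
      by (simp add: algebra_simps)
    then have "discr dvd q" by (rule scaled_dvd[rotated]) (auto simp: add_nonneg_eq_0_iff)
    then show ?case unfolding q by (simp add: mult_dvd_mono mult.assoc)
  qed (use div in simp)
  then show "discr ^ n dvd p" for n by (cases n) auto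
qed

text \<open>\<open>Z\<close> is the generating function of a symmetry, and \<open>Q\<close> its \<open>\<psi>\<^sup>(\<^sup>4\<^sup>)\<close>-component minus \<open>z\<^sub>x Z\<close>.
  Compatibility of the four equations for \<open>Q\<close> shows that the discriminant divides \<open>T = th (dv Z)\<close>,
  and that \<open>T\<close> solves an equation by which divisibility propagates to all powers of the discriminant.\<close>

lemma second_derivatives_vanish:
  assumes Qu: "du Q = zx * du Z + zy * dv Z - Z" and Qv: "dv Q = du Z"
    and QA: "Azero Q = zx * Azero Z + Ezero Z - dv Z" and QE: "Ezero Q = zy * Azero Z + du Z"
  shows "du (du Z) = 0" "dv (du Z) = 0" "dv (dv Z) = 0" "du (dv Z) = 0"
proof -
  note s = derivation_simps[OF derivation_pderiv_c] derivation_zx_zy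
    derivation_simps(1,2,6,7)[OF derivation_Azero] derivation_simps(1,2,6,7)[OF derivation_Ezero]
  \<comment> \<open>M and M' are the commutators of \<open>Azero\<close> with \<open>dv\<close> and
    \<open>du\<close>. The commutators with \<open>Ezero\<close> are expressed through them, so that
    they are the only quantities to eliminate.\<close>
  define M where "M p = dv (Azero p) - Azero (dv p)" for p
  define M' where "M' p = du (Azero p) - Azero (du p)" for p
  have vA: "dv (Azero p) = Azero (dv p) + M p" for p by (simp add: M_def)
  have uA: "du (Azero p) = Azero (du p) + M' p" for p by (simp add: M'_def)
  have uE: "du (Ezero p) = Ezero (du p) + zy * M p" for p
    using commutator_du_Ezero[of p] by (simp add: M_def algebra_simps)
  have vE: "dv (Ezero p) = Ezero (dv p) + M' p - zx * M p" for p
    using commutator_dv_Ezero[of p] by (simp add: M_def M'_def algebra_simps)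
  have uv: "du (dv p) = dv (du p)" for p by (rule pderiv_c_commute)
  \<comment> \<open>Equality of the mixed derivatives of Q.\<close>
  have Zuu: "du (du Z) = zx * dv (du Z) + zy * dv (dv Z)"
    using uv[of Q] unfolding Qu Qv by (simp add: s algebra_simps)
  have c1: "zx * (Azero (dv Z) + M Z) + Ezero (dv Z) + M' Z - zx * M Z - dv (dv Z) - Azero (du Z) = M Q" (is "?L1 = _")
    using vA[of Q] unfolding QA Qv by (simp add: s vA vE algebra_simps)
  have c2: "Azero Z + zx * (Azero (du Z) + M' Z) + Ezero (du Z) + zy * M Z - dv (du Z)
      - (zx * Azero (du Z) + zy * Azero (dv Z) - Azero Z) = M' Q" (is "?L2 = _")
    using uA[of Q] unfolding QA Qu by (simp add: s uA uE uv algebra_simps)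
  have c3: "zy * (Azero (du Z) + M' Z) + du (du Z) - (zx * Ezero (du Z) + zy * Ezero (dv Z) - Ezero Z) = zy * M Q" (is "?L3 = _")
    using uE[of Q] unfolding QE Qu by (simp add: s uA algebra_simps)
  have c4: "Azero Z + zy * (Azero (dv Z) + M Z) + dv (du Z) - Ezero (du Z) = M' Q - zx * M Q" (is "?L4 = _")
    using vE[of Q] unfolding QE Qv by (simp add: s vA algebra_simps)
  define Y where "Y = Ezero (dv Z) - dv (dv Z) + zx * Azero (dv Z) - Azero (du Z)"
  \<comment> \<open>This combination of c1, c2 and c4 eliminates M Q and M' Q, and at the same time
    M Z and M' Z cancel.\<close>
  have v1: "Azero Z + 2 * Ezero (du Z) - 2 * dv (du Z) - 2 * zy * Azero (dv Z) - zx ^ 2 * Azero (dv Z)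
      - zx * Ezero (dv Z) + zx * dv (dv Z) + zx * Azero (du Z) = 0" (is "?V = 0")
  proof -
    have "?V = (?L2 - M' Q) - (?L4 - (M' Q - zx * M Q)) - zx * (?L1 - M Q)"
      by (simp add: algebra_simps power2_eq_square)
    then show ?thesis using c1 c2 c4 by simp
  qed
  \<comment> \<open>Eliminating M Q from c1 and c3 and inserting v1 and Zuu collects the second
    order terms into a multiple of the discriminant.\<close>
  have I: "2 * Ezero Z + zx * Azero Z = discr * Y"
  proof -
    have "2 * Ezero Z + zx * Azero Z - discr * Y = 2 * (?L3 - zy * M Q) - 2 * zy * (?L1 - M Q) + zx * ?V
        - 2 * (du (du Z) - (zx * dv (du Z) + zy * dv (dv Z)))"
      unfolding Y_def discr_def by (simp add: algebra_simps power2_eq_square)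
    moreover have "?L1 - M Q = 0" "?L3 - zy * M Q = 0" "du (du Z) - (zx * dv (du Z) + zy * dv (dv Z)) = 0"
      using c1 c3 Zuu by (simp_all only: diff_self)
    ultimately have "2 * Ezero Z + zx * Azero Z - discr * Y = 0" by (simp only: v1) simp
    then show ?thesis by simp
  qed
  \<comment> \<open>\<open>th\<close> kills the discriminant, so the factor survives differentiation
    of I; comparison with v1 then isolates \<open>th (dv Z)\<close>.\<close>
  have h1: "th (2 * Ezero Z + zx * Azero Z) = discr * th Y"
    unfolding I by (simp add: derivation_simps[OF derivation_th] th_discr)
  have h2: "th (2 * Ezero Z + zx * Azero Z) =
      4 * Ezero (du Z) + 2 * Azero Z + 2 * zx * Azero (du Z) - 2 * zx * Ezero (dv Z) - zx ^ 2 * Azero (dv Z) + discr * M Z" (is "_ = ?F")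
    by (simp add: th_def s uA uE vA vE discr_def algebra_simps power2_eq_square)
  have h3: "th (dv Z) = 2 * dv (du Z) - zx * dv (dv Z)" by (simp add: th_def uv)
  have "2 * th (dv Z) - discr * (th Y - M Z - Azero (dv Z)) = (?F - discr * th Y) - 2 * ?V"
    unfolding h3 discr_def by (simp add: algebra_simps power2_eq_square)
  then have "2 * th (dv Z) = discr * (th Y - M Z - Azero (dv Z))"
    using v1 h1 h2 by simp
  then have div: "discr dvd th (dv Z)"
    using scaled_dvd[of 2 "th (dv Z)" discr "th Y - M Z - Azero (dv Z)"] by (simp only: cst_numeral)
  \<comment> \<open>Zuu differentiated in z_y. Applying \<open>th\<close> once more yields an
    equation of the same form for T = \<open>th (dv Z)\<close>.\<close>
  have W: "th (th (dv Z)) = 2 * dv (dv Z) + discr * dv (dv (dv Z))"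
  proof -
    have "du (du (dv Z)) = dv (du (du Z))" by (simp add: uv)
    also have "\<dots> = zx * dv (dv (du Z)) + dv (dv Z) + zy * dv (dv (dv Z))"
      unfolding Zuu by (simp add: s algebra_simps)
    finally show ?thesis
      by (simp add: th_def s uv discr_def algebra_simps power2_eq_square)
  qed
  have "th (th (th (dv Z))) = 2 * dv (th (dv Z)) + discr * dv (dv (th (dv Z)))"
    unfolding W by (simp add: derivation_simps[OF derivation_th] th_discr th_dv)
  then have T: "th (dv Z) = 0" using div by (rule th_th_equation_zero)
  then have "2 * dv (dv Z) + discr * dv (dv (dv Z)) = 0"
    using W by (simp add: derivation_simps(4)[OF derivation_th])
  then show vv: "dv (dv Z) = 0" by (rule discr_power_dvd_first_order)
  then show "du (dv Z) = 0" using T by (simp add: th_def)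
  then show "dv (du Z) = 0" by (simp add: uv)
  then show "du (du Z) = 0" using Zuu vv by simp
qed

subsection \<open>Fields on the covering and functions of the nonlocal variables\<close>

text \<open>The vector field acting by \<open>\<psi>\<^sup>(\<^sup>j\<^sup>) \<mapsto> f\<^sub>j\<close>, where \<open>\<psi>\<^sup>(\<^sup>1\<^sup>) = y\<close>, \<open>\<psi>\<^sup>(\<^sup>2\<^sup>) = x\<close>, \<open>\<psi>\<^sup>(\<^sup>3\<^sup>) = z - y\<^sup>2/2\<close>.\<close>

definition psi_field :: "gtpoly fps \<Rightarrow> vfield" where
  "psi_field f q = (case q of Yc \<Rightarrow> fps_nth f 1 | Xc \<Rightarrow> fps_nth f 2
     | Zx a \<Rightarrow> (if a = 0 then fps_nth f 3 + var Yc * fps_nth f 1 else 0)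
     | Zxy a \<Rightarrow> 0 | Psi n \<Rightarrow> fps_nth f (n + 4))"

definition psi_vf :: "gtpoly fps \<Rightarrow> gtpoly \<Rightarrow> gtpoly" where
  "psi_vf f = vf_app (psi_field f)"

lemma derivation_psi_vf: "derivation (psi_vf f)"
  by (simp add: psi_vf_def derivation_vf_app)

lemma cmap_psi_vf: "fps_nth f 0 = 0 \<Longrightarrow> cmap (psi_vf f) psi_fps = f"
  by (rule cmap_psi_fpsI) (simp_all add: derivation_psi_vf, simp_all add: psi_vf_def vf_app_var psi_field_def)

lemma psi_vf_jets: "psi_vf f (var (Zx (Suc a))) = 0" "psi_vf f (var (Zxy a)) = 0"
  by (simp_all add: psi_vf_def vf_app_var psi_field_def)

lemma Azero_eq: "Azero p = psi_vf x_fps p"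
  by (rule derivation_ext_psi) (simp_all add: derivation_Azero derivation_psi_vf cmap_psi_vf cmap_Azero_psi x_fps_nth psi_vf_jets,
     simp_all add: Azero_def vf_app_var)

lemma Ezero_eq: "Ezero p = psi_vf y_fps p"
  by (rule derivation_ext_psi) (simp_all add: derivation_Ezero derivation_psi_vf cmap_psi_vf cmap_Ezero_psi y_fps_nth psi_vf_jets,
     simp_all add: Ezero_def vf_app_var)

fun jet :: "coord \<Rightarrow> bool" where
  "jet (Zx a) = (a \<ge> 1)" | "jet (Zxy a) = True" | "jet _ = False"

definition base :: "gtpoly \<Rightarrow> bool" where
  "base p \<longleftrightarrow> (\<forall>q. jet q \<longrightarrow> pderiv_c q p = 0)"

definition base_fps :: "gtpoly fps \<Rightarrow> bool" where
  "base_fps f \<longleftrightarrow> (\<forall>q. jet q \<longrightarrow> cmap (pderiv_c q) f = 0)"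

lemma base_fps_iff: "base_fps f \<longleftrightarrow> (\<forall>n. base (fps_nth f n))"
  by (auto simp: base_fps_def base_def fps_eq_iff)

lemma pderiv_jet_psi: "jet q \<Longrightarrow> cmap (pderiv_c q) psi_fps = 0"
  by (rule cmap_pderiv_psi) auto

lemma base_fps_dpsi: "base_fps dpsi_fps"
  by (simp add: base_fps_def cmap_dpsi[OF derivation_pderiv_c] pderiv_jet_psi)

lemma base_fps_simps:
  "base_fps f \<Longrightarrow> base_fps g \<Longrightarrow> base_fps (f + g)" "base_fps f \<Longrightarrow> base_fps g \<Longrightarrow> base_fps (f * g)"
  "base_fps f \<Longrightarrow> base_fps g \<Longrightarrow> base_fps (f - g)" "base_fps f \<Longrightarrow> base_fps (- f)" "base_fps fps_X" "base_fps 1"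
  "base_fps f \<Longrightarrow> base_fps (fps_deriv f)" "base_fps f \<Longrightarrow> base_fps (f ^ n)"
  by (simp_all add: base_fps_def cmap_simps[OF derivation_pderiv_c])

lemma psi_vf_add: "psi_vf (f + g) p = psi_vf f p + psi_vf g p"
proof -
  have "psi_field (f + g) q = psi_field f q + psi_field g q" for q
    by (auto simp: psi_field_def algebra_simps split: coord.splits)
  then show ?thesis by (simp add: psi_vf_def vf_app_def algebra_simps sum.distrib)
qed

lemma psi_vf_const_mult: "psi_vf (fps_const c * f) p = c * psi_vf f p"
proof -
  have "psi_field (fps_const c * f) q = c * psi_field f q" for q
    by (auto simp: psi_field_def algebra_simps split: coord.splits)
  then show ?thesis by (simp add: psi_vf_def vf_app_def algebra_simps sum_distrib_left)
qed

lemma psi_vf_minus: "psi_vf (- f) p = - psi_vf f p"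
  using psi_vf_const_mult[of "- 1" f p] by (simp flip: fps_const_neg)

lemma psi_vf_sum: "finite I \<Longrightarrow> psi_vf (\<Sum>i\<in>I. f i) p = (\<Sum>i\<in>I. psi_vf (f i) p)"
proof (induction I rule: finite_induct)
  case empty
  show ?case using psi_vf_const_mult[of 0 0 p] by simp
qed (simp add: psi_vf_add)

fun psi_index :: "coord \<Rightarrow> nat" where
  "psi_index Yc = 1" | "psi_index Xc = 2" | "psi_index (Zx a) = 3" | "psi_index (Psi n) = n + 4" | "psi_index (Zxy a) = 0"

lemma psi_field_cong: "(\<And>j. j \<le> psi_index q \<Longrightarrow> fps_nth f j = fps_nth g j) \<Longrightarrow> psi_field f q = psi_field g q"
  by (auto simp: psi_field_def split: coord.splits)

text \<open>A polynomial involves finitely many coordinates, so only an initial segment of the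
  series acts on it. This justifies truncating infinite sums of fields.\<close>

lemma psi_vf_cong:
  assumes "\<And>q. q \<in> vars p \<Longrightarrow> psi_index q \<le> M" "\<And>j. j \<le> M \<Longrightarrow> fps_nth f j = fps_nth g j"
  shows "psi_vf f p = psi_vf g p"
  unfolding psi_vf_def vf_app_def
proof (rule sum.cong)
  fix q assume "q \<in> vars p"
  then have "psi_field f q = psi_field g q" using assms by (intro psi_field_cong) (meson le_trans)
  then show "psi_field f q * pderiv_c q p = psi_field g q * pderiv_c q p" by simp
qed simp

lemma psi_index_bounded: "\<exists>M. \<forall>q\<in>vars p. psi_index q \<le> M"
  using finite_nat_set_iff_bounded_le[of "psi_index ` vars p"] by (auto simp: finite_vars)

lemma subst_gt_id: "(\<And>q. q \<in> vars p \<Longrightarrow> h q = var q) \<Longrightarrow> subst_gt h p = p"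
proof -
  assume h: "\<And>q. q \<in> vars p \<Longrightarrow> h q = var q"
  have "subst_gt h p = subst_gt var p"
    unfolding subst_gt_def
  proof (intro sum.cong arg_cong2[where f = "(*)"] prod.cong refl)
    fix m q assume "m \<in> Poly_Mapping.keys p" "q \<in> Poly_Mapping.keys m"
    then have "q \<in> vars p" unfolding vars_def by blast
    then show "h q ^ Poly_Mapping.lookup m q = var q ^ Poly_Mapping.lookup m q" by (simp add: h)
  qed
  also have "\<dots> = p"
    by (induction p rule: gtpoly_induct) (simp_all add: subst_gt_simps subst_gt_var)
  finally show ?thesis .
qed

lemma base_vars: "base p \<Longrightarrow> q \<in> vars p \<Longrightarrow> \<not> jet q"
  by (auto simp: base_def pderiv_c_eq_0_iff)

lemma base_pderiv: "base p \<Longrightarrow> base (pderiv_c q p)"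
  unfolding base_def by (simp add: pderiv_c_commute[of _ q] derivation_simps(4)[OF derivation_pderiv_c])

lemma subst_psi_vf:
  assumes h: "\<And>q. \<not> jet q \<Longrightarrow> h q = var q" and p: "base p"
  shows "subst_gt h (psi_vf f p) = psi_vf (cmap (subst_gt h) f) p"
proof -
  have id: "base r \<Longrightarrow> subst_gt h r = r" for r
    using base_vars h by (intro subst_gt_id) blast
  have "subst_gt h (psi_field f q) = psi_field (cmap (subst_gt h) f) q" for q
    using h[of Yc] by (auto simp: psi_field_def subst_gt_simps subst_gt_var split: coord.splits)
  then show ?thesis
    unfolding psi_vf_def vf_app_def subst_gt_sum subst_gt_simps(2) using base_pderiv[OF p] id by simp
qed

definition Lop :: "nat \<Rightarrow> gtpoly \<Rightarrow> gtpoly" where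
  "Lop m = psi_vf (- (fps_X ^ (m - 1) * dpsi_fps))"

lemma derivation_Lop: "derivation (Lop m)"
  by (simp add: Lop_def derivation_psi_vf)

lemma cmap_Lop_psi: "m \<ge> 2 \<Longrightarrow> cmap (Lop m) psi_fps = - (fps_X ^ (m - 1) * dpsi_fps)"
  unfolding Lop_def by (rule cmap_psi_vf) (simp add: fps_X_power_mult_nth)

text \<open>\<open>Lop m\<close> is the infinitesimal reparametrisation of mu by mu^(1-m), up to
  sign, so the Witt relations are expected; they need checking on \<open>psi_fps\<close>
  only.\<close>

lemma Lop_commutator:
  assumes "a \<ge> 2" "b \<ge> 2"
  shows "Lop a (Lop b p) - Lop b (Lop a p) = (of_nat a - of_nat b) * Lop (a + b) p"
proof -
  obtain i where a: "a = Suc (Suc i)" using assms(1) by (metis add_2_eq_Suc le_Suc_ex)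
  obtain j where b: "b = Suc (Suc j)" using assms(2) by (metis add_2_eq_Suc le_Suc_ex)
  have dX: "fps_deriv (fps_X ^ Suc n * dpsi_fps) = of_nat (Suc n) * (fps_X ^ n * dpsi_fps) + fps_X ^ Suc n * fps_deriv dpsi_fps" for n
    by (simp add: fps_deriv_power fps_of_nat[symmetric] algebra_simps del: power_Suc fps_const_add)
  have L: "cmap (Lop (Suc (Suc n))) psi_fps = - (fps_X ^ Suc n * dpsi_fps)" for n
    by (simp add: cmap_Lop_psi)
  have Lps: "cmap (Lop (Suc (Suc n))) dpsi_fps = fps_X ^ 2 * (of_nat (Suc n) * (fps_X ^ n * dpsi_fps) + fps_X ^ Suc n * fps_deriv dpsi_fps)" for n
    unfolding cmap_dpsi[OF derivation_Lop] L dX[symmetric] by (simp only: fps_deriv_neg mult_minus_right minus_minus)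
  \<comment> \<open>The last term is symmetric in m and n, so it drops out of the
    commutator.\<close>
  have LL: "cmap (Lop (Suc (Suc m))) (cmap (Lop (Suc (Suc n))) psi_fps)
     = - (of_nat (Suc m) * (fps_X ^ (m + n + 3) * dpsi_fps)) - fps_X ^ (m + n + 4) * fps_deriv dpsi_fps" for m n
    unfolding L cmap_simps(5)[OF derivation_Lop] cmap_simps(2)[OF derivation_Lop] Lps cmap_simps(11)[OF derivation_Lop] cmap_simps(7)[OF derivation_Lop]
    by (simp add: algebra_simps power_add eval_nat_numeral)
  show ?thesis
  proof (rule derivation_ext_psi[where D = "\<lambda>p. Lop a (Lop b p) - Lop b (Lop a p)" and D' = "\<lambda>p. (of_nat a - of_nat b) * Lop (a + b) p"])
    have ab: "a + b = Suc (Suc (i + j + 2))" by (simp add: a b)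
    have c: "fps_const (of_nat a - of_nat b :: gtpoly) = of_nat (Suc i) - of_nat (Suc j)"
    proof -
      have "(of_nat a - of_nat b :: gtpoly) = of_nat (Suc i) - of_nat (Suc j)" by (simp add: a b)
      then show ?thesis by (simp only: fps_of_nat fps_const_sub[symmetric])
    qed
    show "cmap (\<lambda>p. Lop a (Lop b p) - Lop b (Lop a p)) psi_fps = cmap (\<lambda>p. (of_nat a - of_nat b) * Lop (a + b) p) psi_fps"
      unfolding cmap_commutator cmap_scale c
      unfolding ab L unfolding a b LL
      by (simp add: algebra_simps power_add eval_nat_numeral)
  qed (auto intro!: derivation_commutator derivation_scale derivation_Lop simp: derivation_psi_vf Lop_def psi_vf_jets derivation_simps(4)[OF derivation_psi_vf])
qed

section \<open>Degree bounds in t and polynomial identities in a real parameter\<close>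

definition fps_deg_le :: "nat \<Rightarrow> gtpoly fps \<Rightarrow> bool" where
  "fps_deg_le d f \<longleftrightarrow> (\<forall>n>d. fps_nth f n = 0)"

lemma fps_deg_le_add: "fps_deg_le d f \<Longrightarrow> fps_deg_le d g \<Longrightarrow> fps_deg_le d (f + g)"
  by (simp add: fps_deg_le_def)
lemma fps_deg_le_diff: "fps_deg_le d f \<Longrightarrow> fps_deg_le d g \<Longrightarrow> fps_deg_le d (f - g)"
  by (simp add: fps_deg_le_def)
lemma fps_deg_le_mult:
  assumes "fps_deg_le d f" "fps_deg_le d' g" "d + d' \<le> e"
  shows "fps_deg_le e (f * g)"
  unfolding fps_deg_le_def fps_mult_nth
proof (intro allI impI sum.neutral ballI)
  fix n i assume "e < n" "i \<in> {0..n}"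
  then have "i > d \<or> n - i > d'" using assms(3) by auto
  then show "fps_nth f i * fps_nth g (n - i) = 0" using assms by (auto simp: fps_deg_le_def)
qed
lemma fps_deg_le_const: "fps_deg_le d (fps_const c)" by (simp add: fps_deg_le_def)
lemma fps_deg_le_1: "fps_deg_le d 1" using fps_deg_le_const[of d 1] by simp
lemma fps_deg_le_X_power: "k \<le> d \<Longrightarrow> fps_deg_le d (fps_X ^ k)"
  by (simp add: fps_deg_le_def fps_X_power_nth)
lemma fps_deg_le_X: "1 \<le> d \<Longrightarrow> fps_deg_le d fps_X" using fps_deg_le_X_power[of 1 d] by simp
lemma fps_deg_le_quad: "fps_deg_le 2 quad_fps"
  unfolding quad_fps_def
  by (intro fps_deg_le_diff fps_deg_le_1 fps_deg_le_mult[where d = 0 and d' = 2] fps_deg_le_const fps_deg_le_X_power fps_deg_le_X) simp_all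
lemma fps_deg_le_cmap: "fps_deg_le d f \<Longrightarrow> T 0 = 0 \<Longrightarrow> fps_deg_le d (cmap T f)"
  by (simp add: fps_deg_le_def)

lemma real_poly_coeffs_0:
  fixes e :: "nat \<Rightarrow> gtpoly"
  assumes "\<And>q::real. (\<Sum>m\<le>K. cst (q ^ m) * e m) = 0" "m \<le> K"
  shows "e m = 0"
proof (rule poly_mapping_eqI)
  fix k
  have "Poly_Mapping.lookup (cst c * p) k = c * Poly_Mapping.lookup p k" for c p
    by (induction p rule: gtpoly_induct_single) (simp_all add: cst_def mult_single lookup_add algebra_simps lookup_single when_def)
  then have "(\<Sum>m\<le>K. Poly_Mapping.lookup (e m) k * q ^ m) = 0" for q
    using arg_cong[OF assms(1)[of q], of "\<lambda>p. Poly_Mapping.lookup p k"] by (simp add: lookup_sum mult.commute)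
  then have "\<forall>m\<le>K. Poly_Mapping.lookup (e m) k = 0"
    using polyfun_eq_0[of "\<lambda>m. Poly_Mapping.lookup (e m) k" K] by blast
  then show "Poly_Mapping.lookup (e m) k = Poly_Mapping.lookup 0 k" using assms(2) by simp
qed

subsection \<open>Reduction to functions of the nonlocal variables\<close>

fun second_jet :: "coord \<Rightarrow> bool" where
  "second_jet (Zx a) = (a \<ge> 2)" | "second_jet (Zxy a) = (a \<ge> 1)" | "second_jet _ = False"

lemma second_jet_imp_jet: "second_jet q \<Longrightarrow> jet q" by (cases q) auto

definition first_order :: "gtpoly \<Rightarrow> bool" where
  "first_order p \<longleftrightarrow> (\<forall>q. second_jet q \<longrightarrow> pderiv_c q p = 0)"

definition first_order_fps :: "gtpoly fps \<Rightarrow> bool" where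
  "first_order_fps f \<longleftrightarrow> (\<forall>q. second_jet q \<longrightarrow> cmap (pderiv_c q) f = 0)"

lemma jet_cases: "jet q \<Longrightarrow> q = Zx (Suc 0) \<or> q = Zxy 0 \<or> second_jet q"
  by (cases q) auto

lemma derivation_eq_on_vars:
  assumes "derivation D" "derivation D'" "\<And>q. q \<in> vars p \<Longrightarrow> D (var q) = D' (var q)"
  shows "D p = D' p"
  using assms derivation_eq_sum[of D p] derivation_eq_sum[of D' p] by simp

lemma first_order_vars: "first_order p \<Longrightarrow> q \<in> vars p \<Longrightarrow> \<not> second_jet q"
  by (auto simp: first_order_def pderiv_c_eq_0_iff)

lemma Dx_first_order:
  assumes "first_order p"
  shows "vf_app Dx p = var (Zx 2) * du p + var (Zxy 1) * dv p + Azero p"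
proof (rule derivation_eq_on_vars[where D' = "\<lambda>p. var (Zx 2) * du p + var (Zxy 1) * dv p + Azero p"])
  fix q assume "q \<in> vars p"
  then have "\<not> second_jet q" using first_order_vars[OF assms] by blast
  then consider "q = Xc" | "q = Yc" | "q = Zx 0" | "q = Zx (Suc 0)" | "q = Zxy 0" | n where "q = Psi n"
    by (cases q) (auto simp: not_le less_Suc_eq numeral_2_eq_2)
  then show "vf_app Dx (var q) = var (Zx 2) * du (var q) + var (Zxy 1) * dv (var q) + Azero (var q)"
    by cases (simp_all add: vf_app_var Dx_def Azero_def pderiv_c_var zx_def numeral_2_eq_2)
qed (intro derivation_plus derivation_scale derivation_pderiv_c derivation_Azero derivation_vf_app)+

text \<open>The coefficient of \<open>dv p\<close> is z_yy as given by the equation; its constant -1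
  is the source of the terms with \<open>dv Z\<close> in \<open>P_equations\<close>.\<close>

lemma Dy_first_order:
  assumes "first_order p"
  shows "vf_app Dy p = var (Zxy 1) * du p + (zy * var (Zx 2) - zx * var (Zxy 1) - 1) * dv p + Ezero p"
proof (rule derivation_eq_on_vars[where D' = "\<lambda>p. var (Zxy 1) * du p + (zy * var (Zx 2) - zx * var (Zxy 1) - 1) * dv p + Ezero p"])
  fix q assume "q \<in> vars p"
  then have "\<not> second_jet q" using first_order_vars[OF assms] by blast
  then consider "q = Xc" | "q = Yc" | "q = Zx 0" | "q = Zx (Suc 0)" | "q = Zxy 0" | n where "q = Psi n"
    by (cases q) (auto simp: not_le less_Suc_eq numeral_2_eq_2)
  then show "vf_app Dy (var q) = var (Zxy 1) * du (var q) + (zy * var (Zx 2) - zx * var (Zxy 1) - 1) * dv (var q) + Ezero (var q)"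
    by cases (simp_all add: vf_app_var Dy_def Ezero_def pderiv_c_var zy_def zyy_def)
qed (intro derivation_plus derivation_scale derivation_pderiv_c derivation_Ezero derivation_vf_app)+

lemma first_order_coeffs_zero:
  assumes "first_order_fps f" "first_order_fps g" "first_order_fps h"
    and eq: "fps_const (var (Zx 2)) * f + fps_const (var (Zxy 1)) * g + h = 0"
  shows "f = 0" "g = 0" "h = 0"
proof -
  note s = cmap_simps[OF derivation_pderiv_c]
  have "cmap (pderiv_c (Zx 2)) (fps_const (var (Zx 2)) * f + fps_const (var (Zxy 1)) * g + h) = f"
    using assms(1-3) by (simp add: s pderiv_c_var first_order_fps_def)
  then show f: "f = 0" unfolding eq by (simp add: s)
  have "cmap (pderiv_c (Zxy 1)) (fps_const (var (Zx 2)) * f + fps_const (var (Zxy 1)) * g + h) = g"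
    using assms(1-3) by (simp add: s pderiv_c_var first_order_fps_def)
  then show g: "g = 0" unfolding eq by (simp add: s)
  show "h = 0" using eq f g by simp
qed

lemma pderiv_second_jet_Azero: "second_jet q \<Longrightarrow> pderiv_c q (Azero p) = Azero (pderiv_c q p)"
  and pderiv_second_jet_Ezero: "second_jet q \<Longrightarrow> pderiv_c q (Ezero p) = Ezero (pderiv_c q p)"
proof -
  assume q: "second_jet q"
  then have u: "pderiv_c q zx = 0" "pderiv_c q zy = 0" by (auto simp: zx_def zy_def pderiv_c_var)
  have psi: "cmap (pderiv_c q) psi_fps = 0" by (rule pderiv_jet_psi[OF second_jet_imp_jet[OF q]])
  have xy: "cmap (pderiv_c q) x_fps = 0" "cmap (pderiv_c q) y_fps = 0"
    unfolding x_fps_def y_fps_def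
    by (simp_all add: cmap_simps[OF derivation_pderiv_c] cmap_sigma[OF derivation_pderiv_c] cmap_dpsi[OF derivation_pderiv_c] u psi)
  have "pderiv_c q (psi_vf f p) - psi_vf f (pderiv_c q p) = 0" if "cmap (pderiv_c q) f = 0" "fps_nth f 0 = 0" for f
  proof (rule derivation_ext_psi[where D = "\<lambda>p. pderiv_c q (psi_vf f p) - psi_vf f (pderiv_c q p)" and D' = "\<lambda>p. 0"])
    show "cmap (\<lambda>p. pderiv_c q (psi_vf f p) - psi_vf f (pderiv_c q p)) psi_fps = cmap (\<lambda>p. 0) psi_fps"
      unfolding cmap_commutator cmap_psi_vf[OF that(2)] that(1) psi
      by (simp add: fps_eq_iff derivation_simps(4)[OF derivation_psi_vf])
  qed (auto intro!: derivation_commutator derivation_pderiv_c derivation_psi_vf derivation_zero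
      simp: psi_vf_jets pderiv_c_var derivation_simps[OF derivation_psi_vf] derivation_simps(4)[OF derivation_pderiv_c])
  from this[OF xy(1)] this[OF xy(2)]
  show "pderiv_c q (Azero p) = Azero (pderiv_c q p)" "pderiv_c q (Ezero p) = Ezero (pderiv_c q p)"
    by (simp_all add: Azero_eq Ezero_eq x_fps_nth y_fps_nth)
qed

section \<open>Closed forms and the Wronskian of \<open>x_fps\<close> and
  \<open>y_fps\<close>\<close>

lemma sigma_deriv: "fps_deriv sigma_fps = sigma_fps ^ 2 * (fps_const zx + 2 * fps_const zy * fps_X)"
proof -
  have "0 = fps_deriv (quad_fps * sigma_fps)" by (simp add: quad_sigma)
  then have "quad_fps * fps_deriv sigma_fps = - fps_deriv quad_fps * sigma_fps"
    by (simp add: eq_neg_iff_add_eq_0 algebra_simps)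
  moreover have "fps_deriv quad_fps = - (fps_const zx + 2 * fps_const zy * fps_X)"
    by (simp add: quad_fps_def fps_deriv_power algebra_simps numeral_fps_const)
  ultimately have 1: "quad_fps * fps_deriv sigma_fps = (fps_const zx + 2 * fps_const zy * fps_X) * sigma_fps" by (simp only: minus_minus)
  have "fps_deriv sigma_fps = (quad_fps * sigma_fps) * fps_deriv sigma_fps" by (simp add: quad_sigma)
  also have "\<dots> = sigma_fps * (quad_fps * fps_deriv sigma_fps)" by (simp only: mult_ac)
  finally show ?thesis unfolding 1 by (simp only: power2_eq_square mult_ac)
qed

definition beta_fps :: "gtpoly fps" where
  "beta_fps = fps_X + fps_const zy * fps_X ^ 3 * sigma_fps"

lemma y_fps_beta: "y_fps = dpsi_fps * beta_fps" by (simp add: y_fps_def beta_fps_def)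

lemma quad_beta: "quad_fps * beta_fps = fps_X - fps_const zx * fps_X ^ 2"
proof -
  have "quad_fps * beta_fps = quad_fps * fps_X + fps_const zy * fps_X ^ 3 * (quad_fps * sigma_fps)"
    by (simp add: beta_fps_def algebra_simps)
  also have "\<dots> = fps_X - fps_const zx * fps_X ^ 2"
    unfolding quad_sigma by (simp add: quad_fps_def algebra_simps eval_nat_numeral)
  finally show ?thesis .
qed

text \<open>This identity is the commutation of \<open>D\<^sub>x\<close> and \<open>D\<^sub>y\<close> on functions of the nonlocal variables.\<close>

lemma x_y_fps_wronskian: "fps_X ^ 4 * sigma_fps * fps_deriv y_fps - fps_X ^ 2 * fps_deriv x_fps * beta_fps
    = - (fps_X ^ 4 * dpsi_fps * sigma_fps ^ 2)"
proof -
  have r: "sigma_fps + fps_X * fps_deriv sigma_fps - (sigma_fps ^ 2 + fps_const zy * fps_X ^ 2 * sigma_fps ^ 2) = 0"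
  proof -
    have "sigma_fps = sigma_fps * (quad_fps * sigma_fps)" by (simp add: quad_sigma)
    then have "sigma_fps = sigma_fps ^ 2 * (1 - fps_const zx * fps_X - fps_const zy * fps_X ^ 2)"
      by (simp add: quad_fps_def power2_eq_square mult_ac)
    then have "sigma_fps + fps_X * fps_deriv sigma_fps = sigma_fps ^ 2 * (1 - fps_const zx * fps_X - fps_const zy * fps_X ^ 2)
       + fps_X * (sigma_fps ^ 2 * (fps_const zx + 2 * fps_const zy * fps_X))"
      unfolding sigma_deriv by simp
    then show ?thesis by (simp add: algebra_simps power2_eq_square)
  qed
  have X: "fps_deriv (fps_X ^ 2) = (2 * fps_X :: gtpoly fps)" "fps_deriv (fps_X ^ 3) = (3 * fps_X ^ 2 :: gtpoly fps)"
    by (simp_all add: fps_deriv_power numeral_fps_const)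
  have "fps_X ^ 4 * sigma_fps * fps_deriv y_fps - fps_X ^ 2 * fps_deriv x_fps * beta_fps + fps_X ^ 4 * dpsi_fps * sigma_fps ^ 2
     = - (dpsi_fps * fps_X ^ 4) * (sigma_fps + fps_X * fps_deriv sigma_fps - (sigma_fps ^ 2 + fps_const zy * fps_X ^ 2 * sigma_fps ^ 2))"
    unfolding y_fps_beta x_fps_def beta_fps_def fps_deriv_mult fps_deriv_add X
    by (simp add: algebra_simps eval_nat_numeral)
  then show ?thesis unfolding r by (simp only: mult_zero_right eq_neg_iff_add_eq_0)
qed

lemma dpsi_nonzero: "dpsi_fps \<noteq> 0"
  using dpsi_nth[of 0] by auto

context gt_symmetry
begin

lemma first_order_Z: "first_order Z"
  and first_order_P: "first_order_fps P"
proof -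
  have "pderiv_c q p = 0" if "second_jet q" "jet_le 0 p" for p q
  proof (cases q)
    case (Zx a)
    then show ?thesis using jet_le_0_pderiv(1)[OF that(2), of "a - 2"] that(1) by (simp add: numeral_2_eq_2 Suc_diff_Suc)
  next
    case (Zxy a)
    then show ?thesis using jet_le_0_pderiv(2)[OF that(2), of "a - 1"] that(1) by simp
  qed (use that in auto)
  then show "first_order Z" "first_order_fps P"
    using jet_le_0 by (simp_all add: first_order_def first_order_fps_def fps_eq_iff)
qed

lemma first_order_fps_nth: "first_order_fps f \<Longrightarrow> first_order (fps_nth f n)"
  by (simp add: first_order_def first_order_fps_def fps_eq_iff)

abbreviation "u1 \<equiv> var (Zx 2)"
abbreviation "v1 \<equiv> var (Zxy 1)"

lemma cmap_DX_first_order: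
  "cmap DX P = fps_const u1 * cmap du P + fps_const v1 * cmap dv P + cmap Azero P"
  using Dx_first_order[OF first_order_fps_nth[OF first_order_P]] by (simp add: fps_eq_iff)

lemma cmap_DY_first_order:
  "cmap DY P = fps_const v1 * cmap du P + fps_const (zy * u1 - zx * v1 - 1) * cmap dv P + cmap Ezero P"
  using Dy_first_order[OF first_order_fps_nth[OF first_order_P]] by (simp add: fps_eq_iff)

lemma first_order_simps:
  assumes "second_jet q"
  shows "cmap (pderiv_c q) (cmap du P) = 0" "cmap (pderiv_c q) (cmap dv P) = 0" "cmap (pderiv_c q) P = 0"
    "cmap (pderiv_c q) (cmap Azero P) = 0" "cmap (pderiv_c q) (cmap Ezero P) = 0"
    "cmap (pderiv_c q) sigma_fps = 0" "cmap (pderiv_c q) dpsi_fps = 0"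
    "pderiv_c q (du Z) = 0" "pderiv_c q (dv Z) = 0" "pderiv_c q (Azero Z) = 0" "pderiv_c q (Ezero Z) = 0"
    "pderiv_c q zx = 0" "pderiv_c q zy = 0"
proof -
  show P: "cmap (pderiv_c q) P = 0" using first_order_P assms by (simp add: first_order_fps_def)
  then have P': "pderiv_c q (fps_nth P n) = 0" for n by (simp add: fps_eq_iff)
  have Z: "pderiv_c q Z = 0" using first_order_Z assms by (simp add: first_order_def)
  note z = derivation_simps(4)[OF derivation_pderiv_c] derivation_simps(4)[OF derivation_Azero] derivation_simps(4)[OF derivation_Ezero]
  show "cmap (pderiv_c q) (cmap du P) = 0" "cmap (pderiv_c q) (cmap dv P) = 0"
    "pderiv_c q (du Z) = 0" "pderiv_c q (dv Z) = 0"
    by (simp_all add: fps_eq_iff pderiv_c_commute[of q] P' Z z)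
  show "cmap (pderiv_c q) (cmap Azero P) = 0" "cmap (pderiv_c q) (cmap Ezero P) = 0"
    "pderiv_c q (Azero Z) = 0" "pderiv_c q (Ezero Z) = 0"
    using assms by (simp_all add: fps_eq_iff pderiv_second_jet_Azero pderiv_second_jet_Ezero P' Z z)
  show u: "pderiv_c q zx = 0" "pderiv_c q zy = 0" using assms by (auto simp: zx_def zy_def pderiv_c_var)
  show "cmap (pderiv_c q) sigma_fps = 0" by (simp add: cmap_sigma[OF derivation_pderiv_c] u)
  show "cmap (pderiv_c q) dpsi_fps = 0"
    by (simp add: cmap_dpsi[OF derivation_pderiv_c] pderiv_jet_psi[OF second_jet_imp_jet[OF assms]])
qed

text \<open>For Z and P of first order, the equations for D_x P and D_y P are affine in z_xx and
  z_xy with coefficients free of second jets. The first three claims are the coefficients of D_x P,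
  the last is the free term of D_y P.\<close>

lemma P_equations:
  shows du_P: "cmap du P = fps_X ^ 3 * dpsi_fps * sigma_fps ^ 2 * (fps_const (du Z) + fps_const (zy * dv Z) * fps_X)"
    and dv_P: "cmap dv P = fps_X ^ 3 * dpsi_fps * sigma_fps ^ 2 * (fps_const (dv Z) + fps_const (du Z - zx * dv Z) * fps_X)"
    and Azero_P: "cmap Azero P = - (fps_X ^ 4 * sigma_fps * fps_deriv P)
      + fps_X ^ 3 * dpsi_fps * sigma_fps ^ 2 * (fps_const (Azero Z) + fps_const (Ezero Z - dv Z) * fps_X)"
    and Ezero_P: "cmap Ezero P = cmap dv P - fps_X ^ 2 * fps_deriv P * beta_fps
      + fps_X ^ 3 * dpsi_fps * (fps_const (Ezero Z - dv Z) * sigma_fps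
        + fps_const zy * fps_X * sigma_fps ^ 2 * (fps_const (Azero Z) + fps_const (Ezero Z - dv Z) * fps_X))"
proof -
  note s = cmap_simps[OF derivation_pderiv_c]
  define w where "w = fps_X ^ 3 * dpsi_fps * sigma_fps ^ 2"
  let ?a = "cmap du P - w * (fps_const (du Z) + fps_const (zy * dv Z) * fps_X)"
  let ?b = "cmap dv P - w * (fps_const (dv Z) + fps_const (du Z - zx * dv Z) * fps_X)"
  let ?c = "cmap Azero P + fps_X ^ 4 * sigma_fps * fps_deriv P - w * (fps_const (Azero Z) + fps_const (Ezero Z - dv Z) * fps_X)"
  have DXZ: "DX Z = u1 * du Z + v1 * dv Z + Azero Z" by (rule Dx_first_order[OF first_order_Z])
  have DYZ: "DY Z = v1 * du Z + (zy * u1 - zx * v1 - 1) * dv Z + Ezero Z" by (rule Dy_first_order[OF first_order_Z])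
  have w0: "cmap (pderiv_c q) w = 0" if "second_jet q" for q
    using that by (simp add: w_def s first_order_simps)
  have f: "first_order_fps ?a" "first_order_fps ?b" "first_order_fps ?c"
    by (auto simp: first_order_fps_def s first_order_simps w0 derivation_simps[OF derivation_pderiv_c])
  have "fps_const u1 * ?a + fps_const v1 * ?b + ?c = 
     cmap DX P - (- (fps_X ^ 4 * (sigma_fps * fps_deriv P)) +
    fps_X ^ 3 * (dpsi_fps * sigma_fps ^ 2 * (fps_const (DX Z) + fps_const (DY Z) * fps_X)))"
    unfolding cmap_DX_first_order DXZ DYZ w_def
    by (simp add: algebra_simps flip: fps_const_mult fps_const_add fps_const_sub)
  then have 0: "fps_const u1 * ?a + fps_const v1 * ?b + ?c = 0"
    using cmap_DX_P by simp
  note abc = first_order_coeffs_zero[OF f 0]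
  show 1: "cmap du P = fps_X ^ 3 * dpsi_fps * sigma_fps ^ 2 * (fps_const (du Z) + fps_const (zy * dv Z) * fps_X)"
    using abc(1) by (simp add: w_def)
  show 2: "cmap dv P = fps_X ^ 3 * dpsi_fps * sigma_fps ^ 2 * (fps_const (dv Z) + fps_const (du Z - zx * dv Z) * fps_X)"
    using abc(2) by (simp add: w_def)
  show "cmap Azero P = - (fps_X ^ 4 * sigma_fps * fps_deriv P)
      + fps_X ^ 3 * dpsi_fps * sigma_fps ^ 2 * (fps_const (Azero Z) + fps_const (Ezero Z - dv Z) * fps_X)"
    using abc(3) by (simp add: w_def add_eq_0_iff algebra_simps)
  let ?d = "cmap Ezero P - cmap dv P + fps_X ^ 2 * fps_deriv P * beta_fps
      - fps_X ^ 3 * dpsi_fps * (fps_const (Ezero Z - dv Z) * sigma_fps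
        + fps_const zy * fps_X * sigma_fps ^ 2 * (fps_const (Azero Z) + fps_const (Ezero Z - dv Z) * fps_X))"
  let ?e = "fps_const zy * cmap dv P - fps_X ^ 3 * dpsi_fps * (fps_const (zy * dv Z) * sigma_fps
        + fps_const zy * fps_X * sigma_fps ^ 2 * (fps_const (du Z) + fps_const (zy * dv Z) * fps_X))"
  let ?f = "cmap du P - fps_const zx * cmap dv P - fps_X ^ 3 * dpsi_fps * (fps_const (du Z - zx * dv Z) * sigma_fps
        + fps_const zy * fps_X * sigma_fps ^ 2 * (fps_const (dv Z) + fps_const (du Z - zx * dv Z) * fps_X))"
  have f': "first_order_fps ?e" "first_order_fps ?f" "first_order_fps ?d"
    by (auto simp: first_order_fps_def s first_order_simps derivation_simps[OF derivation_pderiv_c] beta_fps_def)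
  have "fps_const u1 * ?e + fps_const v1 * ?f + ?d = 
     cmap DY P - (- (fps_X ^ 2 * fps_deriv P * (fps_X + fps_const zy * fps_X ^ 3 * sigma_fps)) +
    dpsi_fps * fps_X ^ 3 * (fps_const (DY Z) * sigma_fps
      + fps_const zy * fps_X * sigma_fps ^ 2 * (fps_const (DX Z) + fps_const (DY Z) * fps_X)))"
    unfolding cmap_DY_first_order DXZ DYZ beta_fps_def
    by (simp add: algebra_simps flip: fps_const_mult fps_const_add fps_const_sub)
  then have "fps_const u1 * ?e + fps_const v1 * ?f + ?d = 0"
    using cmap_DY_P by simp
  from first_order_coeffs_zero(3)[OF f' this]
  have d0: "?d = 0" .
  have "cmap Ezero P = ?d + (cmap dv P - fps_X ^ 2 * fps_deriv P * beta_fps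
      + fps_X ^ 3 * dpsi_fps * (fps_const (Ezero Z - dv Z) * sigma_fps
        + fps_const zy * fps_X * sigma_fps ^ 2 * (fps_const (Azero Z) + fps_const (Ezero Z - dv Z) * fps_X)))" by (simp only: algebra_simps)
  then show "cmap Ezero P = cmap dv P - fps_X ^ 2 * fps_deriv P * beta_fps
      + fps_X ^ 3 * dpsi_fps * (fps_const (Ezero Z - dv Z) * sigma_fps
        + fps_const zy * fps_X * sigma_fps ^ 2 * (fps_const (Azero Z) + fps_const (Ezero Z - dv Z) * fps_X))"
    unfolding d0 by simp
qed

text \<open>The coefficient of t^4 is the first one after Z itself. Read there,
  \<open>P_equations\<close> become the four equations for Q required by
  \<open>second_derivatives_vanish\<close>.\<close>

lemma Z_affine: "du (du Z) = 0" "dv (du Z) = 0" "dv (dv Z) = 0" "du (dv Z) = 0"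
proof -
  define Q where "Q = fps_nth P 4 - zx * Z"
  have P12: "fps_nth P (Suc 0) = 0" "fps_nth P 2 = 0" using P_nth_012 by simp_all
  have n4: "fps_nth (fps_X ^ 3 * dpsi_fps * sigma_fps ^ 2 * (fps_const a + fps_const b * fps_X)) 4 = 2 * zx * a + b" for a b
    unfolding mult.assoc fps_X_power_mult_nth
    by (simp add: fps_mult_nth_1 dpsi_nth sigma_fps_def sigma_0 sigma_1 power2_eq_square)
  have Pu: "du (fps_nth P 4) = 2 * zx * du Z + zy * dv Z"
    using arg_cong[OF du_P, of "\<lambda>f. fps_nth f 4"] unfolding n4 by simp
  have Pv: "dv (fps_nth P 4) = zx * dv Z + du Z"
    using arg_cong[OF dv_P, of "\<lambda>f. fps_nth f 4"] unfolding n4 by (simp add: algebra_simps)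
  have PA: "Azero (fps_nth P 4) = 2 * zx * Azero Z + Ezero Z - dv Z"
    using arg_cong[OF Azero_P, of "\<lambda>f. fps_nth f 4"] unfolding fps_add_nth n4
    by (simp add: fps_X_power_mult_nth mult.assoc P12)
  have e: "fps_X ^ 2 * fps_deriv P * beta_fps = fps_X ^ 3 * (fps_deriv P * (1 + fps_const zy * fps_X ^ 2 * sigma_fps))"
    by (simp add: beta_fps_def algebra_simps power_numeral_reduce)
  have e4: "fps_nth (fps_X ^ 2 * fps_deriv P * beta_fps) 4 = 0"
    unfolding e fps_X_power_mult_nth using P12 by (simp add: fps_X_power_mult_nth fps_mult_nth_1 numeral_2_eq_2)
  have PE: "Ezero (fps_nth P 4) = zx * dv Z + du Z + zx * (Ezero Z - dv Z) + zy * Azero Z"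
  proof -
    have "fps_nth (fps_X ^ 3 * dpsi_fps * (fps_const e * sigma_fps
        + fps_const zy * fps_X * sigma_fps ^ 2 * (fps_const a + fps_const e * fps_X))) 4 = zx * e + zy * a" for e a
      unfolding mult.assoc fps_X_power_mult_nth
      by (simp add: fps_mult_nth_1 dpsi_nth sigma_fps_def sigma_0 sigma_1 power2_eq_square)
    then show ?thesis
      using arg_cong[OF Ezero_P, of "\<lambda>f. fps_nth f 4"] Pv e4 by (simp add: add.assoc)
  qed
  note s = derivation_simps(2,7)[OF derivation_pderiv_c] derivation_simps(2,7)[OF derivation_Azero] derivation_simps(2,7)[OF derivation_Ezero] derivation_zx_zy
  show "du (du Z) = 0" "dv (du Z) = 0" "dv (dv Z) = 0" "du (dv Z) = 0"
    by (rule second_derivatives_vanish[of Q]; simp add: Q_def s Pu Pv PA PE algebra_simps)+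
qed

end

text \<open>A ring identity, stated with atoms in place of series: w stands for psi', f for F, c'
  and c for \<open>du Z\<close> and \<open>dv Z\<close>. Substituting P = c' x + c y - w f, the
  terms with c' cancel by themselves and those with c by the Wronskian.\<close>

lemma reduced_equation_x:
  fixes X :: "'a::comm_ring_1"
  assumes P: "AP = a' * x + c' * Ax + a * y + c * Ay - Aw * f - w * Af"
    and P': "dP = c' * dx + c * dy - dw * f - w * df"
    and defs: "x = X ^ 2 * w * s" "y = w * b" "dx = 2 * X * w * s + X ^ 2 * dw * s + X ^ 2 * w * ds"
      "Aw = - (X ^ 2 * dx)" "Ax = X ^ 2 * Aw * s" "Ay = Aw * b"
    and eq: "AP = - (X ^ 4 * s * dP) + X ^ 3 * w * s ^ 2 * (z + (e - c) * X)"
    and wr: "X ^ 4 * s * dy - X ^ 2 * dx * b = - (X ^ 4 * w * s ^ 2)"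
  shows "w * (- Af + f * (2 * X ^ 3 * s + X ^ 4 * ds) - X ^ 4 * s * df + a' * X ^ 2 * s + a * b
     - X ^ 3 * s ^ 2 * (z + e * X)) = 0"
proof -
  have "w * (- Af + f * (2 * X ^ 3 * s + X ^ 4 * ds) - X ^ 4 * s * df + a' * X ^ 2 * s + a * b - X ^ 3 * s ^ 2 * (z + e * X))
    = (AP - (- (X ^ 4 * s * dP) + X ^ 3 * w * s ^ 2 * (z + (e - c) * X)))
      - c * ((X ^ 4 * s * dy - X ^ 2 * dx * b) - (- (X ^ 4 * w * s ^ 2)))"
    unfolding P P' defs by (simp add: algebra_simps power_numeral_reduce)
  then show ?thesis unfolding eq wr by simp
qed

text \<open>The companion for D_y; here it is the terms with c' that need the Wronskian.\<close>

lemma reduced_equation_y: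
  fixes X :: "'a::comm_ring_1"
  assumes P: "EP = b' * x + c' * Exx + b * y + c * Ey - Ew * f - w * Ef"
    and P': "dP = c' * dx + c * dy - dw * f - w * df"
    and defs: "x = X ^ 2 * w * s" "y = w * t" "dy = w * dt + dw * t"
      "Ew = - (X ^ 2 * dy)" "Exx = X ^ 2 * Ew * s" "Ey = Ew * t"
    and eq: "EP = c' * (X ^ 4 * w * s ^ 2) + c * (w * (X ^ 3 * s + v * X ^ 5 * s ^ 2)) - X ^ 2 * dP * t
      + X ^ 3 * w * ((e - c) * s + v * X * s ^ 2 * (z + (e - c) * X))"
    and wr: "X ^ 4 * s * dy - X ^ 2 * dx * t = - (X ^ 4 * w * s ^ 2)"
  shows "w * (- Ef + f * X ^ 2 * dt - X ^ 2 * t * df + b' * X ^ 2 * s + b * t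
     - X ^ 3 * (e * s + v * X * s ^ 2 * (z + e * X))) = 0"
proof -
  have "w * (- Ef + f * X ^ 2 * dt - X ^ 2 * t * df + b' * X ^ 2 * s + b * t
     - X ^ 3 * (e * s + v * X * s ^ 2 * (z + e * X)))
    = (EP - (c' * (X ^ 4 * w * s ^ 2) + c * (w * (X ^ 3 * s + v * X ^ 5 * s ^ 2)) - X ^ 2 * dP * t
      + X ^ 3 * w * ((e - c) * s + v * X * s ^ 2 * (z + (e - c) * X))))
      + c' * ((X ^ 4 * s * dy - X ^ 2 * dx * t) - (- (X ^ 4 * w * s ^ 2)))"
    unfolding P P' defs by (simp add: algebra_simps power_numeral_reduce)
  then show ?thesis unfolding eq wr by simp
qed

lemma x_fps_deriv: "fps_deriv x_fps = 2 * fps_X * dpsi_fps * sigma_fps + fps_X ^ 2 * fps_deriv dpsi_fps * sigma_fps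
   + fps_X ^ 2 * dpsi_fps * fps_deriv sigma_fps"
proof -
  have X: "fps_deriv (fps_X ^ 2) = (2 * fps_X :: gtpoly fps)" by (simp add: fps_deriv_power numeral_fps_const)
  show ?thesis unfolding x_fps_def fps_deriv_mult X by (simp add: algebra_simps)
qed

lemma y_fps_deriv: "fps_deriv y_fps = dpsi_fps * fps_deriv beta_fps + fps_deriv dpsi_fps * beta_fps"
  by (simp add: y_fps_beta)

lemma cmap_Azero_sigma_beta: "cmap Azero sigma_fps = 0" "cmap Azero beta_fps = 0"
  and cmap_Ezero_sigma_beta: "cmap Ezero sigma_fps = 0" "cmap Ezero beta_fps = 0"
  by (simp_all add: beta_fps_def cmap_sigma[OF derivation_Azero] cmap_sigma[OF derivation_Ezero]
      cmap_simps[OF derivation_Azero] cmap_simps[OF derivation_Ezero] derivation_zx_zy)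

lemma cmap_Azero_dpsi: "cmap Azero dpsi_fps = - (fps_X ^ 2 * fps_deriv x_fps)"
  by (simp add: cmap_dpsi[OF derivation_Azero] cmap_Azero_psi)
lemma cmap_Ezero_dpsi: "cmap Ezero dpsi_fps = - (fps_X ^ 2 * fps_deriv y_fps)"
  by (simp add: cmap_dpsi[OF derivation_Ezero] cmap_Ezero_psi)

lemma cmap_Azero_x_y: "cmap Azero x_fps = fps_X ^ 2 * cmap Azero dpsi_fps * sigma_fps" "cmap Azero y_fps = cmap Azero dpsi_fps * beta_fps"
  by (simp_all add: x_fps_def y_fps_beta cmap_simps[OF derivation_Azero] cmap_Azero_sigma_beta)
lemma cmap_Ezero_x_y: "cmap Ezero x_fps = fps_X ^ 2 * cmap Ezero dpsi_fps * sigma_fps" "cmap Ezero y_fps = cmap Ezero dpsi_fps * beta_fps"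
  by (simp_all add: x_fps_def y_fps_beta cmap_simps[OF derivation_Ezero] cmap_Ezero_sigma_beta)

lemma quad_sigma_powers:
  "quad_fps ^ 2 * sigma_fps = quad_fps" "quad_fps ^ 2 * sigma_fps ^ 2 = 1"
  "quad_fps ^ 2 * fps_deriv sigma_fps = fps_const zx + 2 * fps_const zy * fps_X"
  "quad_fps ^ 2 * beta_fps = quad_fps * (fps_X - fps_const zx * fps_X ^ 2)"
proof -
  show "quad_fps ^ 2 * sigma_fps = quad_fps"
    using quad_sigma by (simp add: power2_eq_square mult.assoc)
  show 2: "quad_fps ^ 2 * sigma_fps ^ 2 = 1" by (simp add: quad_sigma flip: power_mult_distrib)
  have "quad_fps ^ 2 * fps_deriv sigma_fps = (quad_fps ^ 2 * sigma_fps ^ 2) * (fps_const zx + 2 * fps_const zy * fps_X)"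
    unfolding sigma_deriv by (simp only: mult_ac)
  then show "quad_fps ^ 2 * fps_deriv sigma_fps = fps_const zx + 2 * fps_const zy * fps_X" by (simp add: 2)
  show "quad_fps ^ 2 * beta_fps = quad_fps * (fps_X - fps_const zx * fps_X ^ 2)"
    by (simp add: power2_eq_square mult.assoc quad_beta)
qed

lemma quad_beta_deriv: "quad_fps ^ 2 * fps_deriv beta_fps = (1 - 2 * fps_const zx * fps_X) * quad_fps
   + (fps_X - fps_const zx * fps_X ^ 2) * (fps_const zx + 2 * fps_const zy * fps_X)"
proof -
  have X: "fps_deriv (fps_X ^ 2) = (2 * fps_X :: gtpoly fps)" by (simp add: fps_deriv_power numeral_fps_const)
  have q: "fps_deriv quad_fps = - (fps_const zx + 2 * fps_const zy * fps_X)"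
    by (simp add: quad_fps_def fps_deriv_power algebra_simps numeral_fps_const)
  have "fps_deriv (quad_fps * beta_fps) = 1 - 2 * fps_const zx * fps_X"
    unfolding quad_beta by (simp add: X algebra_simps)
  moreover have "fps_deriv (quad_fps * beta_fps) = quad_fps * fps_deriv beta_fps - (fps_const zx + 2 * fps_const zy * fps_X) * beta_fps"
    unfolding fps_deriv_mult q by (simp only: mult_minus_left diff_conv_add_uminus)
  ultimately have "quad_fps * fps_deriv beta_fps = 1 - 2 * fps_const zx * fps_X + (fps_const zx + 2 * fps_const zy * fps_X) * beta_fps"
    by (simp only: diff_eq_eq)
  then have "quad_fps * (quad_fps * fps_deriv beta_fps) = (1 - 2 * fps_const zx * fps_X) * quad_fps
      + (quad_fps * beta_fps) * (fps_const zx + 2 * fps_const zy * fps_X)"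
    by (simp only:) (simp add: algebra_simps)
  then show ?thesis unfolding quad_beta by (simp only: power2_eq_square mult.assoc)
qed

lemma fps_deg_le_const_mult: "fps_deg_le d f \<Longrightarrow> fps_deg_le d (fps_const c * f)"
  by (simp add: fps_deg_le_def)

lemma fps_deg_le_4:
  "fps_deg_le 4 (fps_const a * fps_X ^ 2 * quad_fps)"
  "fps_deg_le 4 (fps_const a * (quad_fps * (fps_X - fps_const b * fps_X ^ 2)))"
  "fps_deg_le 4 (fps_X ^ 3 * (fps_const a + fps_const b * fps_X))"
  "fps_deg_le 4 (fps_X ^ 3 * (fps_const a * (1 - fps_const b * fps_X) + fps_const c * fps_const d * fps_X))"
proof -
  show "fps_deg_le 4 (fps_const a * fps_X ^ 2 * quad_fps)"
    by (rule fps_deg_le_mult[OF fps_deg_le_const_mult[OF fps_deg_le_X_power[of 2 2]] fps_deg_le_quad]) simp_all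
  have "fps_deg_le 2 (fps_X - fps_const b * fps_X ^ 2)"
    by (intro fps_deg_le_diff fps_deg_le_const_mult fps_deg_le_X_power fps_deg_le_X) simp_all
  then show "fps_deg_le 4 (fps_const a * (quad_fps * (fps_X - fps_const b * fps_X ^ 2)))"
    by (intro fps_deg_le_const_mult fps_deg_le_mult[OF fps_deg_le_quad, of 2]) simp_all
  have "fps_deg_le 1 (fps_const a + fps_const b * fps_X)"
    by (intro fps_deg_le_add fps_deg_le_const_mult fps_deg_le_const fps_deg_le_X) simp_all
  from fps_deg_le_mult[OF fps_deg_le_X_power[of 3 3] this, of 4]
  show "fps_deg_le 4 (fps_X ^ 3 * (fps_const a + fps_const b * fps_X))" by simp
  have "fps_deg_le 1 (fps_const a * (1 - fps_const b * fps_X) + fps_const (c * d) * fps_X)"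
    by (intro fps_deg_le_add fps_deg_le_diff fps_deg_le_const_mult fps_deg_le_1 fps_deg_le_X) simp_all
  then have "fps_deg_le 1 (fps_const a * (1 - fps_const b * fps_X) + fps_const c * fps_const d * fps_X)" by simp
  from fps_deg_le_mult[OF fps_deg_le_X_power[of 3 3] this, of 4]
  show "fps_deg_le 4 (fps_X ^ 3 * (fps_const a * (1 - fps_const b * fps_X) + fps_const c * fps_const d * fps_X))" by simp
qed

section \<open>The reduced field \<open>F\<close> and its equations\<close>

context gt_symmetry
begin

text \<open>Chosen so that S - Z_u D_x - Z_v D_y, with u = z_x and v = z_y, acts on psi by - F
  psi'.\<close>

definition F :: "gtpoly fps" where
  "F = (fps_const (du Z) * x_fps + fps_const (dv Z) * y_fps - P) * fps_right_inverse dpsi_fps 1"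

lemma P_eq: "P = fps_const (du Z) * x_fps + fps_const (dv Z) * y_fps - dpsi_fps * F"
proof -
  have "dpsi_fps * fps_right_inverse dpsi_fps 1 = 1"
    by (rule fps_right_inverse) (simp add: dpsi_nth)
  moreover have "dpsi_fps * F = (fps_const (du Z) * x_fps + fps_const (dv Z) * y_fps - P) * (dpsi_fps * fps_right_inverse dpsi_fps 1)"
    unfolding F_def by (simp only: mult_ac)
  ultimately have "dpsi_fps * F = fps_const (du Z) * x_fps + fps_const (dv Z) * y_fps - P" by (simp only: mult_1_right)
  then show ?thesis by (simp only: diff_diff_eq2 add_diff_cancel_left')
qed

lemma base_Z: "base (du Z)" "base (dv Z)"
  using Z_affine first_order_simps(8,9) by (auto simp: base_def dest!: jet_cases)

text \<open>As Z is affine, \<open>du Z\<close> and \<open>dv Z\<close> are free of jets, and the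
  derivatives of P in z_x and z_y are exactly those of Z_u \<open>x_fps\<close> + Z_v
  \<open>y_fps\<close>.\<close>

lemma base_F: "base_fps F"
  unfolding base_fps_def
proof (intro allI impI)
  fix q assume q: "jet q"
  note s = cmap_simps[OF derivation_pderiv_c]
  have psi: "cmap (pderiv_c q) dpsi_fps = 0" using base_fps_dpsi q by (simp add: base_fps_def)
  have Z0: "pderiv_c q (du Z) = 0" "pderiv_c q (dv Z) = 0" using base_Z q by (auto simp: base_def)
  have "cmap (pderiv_c q) (dpsi_fps * F) = cmap (pderiv_c q) (fps_const (du Z) * x_fps + fps_const (dv Z) * y_fps - P)"
    by (subst P_eq) simp
  also have "\<dots> = fps_const (du Z) * cmap (pderiv_c q) x_fps + fps_const (dv Z) * cmap (pderiv_c q) y_fps - cmap (pderiv_c q) P"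
    by (simp add: s Z0)
  also have "\<dots> = 0"
    using jet_cases[OF q]
  proof (elim disjE)
    assume [simp]: "q = Zx (Suc 0)"
    show ?thesis by (simp add: du_P pderiv_uv_x_y_fps algebra_simps power_numeral_reduce flip: fps_const_mult)
  next
    assume [simp]: "q = Zxy 0"
    show ?thesis by (simp add: dv_P y_fps_v_eq pderiv_uv_x_y_fps(1,2) algebra_simps power_numeral_reduce flip: fps_const_mult fps_const_sub)
  next
    assume q: "second_jet q"
    show ?thesis
      using first_order_simps[OF q] by (simp add: x_fps_def y_fps_def s)
  qed
  finally have "dpsi_fps * cmap (pderiv_c q) F = 0" by (simp add: s psi)
  then show "cmap (pderiv_c q) F = 0" using dpsi_nonzero by simp
qed

lemma P_deriv: "fps_deriv P = fps_const (du Z) * fps_deriv x_fps + fps_const (dv Z) * fps_deriv y_fps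
    - fps_deriv dpsi_fps * F - dpsi_fps * fps_deriv F"
  by (subst P_eq) (simp add: algebra_simps)

lemma A_equation: "- cmap Azero F + F * (2 * fps_X ^ 3 * sigma_fps + fps_X ^ 4 * fps_deriv sigma_fps) - fps_X ^ 4 * sigma_fps * fps_deriv F
   + fps_const (Azero (du Z)) * fps_X ^ 2 * sigma_fps + fps_const (Azero (dv Z)) * beta_fps
   - fps_X ^ 3 * sigma_fps ^ 2 * (fps_const (Azero Z) + fps_const (Ezero Z) * fps_X) = 0"
proof -
  have AP: "cmap Azero P = fps_const (Azero (du Z)) * x_fps + fps_const (du Z) * cmap Azero x_fps
     + fps_const (Azero (dv Z)) * y_fps + fps_const (dv Z) * cmap Azero y_fps - cmap Azero dpsi_fps * F - dpsi_fps * cmap Azero F"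
    by (subst P_eq) (simp add: cmap_simps[OF derivation_Azero] algebra_simps)
  have eq: "cmap Azero P = - (fps_X ^ 4 * sigma_fps * fps_deriv P)
      + fps_X ^ 3 * dpsi_fps * sigma_fps ^ 2 * (fps_const (Azero Z) + (fps_const (Ezero Z) - fps_const (dv Z)) * fps_X)"
    using Azero_P by (simp only: fps_const_sub)
  show ?thesis
    using reduced_equation_x[OF AP P_deriv x_fps_def y_fps_beta x_fps_deriv cmap_Azero_dpsi cmap_Azero_x_y eq x_y_fps_wronskian] dpsi_nonzero
    by simp
qed

lemma E_equation: "- cmap Ezero F + F * fps_X ^ 2 * fps_deriv beta_fps - fps_X ^ 2 * beta_fps * fps_deriv F
   + fps_const (Ezero (du Z)) * fps_X ^ 2 * sigma_fps + fps_const (Ezero (dv Z)) * beta_fps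
   - fps_X ^ 3 * (fps_const (Ezero Z) * sigma_fps + fps_const zy * fps_X * sigma_fps ^ 2 * (fps_const (Azero Z) + fps_const (Ezero Z) * fps_X)) = 0"
proof -
  have EP: "cmap Ezero P = fps_const (Ezero (du Z)) * x_fps + fps_const (du Z) * cmap Ezero x_fps
     + fps_const (Ezero (dv Z)) * y_fps + fps_const (dv Z) * cmap Ezero y_fps - cmap Ezero dpsi_fps * F - dpsi_fps * cmap Ezero F"
    by (subst P_eq) (simp add: cmap_simps[OF derivation_Ezero] algebra_simps)
  have "cmap dv P = fps_const (du Z) * cmap dv x_fps + fps_const (dv Z) * cmap dv y_fps"
    unfolding dv_P y_fps_v_eq pderiv_uv_x_y_fps(1,2)
    by (simp add: algebra_simps power_numeral_reduce flip: fps_const_mult fps_const_sub)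
  then have eq: "cmap Ezero P = fps_const (du Z) * (fps_X ^ 4 * dpsi_fps * sigma_fps ^ 2)
     + fps_const (dv Z) * (dpsi_fps * (fps_X ^ 3 * sigma_fps + fps_const zy * fps_X ^ 5 * sigma_fps ^ 2)) - fps_X ^ 2 * fps_deriv P * beta_fps
      + fps_X ^ 3 * dpsi_fps * ((fps_const (Ezero Z) - fps_const (dv Z)) * sigma_fps
        + fps_const zy * fps_X * sigma_fps ^ 2 * (fps_const (Azero Z) + (fps_const (Ezero Z) - fps_const (dv Z)) * fps_X))"
    using Ezero_P by (simp only: fps_const_sub pderiv_uv_x_y_fps)
  show ?thesis
    using reduced_equation_y[OF EP P_deriv x_fps_def y_fps_beta y_fps_deriv cmap_Ezero_dpsi cmap_Ezero_x_y eq x_y_fps_wronskian] dpsi_nonzero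
    by simp
qed

text \<open>Multiplication by the square of the characteristic polynomial clears all denominators.
  The terms coming from Z become a polynomial in t of degree at most 4, of which only this bound is
  retained; the same is done for D_y below.\<close>

lemma A_equation_quad: "\<exists>p. fps_deg_le 4 p \<and>
  - (quad_fps ^ 2 * cmap Azero F) + F * (2 * fps_X ^ 3 * quad_fps + fps_X ^ 4 * (fps_const zx + 2 * fps_const zy * fps_X))
   - fps_X ^ 4 * quad_fps * fps_deriv F + p = 0"
proof -
  let ?a = "fps_const (Azero (du Z))" and ?b = "fps_const (Azero (dv Z))" and ?z = "fps_const (Azero Z)" and ?e = "fps_const (Ezero Z)"
  define p where "p = ?a * fps_X ^ 2 * quad_fps + ?b * (quad_fps * (fps_X - fps_const zx * fps_X ^ 2)) - fps_X ^ 3 * (?z + ?e * fps_X)"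
  have "fps_deg_le 4 p"
    unfolding p_def
    by (intro fps_deg_le_diff fps_deg_le_add fps_deg_le_4)
  moreover have "- (quad_fps ^ 2 * cmap Azero F) + F * (2 * fps_X ^ 3 * quad_fps + fps_X ^ 4 * (fps_const zx + 2 * fps_const zy * fps_X))
     - fps_X ^ 4 * quad_fps * fps_deriv F + p
    = - (quad_fps ^ 2 * cmap Azero F) + F * (2 * fps_X ^ 3 * (quad_fps ^ 2 * sigma_fps) + fps_X ^ 4 * (quad_fps ^ 2 * fps_deriv sigma_fps))
     - fps_X ^ 4 * (quad_fps ^ 2 * sigma_fps) * fps_deriv F + (?a * fps_X ^ 2 * (quad_fps ^ 2 * sigma_fps) + ?b * (quad_fps ^ 2 * beta_fps)
     - fps_X ^ 3 * (quad_fps ^ 2 * sigma_fps ^ 2) * (?z + ?e * fps_X))"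
    unfolding p_def quad_sigma_powers by simp
  moreover have "\<dots> = quad_fps ^ 2 * (- cmap Azero F + F * (2 * fps_X ^ 3 * sigma_fps + fps_X ^ 4 * fps_deriv sigma_fps) - fps_X ^ 4 * sigma_fps * fps_deriv F
   + ?a * fps_X ^ 2 * sigma_fps + ?b * beta_fps - fps_X ^ 3 * sigma_fps ^ 2 * (?z + ?e * fps_X))"
    by (simp add: algebra_simps)
  moreover have "\<dots> = 0" unfolding A_equation by simp
  ultimately show ?thesis by metis
qed

lemma E_equation_quad: "\<exists>p. fps_deg_le 4 p \<and>
  - (quad_fps ^ 2 * cmap Ezero F) + F * fps_X ^ 2 * ((1 - 2 * fps_const zx * fps_X) * quad_fps
   + (fps_X - fps_const zx * fps_X ^ 2) * (fps_const zx + 2 * fps_const zy * fps_X))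
   - fps_X ^ 2 * (quad_fps * (fps_X - fps_const zx * fps_X ^ 2)) * fps_deriv F + p = 0"
proof -
  let ?a = "fps_const (Ezero (du Z))" and ?b = "fps_const (Ezero (dv Z))" and ?z = "fps_const (Azero Z)" and ?e = "fps_const (Ezero Z)"
  define p where "p = ?a * fps_X ^ 2 * quad_fps + ?b * (quad_fps * (fps_X - fps_const zx * fps_X ^ 2))
    - fps_X ^ 3 * (?e * (1 - fps_const zx * fps_X) + fps_const zy * ?z * fps_X)"
  have pe: "?e * quad_fps + fps_const zy * fps_X * (?z + ?e * fps_X) = ?e * (1 - fps_const zx * fps_X) + fps_const zy * ?z * fps_X"
    by (simp add: quad_fps_def algebra_simps power2_eq_square)
  have "fps_deg_le 4 p"
    unfolding p_def
    by (intro fps_deg_le_diff fps_deg_le_add fps_deg_le_4)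
  moreover have "- (quad_fps ^ 2 * cmap Ezero F) + F * fps_X ^ 2 * ((1 - 2 * fps_const zx * fps_X) * quad_fps
   + (fps_X - fps_const zx * fps_X ^ 2) * (fps_const zx + 2 * fps_const zy * fps_X))
   - fps_X ^ 2 * (quad_fps * (fps_X - fps_const zx * fps_X ^ 2)) * fps_deriv F + p
    = - (quad_fps ^ 2 * cmap Ezero F) + F * fps_X ^ 2 * (quad_fps ^ 2 * fps_deriv beta_fps) - fps_X ^ 2 * (quad_fps ^ 2 * beta_fps) * fps_deriv F
    + (?a * fps_X ^ 2 * (quad_fps ^ 2 * sigma_fps) + ?b * (quad_fps ^ 2 * beta_fps)
     - fps_X ^ 3 * (?e * (quad_fps ^ 2 * sigma_fps) + fps_const zy * fps_X * (quad_fps ^ 2 * sigma_fps ^ 2) * (?z + ?e * fps_X)))"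
    unfolding p_def quad_sigma_powers quad_beta_deriv pe[symmetric] by simp
  moreover have "\<dots> = quad_fps ^ 2 * (- cmap Ezero F + F * fps_X ^ 2 * fps_deriv beta_fps - fps_X ^ 2 * beta_fps * fps_deriv F
   + ?a * fps_X ^ 2 * sigma_fps + ?b * beta_fps
   - fps_X ^ 3 * (?e * sigma_fps + fps_const zy * fps_X * sigma_fps ^ 2 * (?z + ?e * fps_X)))"
    by (simp add: algebra_simps)
  moreover have "\<dots> = 0" unfolding E_equation by simp
  ultimately show ?thesis by metis
qed

end

subsection \<open>Evaluation at the characteristic roots\<close>

text \<open>For real \<open>q\<^sub>1\<close>, \<open>q\<^sub>2\<close> we substitute \<open>z\<^sub>x = q\<^sub>1 + q\<^sub>2\<close> and \<open>z\<^sub>y = - q\<^sub>1 q\<^sub>2\<close>, so that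
  \<open>D\<^sub>y + q\<^sub>1 D\<^sub>x\<close> no longer depends on \<open>q\<^sub>2\<close> on functions of the nonlocal variables.\<close>

definition root_subst :: "real \<Rightarrow> real \<Rightarrow> coord \<Rightarrow> gtpoly" where
  "root_subst q1 q2 q = (if q = Zx (Suc 0) then cst (q1 + q2) else if q = Zxy 0 then cst (- (q1 * q2)) else var q)"

abbreviation root_eval :: "real \<Rightarrow> real \<Rightarrow> gtpoly fps \<Rightarrow> gtpoly fps" where
  "root_eval q1 q2 \<equiv> cmap (subst_gt (root_subst q1 q2))"

abbreviation kst :: "real \<Rightarrow> gtpoly fps" where "kst q \<equiv> fps_const (cst q)"

lemma root_subst_zx_zy:
  "subst_gt (root_subst q1 q2) zx = cst (q1 + q2)" "subst_gt (root_subst q1 q2) zy = cst (- (q1 * q2))"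
  by (simp_all add: zx_def zy_def subst_gt_var root_subst_def)

lemma root_subst_jet: "\<not> jet q \<Longrightarrow> root_subst q1 q2 q = var q"
  by (cases q) (auto simp: root_subst_def)

lemma root_eval_base: "base_fps f \<Longrightarrow> root_eval q1 q2 f = f"
proof (rule fps_ext)
  fix n assume "base_fps f"
  then have "base (fps_nth f n)" by (simp add: base_fps_iff)
  then have "subst_gt (root_subst q1 q2) (fps_nth f n) = fps_nth f n"
    using base_vars root_subst_jet by (intro subst_gt_id) blast
  then show "fps_nth (root_eval q1 q2 f) n = fps_nth f n" by simp
qed

lemma root_eval_consts:
  "root_eval q1 q2 (fps_const zx) = kst q1 + kst q2" "root_eval q1 q2 (fps_const zy) = - (kst q1 * kst q2)"
  by (simp_all add: cmap_subst_gt root_subst_zx_zy cst_add cst_minus cst_mult)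

lemma root_eval_quad: "root_eval q1 q2 quad_fps = (1 - kst q1 * fps_X) * (1 - kst q2 * fps_X)"
  unfolding quad_fps_def cmap_subst_gt(2,4,6,7,10) root_eval_consts
  by (simp add: algebra_simps power2_eq_square flip: fps_const_add fps_const_mult fps_const_neg)

text \<open>The expansion of t / (1 - q t).\<close>

definition geom_fps :: "real \<Rightarrow> gtpoly fps" where
  "geom_fps q = Abs_fps (\<lambda>n. if n = 0 then 0 else cst (q ^ (n - 1)))"

lemma geom_fps_mult: "(1 - kst q * fps_X) * geom_fps q = fps_X"
proof (rule fps_ext)
  fix n
  have e: "(1 - kst q * fps_X) * geom_fps q = geom_fps q - fps_X * (kst q * geom_fps q)" by (simp add: algebra_simps)
  show "fps_nth ((1 - kst q * fps_X) * geom_fps q) n = fps_nth fps_X n"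
  proof (cases "n \<le> 1")
    case True
    then show ?thesis unfolding e by (cases n) (auto simp: geom_fps_def)
  next
    case False
    then obtain m where "n = Suc (Suc m)" by (metis One_nat_def Suc_diff_1 not_le zero_less_diff not_less_eq_eq le0 not0_implies_Suc)
    then show ?thesis unfolding e by (simp add: geom_fps_def cst_mult)
  qed
qed

lemma one_minus_kst_X_nonzero: "1 - kst q * fps_X \<noteq> 0"
proof
  assume "1 - kst q * fps_X = 0"
  then have "fps_nth (1 - kst q * fps_X) 0 = 0" by simp
  then show False by simp
qed

text \<open>The numerators combine to t - (q1 + q2) t^2 + q1 t^2 = t (1 - q2 t), which cancels the
  factor of the second root.\<close>

lemma root_eval_y_x: "root_eval q1 q2 y_fps + kst q1 * root_eval q1 q2 x_fps = dpsi_fps * geom_fps q1"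
proof -
  let ?e = "root_eval q1 q2" and ?a = "1 - kst q1 * fps_X" and ?b = "1 - kst q2 * fps_X"
  have x: "quad_fps * x_fps = fps_X ^ 2 * dpsi_fps"
  proof -
    have "quad_fps * x_fps = fps_X ^ 2 * dpsi_fps * (quad_fps * sigma_fps)" unfolding x_fps_def by (simp only: mult_ac)
    then show ?thesis by (simp add: quad_sigma)
  qed
  have y: "quad_fps * y_fps = dpsi_fps * (fps_X - fps_const zx * fps_X ^ 2)"
    unfolding y_fps_beta quad_beta[symmetric] by (simp only: mult_ac)
  have "?a * ?b * ?e x_fps = ?e (quad_fps * x_fps)" by (simp only: cmap_subst_gt(2) root_eval_quad)
  also have "\<dots> = fps_X ^ 2 * dpsi_fps"
    unfolding x by (simp only: cmap_subst_gt(2,7,10) root_eval_base[OF base_fps_dpsi])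
  finally have ex: "?a * ?b * ?e x_fps = fps_X ^ 2 * dpsi_fps" .
  have "?a * ?b * ?e y_fps = ?e (quad_fps * y_fps)" by (simp only: cmap_subst_gt(2) root_eval_quad)
  also have "\<dots> = dpsi_fps * (fps_X - (kst q1 + kst q2) * fps_X ^ 2)"
    unfolding y by (simp only: cmap_subst_gt(2,6,7,10) root_eval_base[OF base_fps_dpsi] root_eval_consts)
  finally have ey: "?a * ?b * ?e y_fps = dpsi_fps * (fps_X - (kst q1 + kst q2) * fps_X ^ 2)" .
  have "?a * ?b * (?e y_fps + kst q1 * ?e x_fps) = ?a * ?b * ?e y_fps + kst q1 * (?a * ?b * ?e x_fps)"
    by (simp only: distrib_left mult_ac)
  also have "\<dots> = dpsi_fps * ?b * fps_X" unfolding ex ey by (simp add: algebra_simps power2_eq_square flip: fps_const_add)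
  also have "\<dots> = dpsi_fps * ?b * (?a * geom_fps q1)" by (simp only: geom_fps_mult)
  also have "\<dots> = ?a * ?b * (dpsi_fps * geom_fps q1)" by (simp only: mult_ac)
  finally show ?thesis using one_minus_kst_X_nonzero by simp
qed

definition Nop :: "real \<Rightarrow> gtpoly \<Rightarrow> gtpoly" where
  "Nop q = psi_vf (dpsi_fps * geom_fps q)"

lemma root_eval_Ezero_Azero:
  assumes "base_fps f"
  shows "root_eval q1 q2 (cmap Ezero f) + kst q1 * root_eval q1 q2 (cmap Azero f) = cmap (Nop q1) f"
proof (rule fps_ext)
  fix n
  have b: "base (fps_nth f n)" using assms by (simp add: base_fps_iff)
  show "fps_nth (root_eval q1 q2 (cmap Ezero f) + kst q1 * root_eval q1 q2 (cmap Azero f)) n = fps_nth (cmap (Nop q1) f) n"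
    by (simp add: Ezero_eq Azero_eq subst_psi_vf[OF root_subst_jet b] Nop_def psi_vf_add psi_vf_const_mult flip: root_eval_y_x[of q1 q2])
qed

text \<open>The geometric series: t / (1 - q t) is the sum of q^m t^(m+1), and t^(m+1) psi' belongs
  to - \<open>Lop (m + 2)\<close>. Terms with m at least M do not act on p.\<close>

lemma Nop_expand:
  assumes "\<And>q. q \<in> vars p \<Longrightarrow> psi_index q \<le> M"
  shows "Nop q p = - (\<Sum>m<M. cst (q ^ m) * Lop (m + 2) p)"
proof -
  have "Nop q p = psi_vf (\<Sum>m<M. kst (q ^ m) * (fps_X ^ (m + 1) * dpsi_fps)) p"
    unfolding Nop_def
  proof (rule psi_vf_cong)
    fix j assume j: "j \<le> M"
    have g: "fps_nth (geom_fps q) i = fps_nth (\<Sum>m<M. kst (q ^ m) * fps_X ^ (m + 1)) i" if "i \<le> M" for i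
    proof (cases i)
      case (Suc k)
      have "fps_nth (\<Sum>m<M. kst (q ^ m) * fps_X ^ (m + 1)) i = (\<Sum>m<M. if m = k then cst (q ^ m) else 0)"
        unfolding fps_sum_nth by (intro sum.cong) (auto simp: Suc fps_X_power_nth simp del: power_Suc)
      then show ?thesis using Suc that by (simp add: geom_fps_def)
    qed (simp add: geom_fps_def fps_sum_nth fps_X_power_nth del: power_Suc)
    have "fps_nth (dpsi_fps * geom_fps q) j = fps_nth (dpsi_fps * (\<Sum>m<M. kst (q ^ m) * fps_X ^ (m + 1))) j"
      unfolding fps_mult_nth using g j by (intro sum.cong) auto
    also have "dpsi_fps * (\<Sum>m<M. kst (q ^ m) * fps_X ^ (m + 1)) = (\<Sum>m<M. kst (q ^ m) * (fps_X ^ (m + 1) * dpsi_fps))"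
      by (simp add: sum_distrib_left algebra_simps)
    finally show "fps_nth (dpsi_fps * geom_fps q) j = fps_nth (\<Sum>m<M. kst (q ^ m) * (fps_X ^ (m + 1) * dpsi_fps)) j" .
  qed (use assms in auto)
  also have "\<dots> = - (\<Sum>m<M. cst (q ^ m) * Lop (m + 2) p)"
    by (simp add: psi_vf_sum psi_vf_const_mult Lop_def psi_vf_minus sum_negf)
  finally show ?thesis .
qed

lemma Lop_eq_0:
  assumes "\<And>q. q \<in> vars p \<Longrightarrow> psi_index q \<le> M"
  shows "Lop (M + 2) p = 0"
proof -
  have "Lop (M + 2) p = psi_vf 0 p"
    unfolding Lop_def using assms by (intro psi_vf_cong) (auto simp: fps_X_power_mult_nth simp del: power_Suc)
  also have "\<dots> = 0" using psi_vf_const_mult[of 0 0 p] by simp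
  finally show ?thesis .
qed

text \<open>Adding U times the x-equation to the y-equation makes every term with F divisible by
  b^2, so the second root survives only in this factor and in the remainders.\<close>

lemma root_identity:
  fixes X U V :: "'a::comm_ring_1"
  defines "a \<equiv> 1 - U * X" and "b \<equiv> 1 - V * X"
  shows "(- ((a * b) ^ 2 * E) + F * X ^ 2 * ((1 - 2 * (U + V) * X) * (a * b) + (X - (U + V) * X ^ 2) * ((U + V) + 2 * - (U * V) * X))
      - X ^ 2 * ((a * b) * (X - (U + V) * X ^ 2)) * dF + p)
     + U * (- ((a * b) ^ 2 * A) + F * (2 * X ^ 3 * (a * b) + X ^ 4 * ((U + V) + 2 * - (U * V) * X)) - X ^ 4 * (a * b) * dF + p')
    = b ^ 2 * (- (a ^ 2 * (E + U * A)) + X ^ 2 * F - a * X ^ 3 * dF) + (p + U * p')"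
  unfolding a_def b_def by (simp add: algebra_simps power_numeral_reduce)

text \<open>For n at least 3, coefficient n + 2 of the product is a quadratic polynomial in q
  vanishing identically, with q^2-coefficient g_n; the values 0, 1 and -1 suffice.\<close>

lemma fps_deg_le_root_reduce:
  assumes "\<And>q. fps_deg_le 4 ((1 - kst q * fps_X) ^ 2 * g)"
  shows "fps_deg_le 2 g"
proof -
  have e: "fps_nth g (n + 2) - 2 * cst q * fps_nth g (n + 1) + cst q ^ 2 * fps_nth g n = 0" if "n \<ge> 3" for n q
  proof -
    have "(1 - kst q * fps_X) ^ 2 * g = g - fps_X ^ 1 * (fps_const (2 * cst q) * g) + fps_X ^ 2 * (fps_const (cst q ^ 2) * g)"
      by (simp add: algebra_simps power2_eq_square numeral_fps_const flip: fps_const_mult)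
    moreover have "fps_nth ((1 - kst q * fps_X) ^ 2 * g) (n + 2) = 0"
      using assms[of q] that by (simp add: fps_deg_le_def)
    ultimately show ?thesis by (simp only: fps_add_nth fps_sub_nth fps_X_power_mult_nth) simp
  qed
  have 0: "fps_nth g (n + 2) = 0" if "n \<ge> 3" for n using e[OF that, of 0] by simp
  have 1: "- 2 * fps_nth g (n + 1) + fps_nth g n = 0" "2 * fps_nth g (n + 1) + fps_nth g n = 0" if "n \<ge> 3" for n
    using e[OF that, of 1] e[OF that, of "- 1"] 0[OF that] by (simp_all add: cst_minus)
  have "fps_nth g n = 0" if "n \<ge> 3" for n
  proof -
    have "2 * fps_nth g n = 0" using 1[OF that] by (metis (no_types, lifting) add.commute add_cancel_right_left eq_neg_iff_add_eq_0 minus_mult_left mult_2 mult_minus_left)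
    then show ?thesis by simp
  qed
  then show ?thesis by (simp add: fps_deg_le_def)
qed

context gt_symmetry
begin

text \<open>F is free of jets, so the bracket does not depend on the second root q2, which is
  arbitrary; \<open>fps_deg_le_root_reduce\<close> then lowers the degree bound from 4 to 2.\<close>

lemma F_root_equation: "fps_deg_le 2 (- ((1 - kst q * fps_X) ^ 2 * cmap (Nop q) F) + fps_X ^ 2 * F - (1 - kst q * fps_X) * fps_X ^ 3 * fps_deriv F)"
proof (rule fps_deg_le_root_reduce)
  fix q2
  let ?e = "root_eval q q2"
  obtain p where p: "fps_deg_le 4 p" and "- (quad_fps ^ 2 * cmap Azero F) + F * (2 * fps_X ^ 3 * quad_fps + fps_X ^ 4 * (fps_const zx + 2 * fps_const zy * fps_X))
   - fps_X ^ 4 * quad_fps * fps_deriv F + p = 0" using A_equation_quad by blast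
  then have "?e (- (quad_fps ^ 2 * cmap Azero F) + F * (2 * fps_X ^ 3 * quad_fps + fps_X ^ 4 * (fps_const zx + 2 * fps_const zy * fps_X))
   - fps_X ^ 4 * quad_fps * fps_deriv F + p) = 0" by (simp only: cmap_subst_gt(3))
  then have A: "- (((1 - kst q * fps_X) * (1 - kst q2 * fps_X)) ^ 2 * ?e (cmap Azero F)) + F * (2 * fps_X ^ 3 * ((1 - kst q * fps_X) * (1 - kst q2 * fps_X))
    + fps_X ^ 4 * ((kst q + kst q2) + 2 * - (kst q * kst q2) * fps_X)) - fps_X ^ 4 * ((1 - kst q * fps_X) * (1 - kst q2 * fps_X)) * fps_deriv F + ?e p = 0"
    by (simp only: cmap_subst_gt(1,2,5,6,7,9,10,11) root_eval_quad root_eval_consts root_eval_base[OF base_F])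
  obtain p' where p': "fps_deg_le 4 p'" and "- (quad_fps ^ 2 * cmap Ezero F) + F * fps_X ^ 2 * ((1 - 2 * fps_const zx * fps_X) * quad_fps
   + (fps_X - fps_const zx * fps_X ^ 2) * (fps_const zx + 2 * fps_const zy * fps_X))
   - fps_X ^ 2 * (quad_fps * (fps_X - fps_const zx * fps_X ^ 2)) * fps_deriv F + p' = 0" using E_equation_quad by blast
  then have "?e (- (quad_fps ^ 2 * cmap Ezero F) + F * fps_X ^ 2 * ((1 - 2 * fps_const zx * fps_X) * quad_fps
   + (fps_X - fps_const zx * fps_X ^ 2) * (fps_const zx + 2 * fps_const zy * fps_X))
   - fps_X ^ 2 * (quad_fps * (fps_X - fps_const zx * fps_X ^ 2)) * fps_deriv F + p') = 0" by (simp only: cmap_subst_gt(3))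
  then have E: "- (((1 - kst q * fps_X) * (1 - kst q2 * fps_X)) ^ 2 * ?e (cmap Ezero F))
    + F * fps_X ^ 2 * ((1 - 2 * (kst q + kst q2) * fps_X) * ((1 - kst q * fps_X) * (1 - kst q2 * fps_X))
    + (fps_X - (kst q + kst q2) * fps_X ^ 2) * ((kst q + kst q2) + 2 * - (kst q * kst q2) * fps_X))
    - fps_X ^ 2 * (((1 - kst q * fps_X) * (1 - kst q2 * fps_X)) * (fps_X - (kst q + kst q2) * fps_X ^ 2)) * fps_deriv F + ?e p' = 0"
    by (simp only: cmap_subst_gt(1,2,4,5,6,7,9,10,11) root_eval_quad root_eval_consts root_eval_base[OF base_F])
  let ?g = "- ((1 - kst q * fps_X) ^ 2 * cmap (Nop q) F) + fps_X ^ 2 * F - (1 - kst q * fps_X) * fps_X ^ 3 * fps_deriv F"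
  have "(1 - kst q2 * fps_X) ^ 2 * ?g + (?e p' + kst q * ?e p) = 0"
    using root_identity[of "kst q" fps_X "kst q2" "?e (cmap Ezero F)" F "fps_deriv F" "?e p'" "?e (cmap Azero F)" "?e p"]
    unfolding A E root_eval_Ezero_Azero[OF base_F] by simp
  then have "(1 - kst q2 * fps_X) ^ 2 * ?g = - (?e p' + kst q * ?e p)"
    by (rule eq_neg_iff_add_eq_0[THEN iffD2])
  moreover have "- (?e p' + kst q * ?e p) = fps_const (- 1) * (?e p' + kst q * ?e p)"
    by (simp flip: fps_const_neg)
  moreover have "fps_deg_le 4 (fps_const (- 1) * (?e p' + kst q * ?e p))"
    by (intro fps_deg_le_const_mult fps_deg_le_add fps_deg_le_cmap p p' subst_gt_simps)
  ultimately show "fps_deg_le 4 ((1 - kst q2 * fps_X) ^ 2 * ?g)" by (simp only:)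
qed

lemma F_nth_0: "fps_nth F 0 = 0"
proof -
  have "fps_nth P 0 = fps_nth (fps_const (du Z) * x_fps + fps_const (dv Z) * y_fps - dpsi_fps * F) 0"
    using P_eq by simp
  then show ?thesis using P_nth_012[of 0] by (simp add: x_fps_nth y_fps_nth dpsi_nth)
qed

text \<open>The coefficient of t^n q^m in \<open>F_root_equation\<close>; n at least 3 lies beyond
  the bound 2.\<close>

lemma F_relation:
  assumes n: "n \<ge> 3"
  shows "Lop (m + 2) (fps_nth F n) - (if m = 0 then 0 else 2 * Lop (m + 1) (fps_nth F (n - 1)))
     + (if m < 2 then 0 else Lop m (fps_nth F (n - 2)))
     - (if m = 0 then of_nat (n - 3) * fps_nth F (n - 2) else 0) + (if m = 1 then of_nat (n - 3) * fps_nth F (n - 3) else 0) = 0"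
    (is "?e m = 0")
proof -
  define f where "f = fps_nth F"
  obtain M0 where "\<forall>q\<in>vars (f n). psi_index q \<le> M0" using psi_index_bounded by blast
  moreover obtain M1 where "\<forall>q\<in>vars (f (n - 1)). psi_index q \<le> M1" using psi_index_bounded by blast
  moreover obtain M2 where "\<forall>q\<in>vars (f (n - 2)). psi_index q \<le> M2" using psi_index_bounded by blast
  moreover define B where "B = M0 + M1 + M2"
  ultimately have B: "\<And>i q. i \<in> {n, n - 1, n - 2} \<Longrightarrow> q \<in> vars (f i) \<Longrightarrow> psi_index q \<le> B"
    by fastforce
  \<comment> \<open>Large enough that the fields with the two highest indices annihilate the three
    coefficients, so that the index shifts sh1 and sh2 lose no term.\<close>
  define M where "M = B + m + 2"
  have mM: "m \<le> M" "M \<ge> 2" "M \<ge> B + 1" by (simp_all add: M_def)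
  have N: "Nop q (f i) = - (\<Sum>m\<le>M. cst (q ^ m) * Lop (m + 2) (f i))" if "i \<in> {n, n - 1, n - 2}" for q i
  proof -
    have "Nop q (f i) = - (\<Sum>m<Suc M. cst (q ^ m) * Lop (m + 2) (f i))"
      by (rule Nop_expand) (use B[OF that] mM in fastforce)
    then show ?thesis by (simp only: lessThan_Suc_atMost)
  qed
  have L0: "Lop (j + 2) (f i) = 0" if "i \<in> {n, n - 1, n - 2}" "j \<ge> B" for i j
    by (rule Lop_eq_0) (use B[OF that(1)] that(2) in fastforce)
  have sh1: "cst q * (\<Sum>m\<le>M. cst (q ^ m) * Lop (m + 2) (f i)) = (\<Sum>m\<le>M. cst (q ^ m) * (if m = 0 then 0 else Lop (m + 1) (f i)))"
    if "i \<in> {n, n - 1, n - 2}" for q i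
  proof -
    obtain K where K: "M = Suc K" using mM by (cases M) auto
    have "cst q * (\<Sum>m\<le>M. cst (q ^ m) * Lop (m + 2) (f i)) = (\<Sum>m\<le>K. cst (q ^ Suc m) * Lop (m + 2) (f i))"
      using L0[OF that, of M] mM(3) by (simp add: K sum_distrib_left cst_mult mult.assoc)
    also have "\<dots> = (\<Sum>m\<le>M. cst (q ^ m) * (if m = 0 then 0 else Lop (m + 1) (f i)))"
      unfolding K by (subst sum.atMost_Suc_shift) simp
    finally show ?thesis .
  qed
  have sh2: "cst q * (\<Sum>m\<le>M. cst (q ^ m) * (if m = 0 then 0 else Lop (m + 1) (f i))) = (\<Sum>m\<le>M. cst (q ^ m) * (if m < 2 then 0 else Lop m (f i)))"
    if "i \<in> {n, n - 1, n - 2}" for q i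
  proof -
    obtain K where K: "M = Suc (Suc K)" using mM by (metis add_2_eq_Suc le_Suc_ex)
    have "Lop (M + 1) (f i) = 0" using L0[OF that, of "M - 1"] mM by simp
    then have "cst q * (\<Sum>m\<le>M. cst (q ^ m) * (if m = 0 then 0 else Lop (m + 1) (f i))) =
        (\<Sum>m\<le>Suc K. cst (q ^ Suc m) * (if m = 0 then 0 else Lop (m + 1) (f i)))"
      by (simp add: K sum_distrib_left cst_mult algebra_simps)
    also have "\<dots> = (\<Sum>m\<le>Suc (Suc K). cst (q ^ m) * (if m < 2 then 0 else Lop m (f i)))"
      unfolding sum.atMost_Suc_shift[of _ "Suc K"] by (auto intro!: sum.cong)
    finally show ?thesis by (simp only: K)
  qed
  have main: "(\<Sum>m\<le>M. cst (q ^ m) * ?e m) = 0" for q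
  proof -
    let ?i = "\<lambda>i. \<Sum>m\<le>M. cst (q ^ m) * Lop (m + 2) (f i)"
    have g: "- ((1 - kst q * fps_X) ^ 2 * cmap (Nop q) F) + fps_X ^ 2 * F - (1 - kst q * fps_X) * fps_X ^ 3 * fps_deriv F
      = - cmap (Nop q) F + fps_X ^ 1 * (fps_const (2 * cst q) * cmap (Nop q) F) - fps_X ^ 2 * (fps_const (cst q ^ 2) * cmap (Nop q) F)
        + fps_X ^ 2 * F - fps_X ^ 3 * fps_deriv F + fps_X ^ 4 * (kst q * fps_deriv F)"
      by (simp add: algebra_simps power_numeral_reduce numeral_fps_const flip: fps_const_mult)
    \<comment> \<open>Coefficient n of t^3 F' is (n - 2) F_(n-2); it is split as (n - 3) + 1 because
      t^2 F cancels one copy.\<close>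
    have d3: "(if n < 3 then 0 else fps_nth (fps_deriv F) (n - 3)) = (of_nat (n - 3) + 1) * f (n - 2)"
      using n by (simp add: f_def Suc_diff_Suc numeral_3_eq_3 numeral_2_eq_2 algebra_simps)
    have d4: "(if n < 4 then 0 else fps_nth (kst q * fps_deriv F) (n - 4)) = cst q * (of_nat (n - 3) * f (n - 3))"
    proof (cases "n = 3")
      case False
      then have "Suc (n - 4) = n - 3" using n by simp
      then show ?thesis using n False by (simp add: f_def)
    qed simp
    have "fps_nth (- ((1 - kst q * fps_X) ^ 2 * cmap (Nop q) F) + fps_X ^ 2 * F - (1 - kst q * fps_X) * fps_X ^ 3 * fps_deriv F) n = 0"
      using F_root_equation[of q] n by (simp add: fps_deg_le_def)
    then have "- Nop q (f n) + 2 * cst q * Nop q (f (n - 1)) - cst q ^ 2 * Nop q (f (n - 2)) + f (n - 2)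
       - (of_nat (n - 3) + 1) * f (n - 2) + cst q * (of_nat (n - 3) * f (n - 3)) = 0"
      unfolding g using n by (simp only: fps_add_nth fps_sub_nth fps_neg_nth fps_X_power_mult_nth d3 d4)
        (simp add: f_def)?
    then have 1: "?i n - 2 * (cst q * ?i (n - 1)) + cst q * (cst q * ?i (n - 2))
       - of_nat (n - 3) * f (n - 2) + cst q * (of_nat (n - 3) * f (n - 3)) = 0"
      by (simp add: N algebra_simps power2_eq_square)
    have "(\<Sum>m\<le>M. cst (q ^ m) * ?e m) = ?i n - 2 * (\<Sum>m\<le>M. cst (q ^ m) * (if m = 0 then 0 else Lop (m + 1) (f (n - 1))))
       + (\<Sum>m\<le>M. cst (q ^ m) * (if m < 2 then 0 else Lop m (f (n - 2))))
       - (\<Sum>m\<le>M. cst (q ^ m) * (if m = 0 then of_nat (n - 3) * f (n - 2) else 0))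
       + (\<Sum>m\<le>M. cst (q ^ m) * (if m = 1 then of_nat (n - 3) * f (n - 3) else 0))"
      unfolding sum_distrib_left sum.distrib[symmetric] sum_subtractf[symmetric]
      by (intro sum.cong refl) (simp add: f_def algebra_simps)
    also have "(\<Sum>m\<le>M. cst (q ^ m) * (if m = 0 then of_nat (n - 3) * f (n - 2) else 0)) = of_nat (n - 3) * f (n - 2)"
      by (subst sum.remove[of _ 0]) (auto intro!: sum.neutral)
    also have "(\<Sum>m\<le>M. cst (q ^ m) * (if m = 1 then of_nat (n - 3) * f (n - 3) else 0)) = cst q * (of_nat (n - 3) * f (n - 3))"
      using mM by (subst sum.remove[of _ 1]) (auto intro!: sum.neutral)
    finally show ?thesis using 1 by (simp only: sh1 sh2 insertI1 insertI2)
  qed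
  show ?thesis by (rule real_poly_coeffs_0[OF main mM(1)])
qed

lemma F_relations:
  assumes n: "n \<ge> 3"
  shows "Lop 2 (fps_nth F n) = of_nat (n - 3) * fps_nth F (n - 2)"
    and "Lop 3 (fps_nth F n) = 2 * Lop 2 (fps_nth F (n - 1)) - of_nat (n - 3) * fps_nth F (n - 3)"
    and "m \<ge> 4 \<Longrightarrow> Lop m (fps_nth F n) = 2 * Lop (m - 1) (fps_nth F (n - 1)) - Lop (m - 2) (fps_nth F (n - 2))"
proof -
  show "Lop 2 (fps_nth F n) = of_nat (n - 3) * fps_nth F (n - 2)"
    using F_relation[OF n, of 0] by (simp add: numeral_2_eq_2)
  show "Lop 3 (fps_nth F n) = 2 * Lop 2 (fps_nth F (n - 1)) - of_nat (n - 3) * fps_nth F (n - 3)"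
    using F_relation[OF n, of 1] by (simp add: numeral_2_eq_2 numeral_3_eq_3 algebra_simps)
  assume m: "m \<ge> 4"
  then obtain j where j: "m = j + 4" by (metis add.commute le_Suc_ex)
  show "Lop m (fps_nth F n) = 2 * Lop (m - 1) (fps_nth F (n - 1)) - Lop (m - 2) (fps_nth F (n - 2))"
    using F_relation[OF n, of "j + 2"] by (simp add: j algebra_simps numeral_eq_Suc)
qed

end

subsection \<open>The Witt algebra module generated by a symmetry\<close>

lemma of_int_mult_cancel: "c \<noteq> 0 \<Longrightarrow> of_int c * p = of_int c * q \<Longrightarrow> p = q" for p q :: gtpoly
  by simp

lemma Lop_of_int: "Lop m (of_int c * p) = of_int c * Lop m p"
  using derivation_cmult[OF derivation_Lop, of m "of_int c" p] by (simp add: cst_of_int)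

text \<open>The values at d = 0 and d > 0 are forced by the rule L_m G_j = (1 - j - 2m) G_(j+m),
  applied to G_(-2) with m = 2 and to G_(-1) with m = d + 1, whose factors are -1 and -2d.\<close>

definition witt_ext :: "(nat \<Rightarrow> gtpoly) \<Rightarrow> int \<Rightarrow> gtpoly" where
  "witt_ext f d = (if d < 0 then f (nat (- d)) else if d = 0 then - Lop 2 (f 2)
     else cst (- (1 / (2 * real_of_int d))) * Lop (nat d + 1) (f 1))"

context
  fixes f :: "nat \<Rightarrow> gtpoly"
  assumes R2: "\<And>n. n \<ge> 3 \<Longrightarrow> Lop 2 (f n) = of_nat (n - 3) * f (n - 2)"
    and R3: "\<And>n. n \<ge> 3 \<Longrightarrow> Lop 3 (f n) = 2 * Lop 2 (f (n - 1)) - of_nat (n - 3) * f (n - 3)"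
    and R4: "\<And>n m. n \<ge> 3 \<Longrightarrow> m \<ge> 4 \<Longrightarrow> Lop m (f n) = 2 * Lop (m - 1) (f (n - 1)) - Lop (m - 2) (f (n - 2))"
begin

text \<open>R4 says that the second difference in j of \<open>Lop (d + j) (f j)\<close> vanishes, so
  this is the linear interpolation between j = 1 and j = 2.\<close>

lemma witt_diagonal:
  assumes "d \<ge> 1" "j \<ge> 1"
  shows "Lop (d + j) (f j) = of_int (2 - int j) * Lop (d + 1) (f 1) + of_int (int j - 1) * Lop (d + 2) (f 2)"
  using assms(2)
proof (induction j rule: less_induct)
  case (less j)
  consider "j = 1" | "j = 2" | i where "j = i + 3"
  proof -
    have "j = 1 \<or> j = 2 \<or> j = (j - 3) + 3" using less.prems by linarith
    then show thesis using that by blast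
  qed
  then show ?case
  proof cases
    case 3
    let ?A = "Lop (d + 1) (f 1)" and ?B = "Lop (d + 2) (f 2)"
    have e: "Lop (d + j) (f j) = 2 * Lop (d + (i + 2)) (f (i + 2)) - Lop (d + (i + 1)) (f (i + 1))"
      using R4[of j "d + j"] 3 assms(1) by (simp add: numeral_eq_Suc)
    have e2: "Lop (d + (i + 2)) (f (i + 2)) = of_int (2 - int (i + 2)) * ?A + of_int (int (i + 2) - 1) * ?B"
      by (rule less.IH) (use 3 in auto)
    have e1: "Lop (d + (i + 1)) (f (i + 1)) = of_int (2 - int (i + 1)) * ?A + of_int (int (i + 1) - 1) * ?B"
      by (rule less.IH) (use 3 in auto)
    show ?thesis unfolding e e1 e2 unfolding 3 by (simp add: algebra_simps)
  qed simp_all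
qed

lemma witt_diagonal_0: "j \<ge> 2 \<Longrightarrow> Lop j (f j) = of_int (int j - 1) * Lop 2 (f 2)"
proof (induction j rule: less_induct)
  case (less j)
  consider "j = 2" | "j = 3" | i where "j = i + 4"
  proof -
    have "j = 2 \<or> j = 3 \<or> j = (j - 4) + 4" using less.prems by linarith
    then show thesis using that by blast
  qed
  then show ?case
  proof cases
    case 2
    then show ?thesis using R3[of 3] by simp
  next
    case 3
    have e: "Lop j (f j) = 2 * Lop (i + 3) (f (i + 3)) - Lop (i + 2) (f (i + 2))"
      using R4[of j j] 3 by (simp add: numeral_eq_Suc)
    have e3: "Lop (i + 3) (f (i + 3)) = of_int (int (i + 3) - 1) * Lop 2 (f 2)"
      by (rule less.IH) (use 3 in auto)
    have e2: "Lop (i + 2) (f (i + 2)) = of_int (int (i + 2) - 1) * Lop 2 (f 2)"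
      by (rule less.IH) (use 3 in auto)
    show ?thesis unfolding e e2 e3 unfolding 3 by (simp add: algebra_simps)
  qed simp_all
qed

text \<open>R4 relates values with the same n - m and makes second differences vanish, so the factor
  is linear in m and determined by R2 and R3.\<close>

lemma witt_lower: "m \<ge> 2 \<Longrightarrow> n > m \<Longrightarrow> Lop m (f n) = of_int (int n + 1 - 2 * int m) * f (n - m)"
proof (induction m arbitrary: n rule: less_induct)
  case (less m)
  consider "m = 2" | "m = 3" | "m \<ge> 4" using less.prems by linarith
  then show ?case
  proof cases
    case 1
    then show ?thesis using R2[of n] less.prems by (simp add: of_nat_diff)
  next
    case 2
    then obtain i where i: "n = i + 4"
      using less.prems(2) by (metis add.commute le_Suc_ex Suc_leI eval_nat_numeral(2) semiring_norm(26,27,28))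
    have a: "Lop 2 (f (i + 3)) = of_nat i * f (i + 1)" using R2[of "i + 3"] by simp
    have b: "Lop 3 (f n) = 2 * Lop 2 (f (i + 3)) - of_nat (i + 1) * f (i + 1)"
      using R3[of n] by (simp add: i eval_nat_numeral)
    have "n - m = i + 1" using 2 i by simp
    then show ?thesis unfolding 2 b a by (simp add: i algebra_simps)
  next
    case 3
    have "Lop (m - 1) (f (n - 1)) = of_int (int (n - 1) + 1 - 2 * int (m - 1)) * f (n - 1 - (m - 1))"
      by (rule less.IH) (use less.prems 3 in auto)
    moreover have "int (n - 1) + 1 - 2 * int (m - 1) = int n + 2 - 2 * int m" "n - 1 - (m - 1) = n - m"
      using less.prems by (simp_all add: of_nat_diff)
    ultimately have 1: "Lop (m - 1) (f (n - 1)) = of_int (int n + 2 - 2 * int m) * f (n - m)" by (simp only:)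
    have "Lop (m - 2) (f (n - 2)) = of_int (int (n - 2) + 1 - 2 * int (m - 2)) * f (n - 2 - (m - 2))"
      by (rule less.IH) (use less.prems 3 in auto)
    moreover have "int (n - 2) + 1 - 2 * int (m - 2) = int n + 3 - 2 * int m" "n - 2 - (m - 2) = n - m"
      using less.prems 3 by (simp_all add: of_nat_diff)
    ultimately have 2: "Lop (m - 2) (f (n - 2)) = of_int (int n + 3 - 2 * int m) * f (n - m)" by (simp only:)
    show ?thesis using R4[of n m] less.prems 3 unfolding 1 2 by (simp add: algebra_simps)
  qed
qed

text \<open>\<open>witt_diagonal\<close> leaves two unknowns on each diagonal. The commutator of
  \<open>Lop a\<close> and \<open>Lop (a + 1)\<close>, applied to \<open>f (a + 2)\<close>, relates
  them.\<close>

lemma witt_first_two: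
  assumes "a \<ge> 2"
  shows "of_int (2 * int a - 2) * Lop (a + 1) (f 2) = of_int (2 * int a - 1) * Lop a (f 1)"
proof -
  have 1: "Lop (a + 1) (f (a + 2)) = of_int (1 - int a) * f 1" using witt_lower[of "a + 1" "a + 2"] assms by simp
  have 2: "Lop a (f (a + 2)) = of_int (3 - int a) * f 2" using witt_lower[of a "a + 2"] assms by simp
  have "(a - 1) + (a + 2) = a + (a + 1)" "a - 1 + 1 = a" "a - 1 + 2 = a + 1" using assms by simp_all
  then have 3: "Lop (a + (a + 1)) (f (a + 2)) = of_int (- int a) * Lop a (f 1) + of_int (int a + 1) * Lop (a + 1) (f 2)"
    using witt_diagonal[of "a - 1" "a + 2"] assms by simp
  show ?thesis
    using Lop_commutator[of a "a + 1" "f (a + 2)"] assms unfolding 1 2 3 Lop_of_int by (simp add: algebra_simps)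
qed

lemma witt_ext_pos:
  assumes "d \<ge> 1"
  shows "Lop (d + 1) (f 1) = of_int (- 2 * int d) * witt_ext f (int d)" "Lop (d + 2) (f 2) = of_int (- 2 * int d - 1) * witt_ext f (int d)"
proof -
  have "of_int (- 2 * int d) * cst (- (1 / (2 * real d))) = (1 :: gtpoly)"
    using assms by (simp flip: cst_of_int cst_mult)
  then have c: "of_int (- 2 * int d) * (cst (- (1 / (2 * real d))) * p) = p" for p
    unfolding mult.assoc[symmetric] by (simp only: mult_1)
  have "witt_ext f (int d) = cst (- (1 / (2 * real d))) * Lop (d + 1) (f 1)"
    using assms by (simp add: witt_ext_def)
  then show 1: "Lop (d + 1) (f 1) = of_int (- 2 * int d) * witt_ext f (int d)"
    by (simp only: c)
  have "of_int (2 * int d) * Lop (d + 2) (f 2) = of_int (2 * int d) * (of_int (- 2 * int d - 1) * witt_ext f (int d))"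
  proof -
    have e: "d + 1 + 1 = d + 2" "2 * int (d + 1) - 2 = 2 * int d" by simp_all
    have w: "of_int (2 * int (d + 1) - 2) * Lop (d + 1 + 1) (f 2) = of_int (2 * int (d + 1) - 1) * Lop (d + 1) (f 1)"
      by (rule witt_first_two) (use assms in simp)
    have "of_int (2 * int d) * Lop (d + 2) (f 2) = of_int (2 * int (d + 1) - 1) * (of_int (- 2 * int d) * witt_ext f (int d))"
      using w by (simp only: e 1)
    also have "\<dots> = of_int (2 * int d) * (of_int (- 2 * int d - 1) * witt_ext f (int d))" by (simp add: algebra_simps)
    finally show ?thesis .
  qed
  then show "Lop (d + 2) (f 2) = of_int (- 2 * int d - 1) * witt_ext f (int d)"
    by (rule of_int_mult_cancel[rotated]) (use assms in simp)
qed

lemma witt_ext_nonneg_index: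
  assumes "m \<ge> 2" "j \<ge> 1"
  shows "Lop m (f j) = of_int (int j + 1 - 2 * int m) * witt_ext f (int m - int j)"
proof -
  consider "m < j" | "m = j" | d where "m = d + j" "d \<ge> 1"
  proof -
    have "m < j \<or> m = j \<or> m = (m - j) + j \<and> m - j \<ge> 1" by linarith
    then show thesis using that by blast
  qed
  then show ?thesis
  proof cases
    case 1
    then show ?thesis using witt_lower[of m j] assms by (simp add: witt_ext_def nat_diff_distrib)
  next
    case 2
    then show ?thesis using witt_diagonal_0[of j] assms by (simp add: witt_ext_def algebra_simps)
  next
    case 3
    then show ?thesis using witt_diagonal[OF 3(2) assms(2)] unfolding witt_ext_pos[OF 3(2)] by (simp add: algebra_simps)
  qed
qed

text \<open>For negative d this is \<open>witt_ext_nonneg_index\<close>. Otherwise G_d is a nonzero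
  multiple of \<open>Lop b\<close> applied to some f_j, and commuting \<open>Lop m\<close> past
  \<open>Lop b\<close> leads back to that lemma.\<close>

lemma Lop_witt_ext:
  assumes m: "m \<ge> 2"
  shows "Lop m (witt_ext f d) = of_int (1 - d - 2 * int m) * witt_ext f (d + int m)"
proof (cases "d < 0")
  case True
  then show ?thesis using witt_ext_nonneg_index[OF m, of "nat (- d)"] by (simp add: witt_ext_def[of f d] algebra_simps)
next
  case False
  then obtain e where d: "d = int e" by (metis not_less nonneg_int_cases)
  define b where "b = m + e + 1"
  \<comment> \<open>With this index \<open>Lop m\<close> gives a multiple of \<open>f 1\<close>, and
    the factor m + 2d relating G_d to \<open>Lop b (f ?j)\<close> is positive.\<close>
  let ?j = "m + 1"
  have 1: "Lop b (f ?j) = of_int (- (int m + 2 * d)) * witt_ext f d"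
    using witt_ext_nonneg_index[of b ?j] m by (simp add: b_def d algebra_simps)
  have 2: "Lop m (f ?j) = of_int (2 - int m) * f 1"
    using witt_lower[of m ?j] m by simp
  have 3: "Lop b (f 1) = of_int (- 2 * (int m + d)) * witt_ext f (d + int m)"
    using witt_ext_nonneg_index[of b 1] m by (simp add: b_def d algebra_simps)
  have 4: "Lop (m + b) (f ?j) = of_int (- (3 * int m + 2 * d)) * witt_ext f (d + int m)"
    using witt_ext_nonneg_index[of "m + b" ?j] m by (simp add: b_def d algebra_simps)
  have "of_int (- (int m + 2 * d)) * Lop m (witt_ext f d) =
     of_int (2 - int m) * (of_int (- 2 * (int m + d)) * witt_ext f (d + int m))
     + of_int (- (d + 1)) * (of_int (- (3 * int m + 2 * d)) * witt_ext f (d + int m))"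
    using Lop_commutator[of m b "f ?j"] m unfolding 1 2 Lop_of_int 3 4 by (simp add: b_def d algebra_simps)
  also have "\<dots> = of_int ((2 - int m) * (- 2 * (int m + d)) + (d + 1) * (3 * int m + 2 * d)) * witt_ext f (d + int m)"
    by (simp add: algebra_simps)
  also have "(2 - int m) * (- 2 * (int m + d)) + (d + 1) * (3 * int m + 2 * d) = - (int m + 2 * d) * (1 - d - 2 * int m)"
    by (simp add: algebra_simps)
  finally have "of_int (- (int m + 2 * d)) * Lop m (witt_ext f d) = of_int (- (int m + 2 * d)) * (of_int (1 - d - 2 * int m) * witt_ext f (d + int m))"
    by (simp only: of_int_mult mult.assoc)
  then show ?thesis by (rule of_int_mult_cancel[rotated]) (use False m in simp)
qed

end

section \<open>Weights and common constants of the fields L_m\<close>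

lemma base_mult: "base p \<Longrightarrow> base q \<Longrightarrow> base (p * q)"
  by (simp add: base_def derivation_simps[OF derivation_pderiv_c])
lemma base_minus: "base p \<Longrightarrow> base (- p)"
  by (simp add: base_def derivation_simps[OF derivation_pderiv_c])
lemma base_cst: "base (cst c)"
  by (simp add: base_def derivation_simps[OF derivation_pderiv_c])
lemma base_sum: "(\<And>i. i \<in> I \<Longrightarrow> base (f i)) \<Longrightarrow> base (\<Sum>i\<in>I. f i)"
  by (simp add: base_def derivation_sum[OF derivation_pderiv_c])
lemma base_add: "base p \<Longrightarrow> base q \<Longrightarrow> base (p + q)"
  by (simp add: base_def derivation_simps[OF derivation_pderiv_c])
lemma base_var: "\<not> jet q \<Longrightarrow> base (var q)"
  by (auto simp: base_def pderiv_c_var)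
lemma base_0: "base 0"
  by (simp add: base_def derivation_simps[OF derivation_pderiv_c])

lemma base_psi_vf:
  assumes "base_fps f" "base p" shows "base (psi_vf f p)"
proof -
  have "base (psi_field f q)" for q
    using assms(1) base_var[of Yc] by (auto simp: psi_field_def base_fps_iff base_add base_mult base_0 split: coord.splits)
  then show ?thesis
    unfolding psi_vf_def vf_app_def by (intro base_sum base_mult base_pderiv assms)
qed

lemma base_Lop: "base p \<Longrightarrow> base (Lop m p)"
  unfolding Lop_def by (intro base_psi_vf base_fps_simps base_fps_dpsi)

lemma wt_psi: "n \<ge> 1 \<Longrightarrow> hom_deg wt (int n + 1) (psi n)"
proof -
  assume n: "n \<ge> 1"
  consider "n = 1" | "n = 2" | "n = 3" | "n \<ge> 4" using n by linarith
  then show ?thesis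
  proof cases
    case 3
    have "hom_deg wt 4 (var (Zx 0))" "hom_deg wt 4 ((var Yc)\<^sup>2)"
      using hom_deg_var[of wt "Zx 0"] hom_deg_power[OF hom_deg_var[of wt Yc], of 2] by simp_all
    then show ?thesis using 3 by (simp add: psi_def hom_deg_diff hom_deg_cst_mult)
  next
    case 4
    then show ?thesis using hom_deg_var[of wt "Psi (n - 4)"] by (simp add: psi_def of_nat_diff add.commute)
  qed (use hom_deg_var[of wt Yc] hom_deg_var[of wt Xc] in \<open>simp_all add: psi_def\<close>)
qed

lemma wt_zx: "hom_deg wt 1 zx" and wt_zy: "hom_deg wt 2 zy"
  using hom_deg_var[of wt "Zx 1"] hom_deg_var[of wt "Zxy 0"] by (simp_all add: zx_def zy_def)

lemma wt_dpsi_fps: "fps_hom_deg wt 1 0 dpsi_fps"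
  using fps_hom_deg_psi[of wt 1] wt_psi by simp

lemma wt_sigma_fps: "fps_hom_deg wt 1 0 sigma_fps"
  using fps_hom_deg_sigma[of wt 1] wt_zx wt_zy by simp

lemma fps_hom_deg_mult': "fps_hom_deg w a e f \<Longrightarrow> fps_hom_deg w a e' g \<Longrightarrow> e'' = e + e' \<Longrightarrow> fps_hom_deg w a e'' (f * g)"
  using fps_hom_deg_mult by blast

lemma fps_hom_deg_X_power: "e = - (a * int n) \<Longrightarrow> fps_hom_deg w a e (fps_X ^ n)"
  using fps_hom_deg_power[OF fps_hom_deg_X, of w a n] by (simp add: mult.commute)

lemma wt_x_fps: "fps_hom_deg wt 1 (- 2) x_fps" and wt_y_fps: "fps_hom_deg wt 1 (- 1) y_fps"
proof -
  show "fps_hom_deg wt 1 (- 2) x_fps"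
    unfolding x_fps_def
    using fps_hom_deg_mult[OF fps_hom_deg_mult[OF fps_hom_deg_X_power[of "- 2" 1 2] wt_dpsi_fps] wt_sigma_fps] by simp
  have "fps_hom_deg wt 1 (- 1) (fps_const zy * fps_X ^ 3 * sigma_fps)"
    using fps_hom_deg_mult[OF fps_hom_deg_mult[OF fps_hom_deg_const[OF wt_zy] fps_hom_deg_X_power[of "- 3" 1 3]] wt_sigma_fps] by simp
  then show "fps_hom_deg wt 1 (- 1) y_fps"
    unfolding y_fps_def using fps_hom_deg_X[of wt 1]
    by (intro fps_hom_deg_mult'[OF wt_dpsi_fps] fps_hom_deg_add) simp_all
qed

lemma wt_Lop:
  assumes m: "m \<ge> 2" and p: "hom_deg wt w p"
  shows "hom_deg wt (w - int m) (Lop m p)"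
proof -
  let ?f = "- (fps_X ^ (m - 1) * dpsi_fps)"
  have "fps_hom_deg wt 1 (1 - int m) ?f"
    by (intro fps_hom_deg_minus fps_hom_deg_mult'[OF fps_hom_deg_X_power wt_dpsi_fps]) (use m in auto)
  then have f: "hom_deg wt (int n + 1 - int m) (fps_nth ?f n)" for n
    using fps_hom_deg_nth[of wt 1 "1 - int m" ?f n] by (simp add: add_diff_eq)
  have "hom_deg wt (wt q + - int m) (Lop m (var q))" for q
  proof (cases q)
    case (Zx a)
    have "hom_deg wt (4 - int m) (var Yc * fps_nth ?f 1)"
      using hom_deg_mult[OF hom_deg_var[of wt Yc] f[of 1]] by simp
    then have "a = 0 \<Longrightarrow> hom_deg wt (4 - int m) (fps_nth ?f 3 + var Yc * fps_nth ?f 1)"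
      using f[of 3] by (intro hom_deg_add) simp_all
    then show ?thesis using Zx by (simp add: Lop_def psi_vf_def vf_app_var psi_field_def)
  qed (use f[of 1] f[of 2] f[of "n + 4" for n] in \<open>simp_all add: Lop_def psi_vf_def vf_app_var psi_field_def algebra_simps\<close>)
  from hom_deg_derivation[OF derivation_Lop this p] show ?thesis by simp
qed

text \<open>The coordinates x, y, z and \<open>Psi n\<close> all have positive weight.\<close>

lemma base_wt_nonneg:
  assumes "base p" "hom_deg wt w p" "w < 0"
  shows "p = 0"
proof (rule poly_mapping_eqI)
  fix m
  show "Poly_Mapping.lookup p m = Poly_Mapping.lookup 0 m"
  proof (rule ccontr)
    assume "Poly_Mapping.lookup p m \<noteq> Poly_Mapping.lookup 0 m"
    then have m: "m \<in> Poly_Mapping.keys p" by (simp add: in_keys_iff)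
    have "wt q \<ge> 0" if "q \<in> Poly_Mapping.keys m" for q
    proof -
      have "q \<in> vars p" using that m by (auto simp: vars_def)
      then have "\<not> jet q" using base_vars assms(1) by blast
      then show ?thesis by (cases q) auto
    qed
    then have "mono_deg wt m \<ge> 0" unfolding mono_deg_def by (intro sum_nonneg) auto
    then show False using assms(2,3) m by (auto simp: hom_deg_def)
  qed
qed

text \<open>The fields are triangular: psi' starts with 1, so if K is the largest index in p and c
  the coordinate with this index, \<open>Lop (K + 1)\<close> acts on p as minus the derivative in
  c.\<close>

lemma base_Lop_const:
  assumes p: "base p" and L: "\<And>m. m \<ge> 2 \<Longrightarrow> Lop m p = 0"
  shows "p = cst (Poly_Mapping.lookup p 0)"
proof (rule const_if_pderiv_c_0)
  have "vars p = {}"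
  proof (rule ccontr)
    assume ne: "vars p \<noteq> {}"
    define K where "K = Max (psi_index ` vars p)"
    have "K \<in> psi_index ` vars p" unfolding K_def using ne by (intro Max_in) (auto simp: finite_vars)
    then obtain c where c: "c \<in> vars p" "psi_index c = K" by auto
    have le: "psi_index q \<le> K" if "q \<in> vars p" for q unfolding K_def using that by (intro Max_ge) (auto simp: finite_vars)
    have nj: "\<not> jet q" if "q \<in> vars p" for q using base_vars[OF p that] .
    have K1: "K \<ge> 1" using c nj[OF c(1)] by (cases c) auto
    let ?f = "- (fps_X ^ K * dpsi_fps)"
    have f: "fps_nth ?f j = (if j < K then 0 else if j = K then - 1 else fps_nth ?f j)" for j
      by (simp add: fps_X_power_mult_nth dpsi_nth)
    have field: "psi_field ?f q = (if q = c then - 1 else 0)" if "q \<in> vars p" for q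
    proof (cases "q = c")
      case True
      then show ?thesis using c nj[OF c(1)] f[of K] f[of 1]
        by (cases c) (auto simp: psi_field_def)
    next
      case False
      have "psi_index q \<noteq> K" using False c nj[OF that] nj[OF c(1)] by (cases q; cases c) auto
      then have "psi_index q < K" using le[OF that] by simp
      then have "fps_nth ?f j = 0" if "j \<le> psi_index q" for j using f[of j] that by simp
      then have "psi_field ?f q = psi_field 0 q" by (intro psi_field_cong) simp
      then show ?thesis using False by (auto simp: psi_field_def split: coord.splits)
    qed
    have "Lop (K + 1) p = (\<Sum>q\<in>vars p. if q = c then - pderiv_c c p else 0)"
      unfolding Lop_def psi_vf_def vf_app_def using field by (intro sum.cong) auto
    also have "\<dots> = - pderiv_c c p" using c by (simp add: finite_vars)
    finally have "pderiv_c c p = 0" using L[of "K + 1"] K1 by simp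
    then show False using c by (simp add: pderiv_c_eq_0_iff)
  qed
  then show "pderiv_c q p = 0" for q by (simp add: pderiv_c_eq_0_iff)
qed

lemma hom_wt_lookup_0: "hom_deg w n p \<Longrightarrow> n \<noteq> 0 \<Longrightarrow> Poly_Mapping.lookup p 0 = 0"
  by (metis hom_deg_def in_keys_iff mono_deg_0)

subsection \<open>The inverse series\<close>

text \<open>The contraction principle for the t-adic metric: coefficient n of the image depends only
  on the coefficients below n.\<close>

lemma fps_contraction_fixpoint:
  fixes \<Theta> :: "'a::comm_ring_1 fps \<Rightarrow> 'a fps"
  assumes contr: "\<And>f g n. (\<And>i. i < n \<Longrightarrow> fps_nth f i = fps_nth g i) \<Longrightarrow> fps_nth (\<Theta> f) n = fps_nth (\<Theta> g) n"
  shows "\<exists>!f. \<Theta> f = f"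
proof (rule ex_ex1I)
  define it where "it N = (\<Theta> ^^ N) 0" for N
  have it_Suc: "it (Suc N) = \<Theta> (it N)" for N by (simp add: it_def)
  have step: "i < N \<Longrightarrow> fps_nth (it N) i = fps_nth (it (Suc N)) i" for i N
  proof (induction N arbitrary: i)
    case (Suc N)
    have "fps_nth (\<Theta> (it N)) i = fps_nth (\<Theta> (it (Suc N))) i"
      by (rule contr) (use Suc in auto)
    then show ?case by (simp add: it_Suc)
  qed simp
  have stable: "i < N \<Longrightarrow> fps_nth (it (N + M)) i = fps_nth (it N) i" for i N M
  proof (induction M)
    case (Suc M)
    then show ?case using step[of i "N + M"] by simp
  qed simp
  define f where "f = Abs_fps (\<lambda>n. fps_nth (it (Suc n)) n)"
  have "fps_nth (\<Theta> f) n = fps_nth f n" for n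
  proof -
    have "fps_nth f i = fps_nth (it n) i" if "i < n" for i
      using stable[of i "Suc i" "n - Suc i"] that by (simp add: f_def)
    then have "fps_nth (\<Theta> f) n = fps_nth (\<Theta> (it n)) n" by (rule contr)
    then show ?thesis by (simp add: f_def it_Suc)
  qed
  then have "\<Theta> f = f" by (simp add: fps_eq_iff)
  then show "\<exists>f. \<Theta> f = f" by blast
next
  fix f g assume fg: "\<Theta> f = f" "\<Theta> g = g"
  have "fps_nth f n = fps_nth g n" for n
  proof (induction n rule: less_induct)
    case (less n)
    have "fps_nth (\<Theta> f) n = fps_nth (\<Theta> g) n" by (rule contr) (rule less.IH)
    then show ?case using fg by simp
  qed
  then show "f = g" by (simp add: fps_eq_iff)
qed

lemma agree_mult:
  "(\<And>i. i < n \<Longrightarrow> fps_nth f i = fps_nth f' i) \<Longrightarrow> (\<And>i. i < n \<Longrightarrow> fps_nth g i = fps_nth g' i) \<Longrightarrow> i < n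
    \<Longrightarrow> fps_nth (f * g) i = fps_nth (f' * g') i" for f g :: "'a::comm_ring_1 fps"
  unfolding fps_mult_nth by (intro sum.cong) auto

lemma agree_power:
  "(\<And>i. i < n \<Longrightarrow> fps_nth f i = fps_nth f' i) \<Longrightarrow> i < n \<Longrightarrow> fps_nth (f ^ k) i = fps_nth (f' ^ k) i" for f :: "'a::comm_ring_1 fps"
proof (induction k arbitrary: i)
  case (Suc k)
  show ?case unfolding power_Suc by (rule agree_mult[of n]) (use Suc in auto)
qed simp

lemma ufps_uinv: "ufps \<Phi> * uinv \<Phi> = 1"
  unfolding uinv_def by (rule fps_right_inverse) (simp add: ufps_def)

lemma agree_uinv:
  assumes "\<And>i. i < n \<Longrightarrow> fps_nth f i = fps_nth g i" "i \<le> n"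
  shows "fps_nth (uinv f) i = fps_nth (uinv g) i"
proof -
  have "uinv f - uinv g = (ufps g * uinv g) * uinv f - (ufps f * uinv f) * uinv g" by (simp add: ufps_uinv)
  also have "\<dots> = (ufps g - ufps f) * (uinv f * uinv g)" by (simp add: algebra_simps)
  also have "\<dots> = fps_X * ((g - f) * (uinv f * uinv g))" by (simp add: ufps_def algebra_simps)
  finally have e: "uinv f - uinv g = fps_X * ((g - f) * (uinv f * uinv g))" .
  have "fps_nth (uinv f - uinv g) i = 0"
    unfolding e using assms by (cases i) (auto simp: fps_mult_nth intro!: sum.neutral)
  then show ?thesis by simp
qed

text \<open>As phi = u / lambda, this is 1 / phi, the value of t at mu = phi(lambda).\<close>

definition tau :: "gtpoly fps \<Rightarrow> gtpoly fps" where "tau \<Phi> = fps_X * uinv \<Phi>"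

lemma tau_power: "tau \<Phi> ^ j = fps_X ^ j * uinv \<Phi> ^ j"
  by (simp add: tau_def power_mult_distrib)

lemma tau_nth_0: "fps_nth (tau \<Phi>) 0 = 0" by (simp add: tau_def)

text \<open>psi(phi) is phi plus \<open>psi_fps\<close> evaluated at 1 / phi, and phi = 1 / lambda +
  Phi; the identity psi(phi) = 1 / lambda is thus a fixed point equation for Phi.\<close>

lemma phi_rel_iff: "phi_rel \<Phi> \<longleftrightarrow> - (psi_fps oo tau \<Phi>) = \<Phi>"
proof -
  have s: "fps_nth (psi_fps oo tau \<Phi>) n = (if n = 0 then 0 else \<Sum>j=1..n. psi j * fps_nth (uinv \<Phi> ^ j) (n - j))" for n
  proof (cases "n = 0")
    case False
    have "fps_nth (psi_fps oo tau \<Phi>) n = (\<Sum>j=0..n. fps_nth psi_fps j * fps_nth (uinv \<Phi> ^ j) (n - j))"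
      unfolding fps_compose_nth tau_power by (intro sum.cong) (auto simp: fps_X_power_mult_nth)
    then show ?thesis using False by (simp add: sum.atLeast_Suc_atMost psi_fps_nth)
  qed (simp add: fps_compose_nth psi_fps_nth)
  show ?thesis
    unfolding phi_rel_def fps_eq_iff fps_neg_nth s
    by (auto simp: eq_neg_iff_add_eq_0 add.commute eq_commute[of _ "fps_nth \<Phi> _"])
qed

text \<open>Since tau = lambda / (1 + lambda Phi), coefficient n of the composition involves Phi
  only below n, so the contraction principle gives the unique solution that the description
  \<open>PhiS\<close> asks for.\<close>

lemma phi_rel_PhiS: "- (psi_fps oo tau PhiS) = PhiS"
proof -
  have "\<exists>!\<Phi>. - (psi_fps oo tau \<Phi>) = \<Phi>"
  proof (rule fps_contraction_fixpoint)
    fix f g :: "gtpoly fps" and n assume a: "\<And>i. i < n \<Longrightarrow> fps_nth f i = fps_nth g i"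
    have "fps_nth (tau f) i = fps_nth (tau g) i" if "i < Suc n" for i
      using agree_uinv[of n f g "i - 1"] a that by (cases i) (auto simp: tau_def)
    then have "fps_nth (tau f ^ j) n = fps_nth (tau g ^ j) n" for j by (rule agree_power) auto
    then show "fps_nth (- (psi_fps oo tau f)) n = fps_nth (- (psi_fps oo tau g)) n"
      by (simp add: fps_compose_nth)
  qed
  then have "phi_rel PhiS" unfolding PhiS_def phi_rel_iff by (rule theI')
  then show ?thesis by (simp only: phi_rel_iff)
qed

text \<open>For the actual inverse series, \<open>phu\<close> is u = lambda phi, \<open>phui\<close>
  is 1 / u and \<open>phit\<close> is 1 / phi; composing with \<open>phit\<close> evaluates a series
  in t at mu = phi(lambda).\<close>

definition phu :: "gtpoly fps" where "phu = ufps PhiS"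
definition phui :: "gtpoly fps" where "phui = uinv PhiS"
definition phit :: "gtpoly fps" where "phit = tau PhiS"

lemma phu_phui: "phu * phui = 1" by (simp add: phu_def phui_def ufps_uinv)
lemma phit_0: "fps_nth phit 0 = 0" by (simp add: phit_def tau_nth_0)
lemma phu_eq: "phu = 1 + fps_X * PhiS" by (simp add: phu_def ufps_def)
lemma phu_0: "fps_nth phu 0 = 1" by (simp add: phu_eq)
lemma phit_eq: "phit = fps_X * phui" by (simp add: phit_def tau_def phui_def)
lemma phit_phu: "phit * phu = fps_X" using phu_phui by (simp add: phit_eq mult.assoc mult.commute[of phui])
lemma phui_0: "fps_nth phui 0 = 1" using arg_cong[OF phu_phui, of "\<lambda>f. fps_nth f 0"] by (simp add: phu_0)
lemma phit_1: "fps_nth phit 1 = 1" by (simp add: phit_eq phui_0)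
lemma PhiS_eq: "PhiS = - (psi_fps oo phit)" using phi_rel_PhiS by (simp add: phit_def)
lemma PhiS_0: "fps_nth PhiS 0 = 0"
  unfolding PhiS_eq by (simp add: psi_fps_nth)

lemma phit_nonzero: "phit \<noteq> 0" using phit_1 by auto
lemma phu_nonzero: "phu \<noteq> 0" using phu_0 by auto

lemma compose_mult: "fps_nth b 0 = 0 \<Longrightarrow> (f * g) oo b = (f oo b) * (g oo b)" for f g b :: "gtpoly fps"
  by (rule fps_compose_mult_distrib)

lemma X_compose: "fps_nth b 0 = 0 \<Longrightarrow> fps_X oo b = b" for b :: "gtpoly fps"
  by (rule fps_ext) (simp add: fps_X_fps_compose)

lemma X_power_compose: "fps_nth b 0 = 0 \<Longrightarrow> fps_X ^ n oo b = b ^ n" for b :: "gtpoly fps"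
  by (simp add: fps_compose_power[symmetric] X_compose)

lemma compose_nth_poly:
  fixes b :: "gtpoly fps"
  assumes "fps_nth b 0 = 0" "n \<le> N"
  shows "fps_nth (a oo b) n = fps_nth (\<Sum>i\<le>N. fps_const (fps_nth a i) * b ^ i) n"
proof -
  have "fps_nth (b ^ i) n = 0" if "i > n" for i
    using startsby_zero_power_prefix[OF assms(1)] that by blast
  then have "(\<Sum>i\<le>N. fps_nth a i * fps_nth (b ^ i) n) = (\<Sum>i=0..n. fps_nth a i * fps_nth (b ^ i) n)"
    using assms(2) by (intro sum.mono_neutral_right) auto
  then show ?thesis by (simp add: fps_compose_nth fps_sum_nth)
qed

text \<open>Chain rule, proved on truncations since coefficient n sees finitely many powers of b.
  One more power is kept than needed for n because \<open>fps_deriv\<close> lowers the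
  degree.\<close>

lemma cmap_compose:
  assumes D: "derivation D" and b: "fps_nth b 0 = 0"
  shows "cmap D (a oo b) = (cmap D a oo b) + (fps_deriv a oo b) * cmap D b"
proof (rule fps_ext)
  fix n
  let ?p = "\<Sum>i\<le>Suc n. fps_const (fps_nth a i) * b ^ i"
  let ?q = "\<Sum>i\<le>n. fps_const (fps_nth (fps_deriv a) i) * b ^ i"
  have "cmap D ?p = (\<Sum>i\<le>Suc n. fps_const (fps_nth (cmap D a) i) * b ^ i) + (\<Sum>i\<le>Suc n. fps_const (fps_nth a i) * (of_nat i * b ^ (i - 1))) * cmap D b"
  proof -
    have "cmap D (\<Sum>i\<in>K. f i) = (\<Sum>i\<in>K. cmap D (f i))" for f and K :: "nat set"
      by (induction K rule: infinite_finite_induct) (simp_all add: cmap_simps[OF D])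
    then show ?thesis
      by (simp only: cmap_simps(2,8,11)[OF D] sum.distrib sum_distrib_right mult.assoc cmap_nth)
  qed
  also have "(\<Sum>i\<le>Suc n. fps_const (fps_nth a i) * (of_nat i * b ^ (i - 1))) = ?q"
    by (subst sum.atMost_Suc_shift) (auto simp: fps_of_nat[symmetric] mult_ac intro!: sum.cong)
  finally have e: "cmap D ?p = (\<Sum>i\<le>Suc n. fps_const (fps_nth (cmap D a) i) * b ^ i) + ?q * cmap D b" .
  have "fps_nth (cmap D (a oo b)) n = fps_nth (cmap D ?p) n"
    using compose_nth_poly[OF b, of n "Suc n" a] by simp
  also have "\<dots> = fps_nth (cmap D a oo b) n + fps_nth (?q * cmap D b) n"
    unfolding e fps_add_nth using compose_nth_poly[OF b, of n "Suc n" "cmap D a"] by simp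
  also have "fps_nth (?q * cmap D b) n = fps_nth ((fps_deriv a oo b) * cmap D b) n"
    unfolding fps_mult_nth using compose_nth_poly[OF b, of _ n "fps_deriv a"] by (intro sum.cong) auto
  finally show "fps_nth (cmap D (a oo b)) n = fps_nth ((cmap D a oo b) + (fps_deriv a oo b) * cmap D b) n" by simp
qed

lemma cmap_phui: "derivation D \<Longrightarrow> cmap D phui = - (phui ^ 2 * cmap D phu)"
proof -
  assume D: "derivation D"
  have "0 = cmap D (phu * phui)" by (simp add: phu_phui cmap_simps[OF D])
  then have "phu * cmap D phui = - (phui * cmap D phu)"
    by (simp add: cmap_simps[OF D] eq_neg_iff_add_eq_0 algebra_simps)
  then have "phui * (phu * cmap D phui) = phui * - (phui * cmap D phu)" by simp
  moreover have "phui * (phu * c) = c" for c using phu_phui by (simp add: mult.assoc[symmetric] mult.commute[of phui])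
  ultimately show ?thesis by (simp add: power2_eq_square mult.assoc)
qed

lemma cmap_phu: "derivation D \<Longrightarrow> cmap D phu = fps_X * cmap D PhiS"
  by (simp add: phu_eq cmap_simps)

lemma cmap_phit: "derivation D \<Longrightarrow> cmap D phit = - (phit ^ 2 * cmap D PhiS)"
  by (simp add: phit_eq cmap_simps cmap_phui cmap_phu algebra_simps power2_eq_square)

lemma dpsi_compose_phit: "dpsi_fps oo phit = 1 - phit ^ 2 * (fps_deriv psi_fps oo phit)"
  unfolding dpsi_fps_def by (simp add: fps_compose_sub_distrib compose_mult phit_0 X_power_compose)

text \<open>A field acting on the inverse series \<open>\<psi>\<close> by \<open>\<psi> \<mapsto> - H \<psi>'\<close> acts on \<open>\<phi>\<close> by \<open>\<phi> \<mapsto> H(\<phi>)\<close>.\<close>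

lemma cmap_PhiS:
  assumes D: "derivation D" and psi: "cmap D psi_fps = - (H * dpsi_fps)"
  shows "cmap D PhiS = H oo phit"
proof -
  have "cmap D PhiS = - cmap D (psi_fps oo phit)"
    by (subst PhiS_eq) (simp add: cmap_simps[OF D])
  also have "\<dots> = ((H * dpsi_fps) oo phit) + (fps_deriv psi_fps oo phit) * phit ^ 2 * cmap D PhiS"
    by (simp add: cmap_compose[OF D phit_0] psi cmap_phit[OF D] fps_compose_uminus algebra_simps)
  finally have "cmap D PhiS * (dpsi_fps oo phit) = (H oo phit) * (dpsi_fps oo phit)"
    unfolding dpsi_compose_phit compose_mult[OF phit_0] by (simp add: dpsi_compose_phit algebra_simps)
  moreover have "dpsi_fps oo phit \<noteq> 0"
  proof
    assume "dpsi_fps oo phit = 0"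
    then have "fps_nth (dpsi_fps oo phit) 0 = 0" by simp
    then show False by (simp add: dpsi_nth)
  qed
  ultimately show ?thesis by simp
qed

text \<open>This is lambda^2 phi_lambda.\<close>

definition Wser :: "gtpoly fps" where "Wser = fps_X ^ 2 * fps_deriv PhiS - 1"

text \<open>The derivative of 1 / phi is - phi_lambda / phi^2, multiplied by lambda^2 to stay within
  power series.\<close>

lemma X2_phit_deriv: "fps_X ^ 2 * fps_deriv phit = - (phit ^ 2 * Wser)"
proof -
  have dU: "fps_deriv phu = PhiS + fps_X * fps_deriv PhiS" by (simp add: phu_eq)
  have "fps_deriv phit * phu = 1 - phit * (PhiS + fps_X * fps_deriv PhiS)"
    using arg_cong[OF phit_phu, of fps_deriv] by (simp add: dU algebra_simps)
  then have "fps_X ^ 2 * fps_deriv phit * phu = fps_X * (fps_X - phit * (fps_X * PhiS) - phit * (fps_X ^ 2 * fps_deriv PhiS))"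
    by (simp add: mult.assoc) (simp add: algebra_simps power2_eq_square)
  also have "fps_X * PhiS = phu - 1" by (simp add: phu_eq)
  also have "fps_X ^ 2 * fps_deriv PhiS = Wser + 1" by (simp add: Wser_def)
  also have "fps_X * (fps_X - phit * (phu - 1) - phit * (Wser + 1)) = (phit * phu) * (phit * phu - phit * (phu - 1) - phit * (Wser + 1))"
    by (simp only: phit_phu)
  also have "\<dots> = - (phit ^ 2 * Wser) * phu" by (simp add: algebra_simps power2_eq_square)
  finally show ?thesis by (rule mult_right_cancel[OF phu_nonzero, THEN iffD1])
qed

subsection \<open>The expansion in powers of \<open>\<phi>\<close>\<close>

definition Upow :: "int \<Rightarrow> gtpoly fps" where
  "Upow j = (if j \<ge> 0 then phu ^ nat j else phui ^ nat (- j))"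

lemma Upow_nonzero: "Upow j \<noteq> 0"
  using phu_phui phu_nonzero by (auto simp: Upow_def)

lemma phu_power_I_power: "phu ^ n * phui ^ n = 1"
  by (simp add: phu_phui flip: power_mult_distrib)

lemma Upow_diff: "Upow (j - int i) = Upow j * phui ^ i"
proof (cases "j \<ge> int i")
  case True
  then have "nat j = nat (j - int i) + i" by simp
  then have "Upow j = phu ^ nat (j - int i) * phu ^ i" using True by (simp only: Upow_def power_add) simp
  then have "Upow j * phui ^ i = phu ^ nat (j - int i) * (phu ^ i * phui ^ i)" by (simp only: mult.assoc)
  then show ?thesis using True by (simp add: phu_power_I_power Upow_def)
next
  case False
  show ?thesis
  proof (cases "j \<ge> 0")
    case True
    then have i: "i = nat j + nat (int i - j)" using False by simp
    have "Upow j * phui ^ i = (phu ^ nat j * phui ^ nat j) * phui ^ nat (int i - j)"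
      using True by (subst i) (simp add: Upow_def power_add mult.assoc)
    then show ?thesis using False True by (simp add: phu_power_I_power Upow_def)
  next
    case F: False
    then have "nat (int i - j) = nat (- j) + i" by simp
    then show ?thesis using False F by (simp add: Upow_def power_add)
  qed
qed

lemma phipow_coef_eq: "e + j \<ge> 0 \<Longrightarrow> phipow_coef j e = fps_nth (Upow j) (nat (e + j))"
  by (simp add: phipow_coef_def Let_def Upow_def phu_def phui_def)

lemma Fcoef_eq: "Fcoef n e = (if e < n - 2 then 0 else fps_nth Wser (nat (e - n + 2)))"
proof -
  consider "e < n - 2" | "e = n - 2" | "e = n - 1" | i where "e = n + int i" 
  proof -
    have "e < n - 2 \<or> e = n - 2 \<or> e = n - 1 \<or> e = n + int (nat (e - n))" by linarith
    then show thesis using that by blast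
  qed
  then show ?thesis
  proof cases
    case 4
    then have "nat (e - n + 2) = i + 2" "nat (e - n + 1) = Suc i" by simp_all
    then show ?thesis using 4 by (simp add: Fcoef_def Wser_def fps_X_power_mult_nth phi_def)
  qed (auto simp: Fcoef_def Wser_def fps_X_power_mult_nth)
qed

text \<open>phi^j = lambda^(-j) u^j, so a sum over j up to J is lambda^(-J) u^J times a power series
  in 1 / phi; the factor lambda^(-J) is the shift of e by J.\<close>

lemma expansion_sum:
  fixes c :: "int \<Rightarrow> gtpoly"
  assumes "e + J \<ge> 0"
  shows "(\<Sum>j\<in>{-e..J}. c j * phipow_coef j e) = fps_nth (Upow J * (Abs_fps (\<lambda>i. c (J - int i)) oo phit)) (nat (e + J))"
proof -
  define m where "m = nat (e + J)"
  let ?C = "Abs_fps (\<lambda>i. c (J - int i))"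
  have "(\<Sum>j\<in>{-e..J}. c j * phipow_coef j e) = (\<Sum>i\<le>m. c (J - int i) * phipow_coef (J - int i) e)"
    by (rule sum.reindex_bij_witness[of _ "\<lambda>i. J - int i" "\<lambda>j. nat (J - j)"]) (use assms in \<open>auto simp: m_def\<close>)
  also have "\<dots> = (\<Sum>i\<le>m. c (J - int i) * fps_nth (Upow J * phit ^ i) m)"
  proof (rule sum.cong)
    fix i assume "i \<in> {..m}"
    then have i: "int i \<le> e + J" "i \<le> m" "nat (e + (J - int i)) = m - i" using assms by (auto simp: m_def)
    have "fps_nth (Upow J * phit ^ i) m = fps_nth (fps_X ^ i * Upow (J - int i)) m"
      unfolding Upow_diff phit_eq power_mult_distrib by (simp only: mult_ac)
    then show "c (J - int i) * phipow_coef (J - int i) e = c (J - int i) * fps_nth (Upow J * phit ^ i) m"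
      using i by (simp add: phipow_coef_eq fps_X_power_mult_nth)
  qed simp
  also have "\<dots> = fps_nth (Upow J * (\<Sum>i\<le>m. fps_const (fps_nth ?C i) * phit ^ i)) m"
    by (simp add: sum_distrib_left fps_sum_nth mult.left_commute[of "Upow J"])
  also have "\<dots> = fps_nth (Upow J * (?C oo phit)) m"
    unfolding fps_mult_nth using compose_nth_poly[OF phit_0, of _ m ?C] by (intro sum.cong) auto
  finally show ?thesis by (simp add: m_def)
qed

lemma expansion_iff:
  fixes c :: "int \<Rightarrow> gtpoly"
  shows "(\<forall>e. Fcoef n e = (\<Sum>j\<in>{-e..2 - n}. c j * phipow_coef j e)) \<longleftrightarrow> Wser = Upow (2 - n) * (Abs_fps (\<lambda>i. c (2 - n - int i)) oo phit)"
    (is "?L \<longleftrightarrow> Wser = ?R")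
proof
  assume L: ?L
  show "Wser = ?R"
  proof (rule fps_ext)
    fix m
    have "fps_nth Wser m = Fcoef n (int m + n - 2)" by (simp add: Fcoef_eq)
    then show "fps_nth Wser m = fps_nth ?R m" using L expansion_sum[of "int m + n - 2" "2 - n" c] by simp
  qed
next
  assume R: "Wser = ?R"
  show ?L
  proof
    fix e
    show "Fcoef n e = (\<Sum>j\<in>{-e..2 - n}. c j * phipow_coef j e)"
    proof (cases "e < n - 2")
      case False
      have "Fcoef n e = fps_nth ?R (nat (e - n + 2))" using False R by (simp add: Fcoef_eq)
      then show ?thesis using expansion_sum[of e "2 - n" c] False by (simp add: algebra_simps)
    qed (simp add: Fcoef_eq)
  qed
qed

text \<open>\<open>phit\<close> starts with lambda, so composition with it is unitriangular on
  coefficients.\<close>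

lemma compose_phit_bij: "\<exists>!C. C oo phit = Y"
proof -
  have "\<exists>!C. Y - (C oo phit) + C = C"
  proof (rule fps_contraction_fixpoint)
    fix f g :: "gtpoly fps" and n assume a: "\<And>i. i < n \<Longrightarrow> fps_nth f i = fps_nth g i"
    have Tn: "fps_nth (phit ^ n) n = 1"
      using startsby_zero_power_nth_same[OF phit_0, of n] phit_1 by simp
    have "fps_nth (h oo phit) n = (\<Sum>i<n. fps_nth h i * fps_nth (phit ^ i) n) + fps_nth h n" for h
      by (simp add: fps_compose_nth atLeast0AtMost lessThan_Suc_atMost[symmetric] Tn)
    then show "fps_nth (Y - (f oo phit) + f) n = fps_nth (Y - (g oo phit) + g) n" using a by simp
  qed
  moreover have "Y - (C oo phit) + C = C \<longleftrightarrow> C oo phit = Y" for C by auto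
  ultimately show ?thesis by simp
qed

text \<open>The coefficients are listed from the top index 2 - n downwards, which makes them a power
  series in 1 / phi.\<close>

definition expc :: "int \<Rightarrow> gtpoly fps" where
  "expc n = Abs_fps (\<lambda>i. expansion_coefs n (2 - n - int i))"

text \<open>Dividing by the power of u and inverting the composition with 1 / phi yields exactly one
  coefficient family, so the description \<open>expansion_coefs\<close> has its intended
  meaning.\<close>

lemma expansion_coefs_props:
  shows "j > 2 - n \<Longrightarrow> expansion_coefs n j = 0" and "Fcoef n e = (\<Sum>j\<in>{-e..2 - n}. expansion_coefs n j * phipow_coef j e)"
    and "Wser = Upow (2 - n) * (expc n oo phit)"
proof -
  let ?J = "2 - n"
  have UU: "Upow ?J * Upow (- ?J) = 1"
    using phu_power_I_power[of "nat ?J"] phu_power_I_power[of "nat (- ?J)"] by (simp add: Upow_def mult.commute)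
  obtain C where C: "C oo phit = Upow (- ?J) * Wser" and uniq: "\<And>C'. C' oo phit = Upow (- ?J) * Wser \<Longrightarrow> C' = C"
    using compose_phit_bij by metis
  have eq: "Wser = Upow ?J * (C' oo phit) \<longleftrightarrow> C' = C" for C'
  proof
    assume w: "Wser = Upow ?J * (C' oo phit)"
    have "Upow (- ?J) * Wser = (Upow ?J * Upow (- ?J)) * (C' oo phit)" by (subst w) (simp only: mult_ac)
    then have "C' oo phit = Upow (- ?J) * Wser" by (simp only: UU mult_1)
    then show "C' = C" by (rule uniq)
  next
    assume "C' = C"
    then have "Upow ?J * (C' oo phit) = (Upow ?J * Upow (- ?J)) * Wser" using C by (simp only: mult.assoc)
    then show "Wser = Upow ?J * (C' oo phit)" by (simp only: UU mult_1)
  qed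
  let ?P = "\<lambda>c :: int \<Rightarrow> gtpoly. (\<forall>j>2 - n. c j = 0) \<and> (\<forall>e. Fcoef n e = (\<Sum>j\<in>{-e..2 - n}. c j * phipow_coef j e))"
  have "\<exists>!c. ?P c"
  proof (rule ex1I)
    let ?c = "\<lambda>j. if j > ?J then 0 else fps_nth C (nat (?J - j))"
    show "?P ?c"
    proof -
      have "Abs_fps (\<lambda>i. ?c (?J - int i)) = C" by (rule fps_ext) simp
      then have "Wser = Upow ?J * (Abs_fps (\<lambda>i. ?c (?J - int i)) oo phit)" using eq by blast
      then show ?thesis using expansion_iff[of n ?c] by simp
    qed
  next
    fix c assume c: "?P c"
    then have "Abs_fps (\<lambda>i. c (?J - int i)) = C" using expansion_iff[of n c] eq by blast
    then have ci: "c (?J - int i) = fps_nth C i" for i by (metis fps_nth_Abs_fps)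
    have "j \<le> ?J \<Longrightarrow> c j = fps_nth C (nat (?J - j))" for j using ci[of "nat (?J - j)"] by simp
    then show "c = (\<lambda>j. if j > ?J then 0 else fps_nth C (nat (?J - j)))" using c by auto
  qed
  then have "?P (expansion_coefs n)" unfolding expansion_coefs_def by (rule theI')
  then show "j > 2 - n \<Longrightarrow> expansion_coefs n j = 0" "Fcoef n e = (\<Sum>j\<in>{-e..2 - n}. expansion_coefs n j * phipow_coef j e)"
    "Wser = Upow (2 - n) * (expc n oo phit)"
    using expansion_iff[of n "expansion_coefs n"] by (auto simp: expc_def)
qed

lemma phui_phu_mult: "phui * (phu * c) = c"
  using phu_phui by (simp add: mult.assoc[symmetric] mult.commute[of phui])

lemma cmap_Upow:
  assumes D: "derivation D"
  shows "cmap D (Upow j) = of_int j * (Upow j * (phui * cmap D phu))"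
proof (cases "j \<ge> 0")
  case True
  then obtain n where j: "j = int n" by (metis nonneg_int_cases)
  show ?thesis
  proof (cases n)
    case (Suc i)
    have "phu ^ i * cmap D phu = phu ^ Suc i * (phui * cmap D phu)"
      using phui_phu_mult[of "phu ^ i * cmap D phu"] by (simp add: mult_ac)
    moreover have "Upow j = phu ^ Suc i" unfolding j Suc Upow_def by (simp only: nat_int of_nat_0_le_iff if_True)
    ultimately show ?thesis by (simp add: j Suc cmap_power_Suc[OF D] del: power_Suc)
  qed (simp add: j Upow_def cmap_simps[OF D])
next
  case False
  then obtain n where j: "j = - int (Suc n)" by (metis not_le int_cases of_nat_less_0_iff negative_zless)
  have "phui ^ n * cmap D phui = - (phui ^ Suc n * (phui * cmap D phu))"
    by (simp add: cmap_phui[OF D] power2_eq_square mult_ac)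
  moreover have "Upow j = phui ^ Suc n" using False unfolding j Upow_def by (simp only: minus_minus nat_int if_False)
  ultimately show ?thesis by (simp add: j cmap_power_Suc[OF D] algebra_simps del: power_Suc)
qed

lemma compose_phit_eq_0: "f oo phit = 0 \<Longrightarrow> f = 0"
  using fps_compose_eq_0_iff[OF phit_0] phit_nonzero by blast

lemma cmap_expc_eq:
  assumes D: "derivation D" and W: "cmap D Wser = w * Wser"
  shows "w * (expc n oo phit) = of_int (2 - n) * (phui * cmap D phu) * (expc n oo phit)
    + (cmap D (expc n) oo phit) + (fps_deriv (expc n) oo phit) * cmap D phit"
proof -
  let ?J = "2 - n" and ?C = "expc n"
  have "Upow ?J * (w * (?C oo phit)) = cmap D Wser"
    unfolding W by (subst expansion_coefs_props(3)[of n]) (simp only: mult_ac)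
  also have "\<dots> = cmap D (Upow ?J * (?C oo phit))" by (subst expansion_coefs_props(3)[of n]) simp
  also have "\<dots> = Upow ?J * (of_int ?J * (phui * cmap D phu) * (?C oo phit)
      + (cmap D ?C oo phit) + (fps_deriv ?C oo phit) * cmap D phit)"
    unfolding cmap_simps(2)[OF D] cmap_Upow[OF D] cmap_compose[OF D phit_0] by (simp add: algebra_simps)
  finally show ?thesis using Upow_nonzero[of ?J] by simp
qed

text \<open>Jet derivatives annihilate \<open>psi_fps\<close>, hence phi and all terms of its
  expansions.\<close>

lemma base_expansion_coefs: "base (expansion_coefs n j)"
proof (cases "j > 2 - n")
  case True
  then show ?thesis by (simp add: expansion_coefs_props(1) base_0)
next
  case False
  have "base_fps (expc n)"
    unfolding base_fps_def
  proof (intro allI impI)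
    fix q assume "jet q"
    note D = derivation_pderiv_c[of q]
    have Phi: "cmap (pderiv_c q) PhiS = 0"
      using cmap_PhiS[OF D, of 0] pderiv_jet_psi[OF \<open>jet q\<close>] by simp
    have 0: "cmap (pderiv_c q) Wser = 0 * Wser" "cmap (pderiv_c q) phu = 0" "cmap (pderiv_c q) phit = 0"
      by (simp_all add: Wser_def cmap_simps[OF D] Phi cmap_phu[OF D] cmap_phit[OF D])
    have "cmap (pderiv_c q) (expc n) oo phit = 0"
      using cmap_expc_eq[OF D 0(1), of n] by (simp add: 0(2,3))
    then show "cmap (pderiv_c q) (expc n) = 0" by (rule compose_phit_eq_0)
  qed
  then have "base (fps_nth (expc n) (nat (2 - n - j)))" by (simp add: base_fps_iff)
  then show ?thesis using False by (simp add: expc_def)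
qed

text \<open>\<open>Lop m\<close> takes phi to phi^(1-m) and so multiplies phi_lambda by (1 - m)
  phi^(-m). In the expansion it also takes c_i phi^i to i c_i phi^(i-m) plus the derivative of c_i;
  comparing coefficients of phi^j with i = j + m gives 1 - m - (j + m).\<close>

lemma Lop_expansion_coefs:
  assumes m: "m \<ge> 2"
  shows "Lop m (expansion_coefs n j) = of_int (1 - j - 2 * int m) * expansion_coefs n (j + int m)"
proof (cases "j > 2 - n")
  case True
  then show ?thesis using expansion_coefs_props(1)[of n] by (simp add: derivation_simps(4)[OF derivation_Lop])
next
  case False
  obtain i where mi: "m = Suc (Suc i)" using m by (metis add_2_eq_Suc le_Suc_ex)
  let ?C = "expc n" and ?J = "2 - n"
  note D = derivation_Lop[of m]
  have Phi: "cmap (Lop m) PhiS = phit ^ Suc i"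
    using cmap_PhiS[OF D, of "fps_X ^ Suc i"] cmap_Lop_psi[OF m] by (simp add: mi X_power_compose[OF phit_0] del: power_Suc)
  have dphit: "cmap (Lop m) phit = - (phit ^ Suc m)"
    unfolding cmap_phit[OF D] Phi by (simp add: mi algebra_simps power2_eq_square)
  have dphu: "phui * cmap (Lop m) phu = phit ^ m"
    unfolding cmap_phu[OF D] Phi by (simp add: mi phit_eq algebra_simps)
  have dX: "fps_deriv (phit ^ Suc i) = of_nat (Suc i) * (phit ^ i * fps_deriv phit)"
    by (simp add: fps_deriv_power fps_of_nat[symmetric] mult_ac del: power_Suc)
  have "cmap (Lop m) Wser = of_nat (Suc i) * phit ^ i * (fps_X ^ 2 * fps_deriv phit)"
    by (simp only: Wser_def cmap_simps[OF D] Phi dX) (simp add: mult_ac)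
  also have "\<dots> = - (of_nat (Suc i) * phit ^ m) * Wser"
    unfolding X2_phit_deriv by (simp add: mi power2_eq_square mult_ac)
  finally have W: "cmap (Lop m) Wser = - (of_nat (Suc i) * phit ^ m) * Wser" .
  have "(cmap (Lop m) ?C oo phit) = - (of_nat (Suc i) * phit ^ m) * (?C oo phit) - of_int ?J * phit ^ m * (?C oo phit)
     + (fps_deriv ?C oo phit) * phit ^ Suc m"
    using cmap_expc_eq[OF D W, of n] unfolding dphit dphu by (simp add: algebra_simps)
  also have "\<dots> = of_int (- int (Suc i) - ?J) * (phit ^ m * (?C oo phit)) + (fps_deriv ?C oo phit) * phit ^ Suc m"
    by (simp add: algebra_simps)
  also have "\<dots> = fps_const (of_int (- int (Suc i) - ?J)) * (phit ^ m * (?C oo phit)) + (fps_deriv ?C oo phit) * phit ^ Suc m"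
    by (simp only: fps_of_int)
  also have "\<dots> = (fps_const (of_int (- int (Suc i) - ?J)) * (fps_X ^ m * ?C) + fps_deriv ?C * fps_X ^ Suc m) oo phit"
    by (simp only: fps_compose_add_distrib compose_mult[OF phit_0] X_power_compose[OF phit_0] fps_const_compose)
  finally have "(cmap (Lop m) ?C - (fps_const (of_int (- int (Suc i) - ?J)) * (fps_X ^ m * ?C) + fps_deriv ?C * fps_X ^ Suc m)) oo phit = 0"
    by (simp only: fps_compose_sub_distrib diff_self)
  then have eq: "cmap (Lop m) ?C = fps_const (of_int (- int (Suc i) - ?J)) * (fps_X ^ m * ?C) + fps_X ^ Suc m * fps_deriv ?C"
    using compose_phit_eq_0 by (metis eq_iff_diff_eq_0 mult.commute)
  define l where "l = nat (?J - j)"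
  have j: "j = ?J - int l" using False by (simp add: l_def)
  have "Lop m (expansion_coefs n j) = fps_nth (cmap (Lop m) ?C) l" by (simp add: expc_def j)
  also have "\<dots> = (if l < m then 0 else of_int (1 - j - 2 * int m) * expansion_coefs n (j + int m))"
  proof (cases "l \<le> m")
    case True
    then show ?thesis
      unfolding eq fps_add_nth fps_mult_left_const_nth fps_X_power_mult_nth
      by (cases "l = m") (simp_all add: expc_def j mi algebra_simps)
  next
    case F: False
    then have s: "Suc (l - Suc m) = l - m" "?J - int (l - m) = j + int m" by (simp_all add: j)
    have "fps_nth (cmap (Lop m) ?C) l = of_int (- int (Suc i) - ?J) * fps_nth ?C (l - m) + of_nat (l - m) * fps_nth ?C (l - m)"
      unfolding eq fps_add_nth fps_mult_left_const_nth fps_X_power_mult_nth using F s(1)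
      by (simp del: power_Suc of_nat_Suc)
    also have "\<dots> = of_int (- int (Suc i) - ?J + int (l - m)) * fps_nth ?C (l - m)" by (simp add: algebra_simps)
    also have "- int (Suc i) - ?J + int (l - m) = 1 - j - 2 * int m" using F by (simp add: j mi)
    also have "fps_nth ?C (l - m) = expansion_coefs n (j + int m)" unfolding expc_def fps_nth_Abs_fps s(2) ..
    finally show ?thesis using F by simp
  qed
  also have "\<dots> = of_int (1 - j - 2 * int m) * expansion_coefs n (j + int m)"
    using expansion_coefs_props(1)[of n "j + int m"] by (simp add: j)
  finally show ?thesis .
qed

lemma expansion_coefs_top: "expansion_coefs n (2 - n) = - 1"
proof -
  have "fps_nth (phui ^ i) 0 = 1" "fps_nth (phu ^ i) 0 = 1" for i
    by (induction i) (simp_all add: phui_0 phu_0)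
  then have "fps_nth (Upow j) 0 = 1" for j by (simp add: Upow_def)
  then have "fps_nth Wser 0 = fps_nth (expc n) 0"
    by (subst expansion_coefs_props(3)[of n]) simp
  then show ?thesis by (simp add: Wser_def expc_def)
qed

lemma subst_zero: "subst_gt (\<lambda>_. 0) p = cst (Poly_Mapping.lookup p 0)"
proof (induction p rule: gtpoly_induct_single)
  case (single m c)
  show ?case
  proof (cases "m = 0")
    case False
    then have ne: "Poly_Mapping.keys m \<noteq> {}" by (simp add: keys_eq_empty)
    have "(\<Prod>q\<in>Poly_Mapping.keys m. (0::gtpoly) ^ Poly_Mapping.lookup m q) = 0"
    proof -
      obtain q where "q \<in> Poly_Mapping.keys m" using ne by blast
      then show ?thesis by (intro prod_zero bexI[of _ q]) (auto simp: in_keys_iff)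
    qed
    then show ?thesis using False by (simp add: subst_gt_single lookup_single when_def)
  qed (simp add: subst_gt_single)
qed (simp add: subst_gt_simps lookup_add cst_add)

lemma cmap_subst_gt_compose: "cmap (subst_gt h) (a oo b) = cmap (subst_gt h) a oo cmap (subst_gt h) b"
proof (rule fps_ext)
  fix n
  have "subst_gt h (fps_nth (b ^ i) n) = fps_nth (cmap (subst_gt h) b ^ i) n" for i
    unfolding cmap_subst_gt(10)[symmetric] by simp
  then show "fps_nth (cmap (subst_gt h) (a oo b)) n = fps_nth (cmap (subst_gt h) a oo cmap (subst_gt h) b) n"
    by (simp add: fps_compose_nth subst_gt_sum subst_gt_simps)
qed

text \<open>At the origin of all coordinates phi is 1 / lambda, and lambda^n phi_lambda is -
  phi^(2-n): only the top coefficient has a constant term.\<close>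

lemma expansion_coefs_lookup_0: "j < 2 - n \<Longrightarrow> Poly_Mapping.lookup (expansion_coefs n j) 0 = 0"
proof -
  assume j: "j < 2 - n"
  let ?e = "cmap (subst_gt (\<lambda>_. 0))"
  have "?e psi_fps = 0"
    by (rule fps_ext) (simp add: psi_fps_nth psi_def subst_gt_simps subst_gt_var)
  then have Phi: "?e PhiS = 0"
    using arg_cong[OF PhiS_eq, of ?e] by (simp add: cmap_subst_gt cmap_subst_gt_compose)
  then have u: "?e phu = 1" by (simp add: phu_eq cmap_subst_gt)
  have "?e phu * ?e phui = 1" unfolding cmap_subst_gt(2)[symmetric] phu_phui by (simp add: cmap_subst_gt)
  then have i: "?e phui = 1" using u by simp
  have t: "?e phit = fps_X" by (simp add: phit_eq cmap_subst_gt i)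
  have up: "?e (Upow k) = 1" for k by (simp add: Upow_def cmap_subst_gt u i)
  have "?e Wser = - 1" by (simp add: Wser_def cmap_subst_gt Phi)
  moreover have "?e Wser = ?e (expc n)"
    by (subst expansion_coefs_props(3)[of n]) (simp add: cmap_subst_gt cmap_subst_gt_compose up t)
  ultimately have "fps_nth (?e (expc n)) (nat (2 - n - j)) = fps_nth (- 1) (nat (2 - n - j))" by simp
  then have "cst (Poly_Mapping.lookup (expansion_coefs n j) 0) = 0"
    using j by (simp add: expc_def subst_zero)
  then show ?thesis using cst_mult_eq_0[of _ 1] by fastforce
qed

text \<open>The projection subtracts the nonnegative powers of phi, leaving a series in 1 / phi
  without constant term.\<close>

lemma fcoef_eq:
  assumes "l \<ge> 1"
  shows "fcoef n l = fps_nth (Abs_fps (\<lambda>i. if i = 0 then 0 else expansion_coefs n (- int i)) oo phit) l"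
proof -
  let ?c = "expansion_coefs n" and ?t = "\<lambda>j. expansion_coefs n j * phipow_coef j (int l)"
  have "Fcoef n (int l) = (\<Sum>j\<in>{- int l..2 - n}. ?t j)" by (rule expansion_coefs_props(2))
  also have "\<dots> = (\<Sum>j\<in>{- int l..- 1} \<union> {0..2 - n}. ?t j)"
    by (intro sum.mono_neutral_left) (auto simp: expansion_coefs_props(1))
  also have "\<dots> = (\<Sum>j\<in>{- int l..- 1}. ?t j) + (\<Sum>j\<in>{0..2 - n}. ?t j)"
    by (rule sum.union_disjoint) auto
  finally have "fcoef n l = (\<Sum>j\<in>{- int l..- 1}. ?t j)" by (simp add: fcoef_def)
  also have "\<dots> = (\<Sum>i=1..l. ?c (- int i) * phipow_coef (- int i) (int l))"
    by (rule sum.reindex_bij_witness[of _ "\<lambda>i. - int i" "\<lambda>j. nat (- j)"]) auto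
  also have "\<dots> = (\<Sum>i=1..l. ?c (- int i) * fps_nth (phit ^ i) l)"
  proof (rule sum.cong)
    fix i assume i: "i \<in> {1..l}"
    then have "nat (int l - int i) = l - i" by auto
    then show "?c (- int i) * phipow_coef (- int i) (int l) = ?c (- int i) * fps_nth (phit ^ i) l"
      using i by (simp add: phipow_coef_eq Upow_def phit_eq power_mult_distrib fps_X_power_mult_nth)
  qed simp
  finally show ?thesis by (simp add: fps_compose_nth sum.atLeast_Suc_atMost)
qed

subsection \<open>Identification of the symmetry\<close>

text \<open>Up to sign psi^(n) and phi^(n) differ by a polynomial in earlier coordinates, so they
  can be exchanged one index at a time. This gives uniqueness in the description of
  \<open>Sk\<close>, which prescribes values on phi^(j) only for j at least 4.\<close>

lemma derivation_vanishes_on_phi_imp_psi: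
  assumes D: "derivation D" and low: "\<And>j. j \<in> {1..3} \<Longrightarrow> D (psi j) = 0" and phi: "\<And>j. j \<ge> 4 \<Longrightarrow> D (phi j) = 0"
  shows "cmap D psi_fps = 0"
proof -
  have "D (fps_nth psi_fps n) = 0 \<and> D (fps_nth PhiS n) = 0" for n
  proof (induction n rule: less_induct)
    case (less n)
    note s = derivation_simps[OF D]
    have T: "D (fps_nth phit i) = 0" if "i \<le> n" for i
    proof -
      have "fps_nth (cmap D phit) i = - fps_nth (phit ^ 2 * cmap D PhiS) i"
        by (simp only: cmap_phit[OF D] fps_neg_nth)
      also have "fps_nth (phit ^ 2 * cmap D PhiS) i = 0"
        unfolding fps_mult_nth
      proof (intro sum.neutral ballI)
        fix a assume "a \<in> {0..i}"
        then show "fps_nth (phit ^ 2) a * fps_nth (cmap D PhiS) (i - a) = 0"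
          using less.IH[of "i - a"] that startsby_zero_power_prefix[OF phit_0, of 2] by (cases "a = 0") auto
      qed
      finally show ?thesis by simp
    qed
    then have Tp: "D (fps_nth (phit ^ j) i) = 0" if "i \<le> n" for i j
      using that
    proof (induction j arbitrary: i)
      case (Suc j)
      then show ?case by (simp add: fps_mult_nth derivation_sum[OF D] s)
    qed (simp add: s)
    have Tn: "fps_nth (phit ^ n) n = 1"
      using startsby_zero_power_nth_same[OF phit_0, of n] phit_1 by simp
    have "fps_nth PhiS n = - (\<Sum>i<n. fps_nth psi_fps i * fps_nth (phit ^ i) n) - fps_nth psi_fps n"
      by (subst PhiS_eq) (simp add: fps_compose_nth atLeast0AtMost lessThan_Suc_atMost[symmetric] Tn)
    then have "D (fps_nth PhiS n) = - D (fps_nth psi_fps n)"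
      using less.IH Tp by (simp add: s derivation_sum[OF D])
    moreover have "D (fps_nth psi_fps n) = 0 \<or> D (fps_nth PhiS n) = 0"
    proof (cases "n \<ge> 4")
      case False
      then have "n = 0 \<or> n \<in> {1..3}" by auto
      then show ?thesis using low[of n] by (auto simp: psi_fps_nth s)
    qed (use phi[of n] in \<open>simp add: phi_def\<close>)
    ultimately show ?case by auto
  qed
  then show ?thesis by (simp add: fps_eq_iff)
qed

lemma Sk_eqI:
  assumes V: "V Xc = 0" "V Yc = 0" "\<And>a. V (Zx a) = (vf_app Dx ^^ a) (genZ k)"
     "\<And>a. V (Zxy a) = (vf_app Dx ^^ a) (vf_app Dy (genZ k))"
     "\<And>j. j \<ge> 4 \<Longrightarrow> vf_app V (phi j) =
        fcoef (1 - k) j + fcoef (1 - k) 2 * vf_app Dx (phi j) + fcoef (1 - k) 1 * vf_app Dy (phi j)"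
  shows "Sk k = V"
  unfolding Sk_def
proof (rule the_equality)
  fix W assume W: "W Xc = 0 \<and> W Yc = 0 \<and> (\<forall>a. W (Zx a) = (vf_app Dx ^^ a) (genZ k)) \<and>
     (\<forall>a. W (Zxy a) = (vf_app Dx ^^ a) (vf_app Dy (genZ k))) \<and>
     (\<forall>j\<ge>4. vf_app W (phi j) =
        fcoef (1 - k) j + fcoef (1 - k) 2 * vf_app Dx (phi j) + fcoef (1 - k) 1 * vf_app Dy (phi j))"
  let ?D = "\<lambda>p. vf_app W p - vf_app V p"
  have D: "derivation ?D" by (intro derivation_minus derivation_vf_app)
  have "cmap ?D psi_fps = 0"
  proof (rule derivation_vanishes_on_phi_imp_psi[OF D])
    fix j :: nat assume "j \<in> {1..3}"
    then have "j = 1 \<or> j = 2 \<or> j = 3" by auto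
    then show "?D (psi j) = 0"
      using W V by (auto simp: psi_def vf_app_var derivation_simps[OF derivation_vf_app])
  qed (use W V in simp)
  then have "?D (var q) = 0" for q
    using derivation_ext_psi[OF D derivation_zero, of "var q"] W V by (simp add: vf_app_var fps_eq_iff)
  then show "W = V" by (simp add: vf_app_var fun_eq_iff)
qed (use V in blast)

text \<open>1 / phi = lambda + y lambda^3 + ..., because phi^(1) = -y and u has no linear
  term.\<close>

lemma compose_phit_nth_123:
  assumes "fps_nth f 0 = 0"
  shows "fps_nth (f oo phit) 1 = fps_nth f 1" "fps_nth (f oo phit) 2 = fps_nth f 2"
    "fps_nth (f oo phit) 3 = fps_nth f 3 + var Yc * fps_nth f 1"
proof -
  have P1: "fps_nth PhiS 1 = - var Yc"
    by (subst PhiS_eq) (simp add: fps_compose_nth psi_fps_nth psi_def phit_1[simplified])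
  have u: "fps_nth phu 1 = 0" "fps_nth phu 2 = - var Yc" using P1 by (simp_all add: phu_eq PhiS_0 numeral_2_eq_2)
  have "fps_nth (phu * phui) 1 = 0" "fps_nth (phu * phui) 2 = 0" by (simp_all add: phu_phui)
  then have i: "fps_nth phui 1 = 0" "fps_nth phui 2 = var Yc"
    using u by (simp_all add: fps_mult_nth phu_0 phui_0 numeral_2_eq_2 sum.atLeast0_atMost_Suc)
  have t: "fps_nth phit 1 = 1" "fps_nth phit 2 = 0" "fps_nth phit 3 = var Yc"
    using i by (simp_all add: phit_eq phui_0 numeral_2_eq_2 numeral_3_eq_3)
  have p: "fps_nth (phit ^ j) n = (if n < j then 0 else fps_nth (phui ^ j) (n - j))" for j n
    by (simp only: phit_eq power_mult_distrib fps_X_power_mult_nth)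
  have "fps_nth (phui ^ 2) 0 = 1" "fps_nth (phui ^ 2) 1 = 0" "fps_nth (phui ^ 3) 0 = 1"
    using i by (simp_all add: power2_eq_square power3_eq_cube fps_mult_nth_1 phui_0)
  then have t2: "fps_nth (phit ^ 2) 1 = 0" "fps_nth (phit ^ 2) 2 = 1" "fps_nth (phit ^ 2) 3 = 0" "fps_nth (phit ^ 3) 3 = 1"
    by (simp_all add: p)
  show "fps_nth (f oo phit) 1 = fps_nth f 1" "fps_nth (f oo phit) 2 = fps_nth f 2"
    "fps_nth (f oo phit) 3 = fps_nth f 3 + var Yc * fps_nth f 1"
    using assms t t2 by (simp_all add: fps_compose_nth numeral_2_eq_2 numeral_3_eq_3 sum.atLeast0_atMost_Suc algebra_simps)
qed

locale gt_weighted_symmetry = gt_symmetry +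
  fixes k :: int
  assumes weight: "poly_vf_of_weight k S"
begin

lemma wt_F: "fps_hom_deg wt 1 (k + 1) F"
proof -
  have S: "hom_deg wt (wt q + k) (VS (var q))" for q
    using weight by (simp add: poly_vf_of_weight_def homogeneous_iff vf_app_var)
  have Z: "hom_deg wt (4 + k) Z" using S[of "Zx 0"] by (simp add: vf_app_var Z_def)
  have P: "fps_hom_deg wt 1 (k + 1) P"
    unfolding fps_hom_deg_def
  proof
    fix n
    show "hom_deg wt (1 * int n + (k + 1)) (fps_nth P n)"
      using hom_deg_derivation[OF derivation_vf_app S wt_psi[of n]]
      by (cases "n = 0") (simp_all add: P_def psi_fps_nth derivation_simps(4)[OF derivation_vf_app] algebra_simps)
  qed
  have u: "hom_deg wt (k + 3) (du Z)" and v: "hom_deg wt (k + 2) (dv Z)"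
    using hom_deg_pderiv_c[OF Z, of "Zx (Suc 0)"] hom_deg_pderiv_c[OF Z, of "Zxy 0"] by (simp_all add: algebra_simps)
  have x: "fps_hom_deg wt 1 (k + 1) (fps_const (du Z) * x_fps)" and y: "fps_hom_deg wt 1 (k + 1) (fps_const (dv Z) * y_fps)"
    using fps_hom_deg_mult[OF fps_hom_deg_const[OF u] wt_x_fps] fps_hom_deg_mult[OF fps_hom_deg_const[OF v] wt_y_fps]
    by (simp_all add: algebra_simps)
  have d0: "fps_nth dpsi_fps 0 = 1" by (simp add: dpsi_nth)
  have "dpsi_fps * fps_right_inverse dpsi_fps 1 = 1" by (rule fps_right_inverse) (simp add: d0)
  then have "fps_hom_deg wt 1 0 (fps_right_inverse dpsi_fps 1)" by (rule fps_hom_deg_inverse[OF wt_dpsi_fps d0])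
  then show ?thesis
    unfolding F_def using fps_hom_deg_mult[OF fps_hom_deg_diff[OF fps_hom_deg_add[OF x y] P]] by fastforce
qed

definition G :: "int \<Rightarrow> gtpoly" where "G = witt_ext (fps_nth F)"

lemma Lop_G: "m \<ge> 2 \<Longrightarrow> Lop m (G d) = of_int (1 - d - 2 * int m) * G (d + int m)"
  unfolding G_def by (rule Lop_witt_ext) (use F_relations in auto)

lemma base_G: "base (G d)"
  using base_F unfolding G_def witt_ext_def base_fps_iff
  by (auto intro!: base_minus base_mult base_cst base_Lop)

lemma wt_G: "hom_deg wt (k + 1 - d) (G d)"
proof -
  have F: "hom_deg wt (int n + (k + 1)) (fps_nth F n)" for n using fps_hom_deg_nth[OF wt_F, of n] by simp
  consider "d < 0" | "d = 0" | "d > 0" by linarith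
  then show ?thesis
  proof cases
    case 1
    then show ?thesis using F[of "nat (- d)"] by (simp add: G_def witt_ext_def algebra_simps)
  next
    case 2
    then show ?thesis using wt_Lop[of 2, OF _ F[of 2]] by (simp add: G_def witt_ext_def hom_deg_minus add.commute)
  next
    case 3
    have "hom_deg wt (int 1 + (k + 1) - int (nat d + 1)) (Lop (nat d + 1) (fps_nth F 1))"
      by (rule wt_Lop[OF _ F]) (use 3 in simp)
    moreover have "int 1 + (k + 1) - int (nat d + 1) = k + 1 - d" using 3 by simp
    ultimately have "hom_deg wt (k + 1 - d) (Lop (nat d + 1) (fps_nth F 1))" by (simp only:)
    then show ?thesis using 3 by (simp add: G_def witt_ext_def hom_deg_cst_mult)
  qed
qed

text \<open>G_j has weight k + 1 - j. It vanishes above k + 1 and is constant at k + 1; going down,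
  the difference of the two families is annihilated by all \<open>Lop m\<close>, hence constant, and
  its constant term is zero by weight and by \<open>expansion_coefs_lookup_0\<close>.\<close>

lemma G_proportional: "\<exists>g. \<forall>j. G j = cst g * expansion_coefs (1 - k) j"
proof -
  \<comment> \<open>The sign compensates the top expansion coefficient, which is -1.\<close>
  define g where "g = - Poly_Mapping.lookup (G (k + 1)) 0"
  let ?c = "expansion_coefs (1 - k)"
  have above: "G j = 0" if "j > k + 1" for j
    using base_wt_nonneg[OF base_G wt_G] that by simp
  have "Lop m (G (k + 1)) = 0" if "m \<ge> 2" for m
    using Lop_G[OF that, of "k + 1"] above[of "k + 1 + int m"] that by simp
  then have top: "G (k + 1) = cst (- g)"
    using base_Lop_const[OF base_G] by (simp add: g_def)
  have "G (k + 1 - int i) = cst g * ?c (k + 1 - int i)" for i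
  proof (induction i rule: less_induct)
    case (less i)
    let ?j = "k + 1 - int i"
    have above': "G j = cst g * ?c j" if "j > ?j" for j
    proof (cases "j > k + 1")
      case True
      then show ?thesis using above expansion_coefs_props(1)[of "1 - k" j] by simp
    next
      case False
      then show ?thesis using less[of "nat (k + 1 - j)"] that by simp
    qed
    show ?case
    proof (cases "i = 0")
      case True
      then show ?thesis using top expansion_coefs_top[of "1 - k"] by (simp add: cst_minus add.commute)
    next
      case False
      let ?d = "G ?j - cst g * ?c ?j"
      have "Lop m ?d = 0" if "m \<ge> 2" for m
        using Lop_G[OF that, of ?j] Lop_expansion_coefs[OF that, of "1 - k" ?j] above'[of "?j + int m"] that
        by (simp add: derivation_simps(7)[OF derivation_Lop] derivation_cmult[OF derivation_Lop] mult.left_commute)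
      moreover have "base ?d"
        using base_add[OF base_G base_minus[OF base_mult[OF base_cst base_expansion_coefs]]] by simp
      ultimately have d: "?d = cst (Poly_Mapping.lookup ?d 0)" by (intro base_Lop_const)
      have l: "Poly_Mapping.lookup (cst c * p) 0 = c * Poly_Mapping.lookup p 0" for c p
        by (induction p rule: gtpoly_induct_single) (simp_all add: cst_def mult_single lookup_add algebra_simps lookup_single when_def)
      have "Poly_Mapping.lookup ?d 0 = 0"
        using expansion_coefs_lookup_0[of ?j "1 - k"] hom_wt_lookup_0[OF wt_G, of ?j] False
        by (simp add: lookup_minus l)
      then show ?thesis using d by simp
    qed
  qed
  then have le: "G (k + 1 - int i) = cst g * ?c (k + 1 - int i)" for i .
  have "G j = cst g * ?c j" for j
  proof (cases "j > k + 1")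
    case True
    then show ?thesis using above[of j] expansion_coefs_props(1)[of "1 - k" j] by simp
  next
    case False
    then show ?thesis using le[of "nat (k + 1 - j)"] by simp
  qed
  then show ?thesis by blast
qed

lemma symmetry_proportional: "\<exists>c. \<forall>q. S q = cst c * Sk k q"
proof -
  let ?f = "fcoef (1 - k)"
  obtain g where g: "\<And>j. G j = cst g * expansion_coefs (1 - k) j" using G_proportional by blast
  let ?N = "Abs_fps (\<lambda>i. if i = 0 then 0 else expansion_coefs (1 - k) (- int i))"
  have F: "F = fps_const (cst g) * ?N"
  proof (rule fps_ext)
    fix n
    show "fps_nth F n = fps_nth (fps_const (cst g) * ?N) n"
    proof (cases "n = 0")
      case False
      then have "G (- int n) = fps_nth F n" by (simp add: G_def witt_ext_def)
      then show ?thesis using g[of "- int n"] False by simp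
    qed (simp add: F_nth_0)
  qed
  have Fl: "fps_nth (F oo phit) l = cst g * ?f l" if "l \<ge> 1" for l
    unfolding fcoef_eq[OF that] F compose_mult[OF phit_0] fps_const_compose by simp
  \<comment> \<open>The coefficients of t, t^2 and t^3 in \<open>P_eq\<close>, where P has the
    values 0, 0 and Z.\<close>
  have C: "dv Z = fps_nth F 1" "du Z = fps_nth F 2" "Z = du Z * zx + dv Z * zy - fps_nth F 3"
  proof -
    have dF: "fps_nth (dpsi_fps * F) 1 = fps_nth F 1" "fps_nth (dpsi_fps * F) 2 = fps_nth F 2"
      "fps_nth (dpsi_fps * F) 3 = fps_nth F 3 - var Yc * fps_nth F 1"
      using F_nth_0 by (simp_all add: fps_mult_nth dpsi_nth numeral_2_eq_2 numeral_3_eq_3 sum.atLeast0_atMost_Suc psi_def)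
    have P: "fps_nth P n = du Z * fps_nth x_fps n + dv Z * fps_nth y_fps n - fps_nth (dpsi_fps * F) n" for n
      by (subst P_eq) simp
    show "dv Z = fps_nth F 1" using P[of 1] P_nth_012[of 1] dF by (simp add: x_fps_nth y_fps_nth)
    then have v: "fps_nth F 1 = dv Z" by simp
    show "du Z = fps_nth F 2" using P[of 2] P_nth_012[of 2] dF by (simp add: x_fps_nth y_fps_nth Xk_2)
    show "Z = du Z * zx + dv Z * zy - fps_nth F 3"
      using P[of 3] P_nth_3 dF(3) unfolding v by (simp add: x_fps_nth y_fps_nth Xk_3 Yk_3 algebra_simps)
  qed
  have f: "dv Z = cst g * ?f 1" "du Z = cst g * ?f 2" "fps_nth F 3 = cst g * ?f 3 - var Yc * (cst g * ?f 1)"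
    using C Fl[of 1] Fl[of 2] Fl[of 3] compose_phit_nth_123[OF F_nth_0] by (simp_all add: algebra_simps)
  have Z: "Z = cst g * genZ k"
    by (subst C(3)) (simp add: f genZ_def Let_def algebra_simps)
  have SZx: "S (Zx a) = cst g * (DX ^^ a) (genZ k)" for a
  proof (induction a)
    case 0
    then show ?case using Z by (simp add: Z_def)
  next
    case (Suc a)
    have e: "S (Zx (Suc a)) = VS (DX (var (Zx a)))" by (simp add: vf_app_var Dx_def)
    show ?case unfolding e VS_DX by (simp add: Suc vf_app_var derivation_cmult[OF derivation_vf_app])
  qed
  have SZxy: "S (Zxy a) = cst g * (DX ^^ a) (DY (genZ k))" for a
  proof (induction a)
    case 0
    have "S (Zxy 0) = VS zy" by (simp add: zy_def vf_app_var)
    then show ?case by (simp add: VS_zy Z derivation_cmult[OF derivation_vf_app])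
  next
    case (Suc a)
    have e: "S (Zxy (Suc a)) = VS (DX (var (Zxy a)))" by (simp add: vf_app_var Dx_def)
    show ?case unfolding e VS_DX by (simp add: Suc vf_app_var derivation_cmult[OF derivation_vf_app])
  qed
  have Sphi: "VS (phi j) = cst g * (?f j + ?f 2 * DX (phi j) + ?f 1 * DY (phi j))" if "j \<ge> 4" for j
  proof -
    \<comment> \<open>After removal of its D_x and D_y parts, S acts on psi by - F psi' and
      therefore on phi by F(phi).\<close>
    let ?D = "\<lambda>p. VS p - (du Z * DX p + dv Z * DY p)"
    have D: "derivation ?D" by (intro derivation_minus derivation_plus derivation_scale derivation_vf_app)
    have "cmap ?D psi_fps = P - (fps_const (du Z) * x_fps + fps_const (dv Z) * y_fps)"
      unfolding cmap_minus cmap_plus cmap_scale cmap_Dx_psi cmap_Dy_psi P_def[symmetric] ..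
    also have "\<dots> = - (F * dpsi_fps)" by (subst P_eq) (simp add: mult.commute)
    finally have "cmap ?D PhiS = F oo phit" by (rule cmap_PhiS[OF D])
    from arg_cong[OF this, of "\<lambda>h. fps_nth h j"] have "?D (phi j) = cst g * ?f j"
      using Fl[of j] that by (simp add: phi_def)
    then show ?thesis using f(1,2) by (simp add: algebra_simps)
  qed
  show ?thesis
  proof (cases "g = 0")
    \<comment> \<open>Here F, and with it P and Z, vanish; so S is zero and c = 0 works whatever
      field \<open>Sk k\<close> denotes.\<close>
    case True
    then have "F = 0" using F by simp
    then have "P = 0" using P_eq f True by simp
    moreover have "fps_nth P (n + 4) = S (Psi n)" for n
      by (simp add: P_def psi_fps_nth psi_def vf_app_var)
    ultimately have "S (Psi n) = 0" for n by (metis fps_zero_nth)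
    then have "S q = 0" for q
      using SZx SZxy VS_x_y True by (cases q) (simp_all add: vf_app_var)
    then show ?thesis by (intro exI[of _ 0]) simp
  next
    case False
    \<comment> \<open>S / g satisfies the conditions describing \<open>Sk k\<close>, so it supplies
      existence as well as the identification.\<close>
    define V where "V q = cst (1 / g) * S q" for q
    have inv: "cst (1 / g) * (cst g * p) = p" for p using False by (simp flip: mult.assoc cst_mult)
    have V: "vf_app V p = cst (1 / g) * VS p" for p
      by (simp add: vf_app_def V_def sum_distrib_left mult.assoc)
    have "Sk k = V"
      by (rule Sk_eqI) (use SZx SZxy VS_x_y Sphi in \<open>simp_all add: V inv, simp_all add: V_def inv vf_app_var\<close>)
    then have "S q = cst g * Sk k q" for q
      using False by (simp add: V_def flip: mult.assoc cst_mult)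
    then show ?thesis by blast
  qed
qed

end

theorem mainTheorem3:
  fixes k :: int and S :: vfield
  assumes "k \<ge> -4"
    and "nonlocal_symmetry S"
    and "poly_vf_of_weight k S"
  shows "\<exists>c::real. \<forall>q. S q = cst c * Sk k q"
proof -
  interpret gt_weighted_symmetry S k
    by unfold_locales (use assms in auto)
  show ?thesis by (rule symmetry_proportional)
qed

end
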